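(* Let $\vec{U}\in\dot{H}^1(\mathbb{R}^3)$ be a weak solution of the steady-state Navier-Stokes equations on $\mathbb{R}^3$, $$-\Delta \vec{U} + (\vec{U}\cdot\vec{\nabla})\vec{U} + \vec{\nabla}P = 0, \qquad \operatorname{div}(\vec{U}) = 0 .$$ If $\widehat{\vec{U}}\in L^r_{loc}(\mathbb{R}^3)$ for some $r>6$, then $\vec{U}=0$.
   Context: Here $\vec{U}=(U_1,U_2,U_3)$ is an $\mathbb{R}^3$-valued velocity field on $\mathbb{R}^3$, $P$ is a pressure, and $\widehat{\vec{U}}$ is the (componentwise) Fourier transform of $\vec{U}$. The space $\dot{H}^1(\mathbb{R}^3)$ is the space of tempered distributions $g$ such that $\widehat{g}\in L^1_{loc}(\mathbb{R}^3)$ and $\int_{\mathbb{R}^3}|\xi|^2|\widehat{g}(\xi)|^2\,d\xi<+\infty$; membership of a vector field is understood componentwise. That $\vec{U}\in\dot{H}^1(\mathbb{R}^3)$ is a weak solution means that $\vec{U}$ verifies the equations (with some pressure $P$) in the sense of distributions; no further smoothness of $\vec{U}$ is assumed. *)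

theory Defs
  imports "HOL-Analysis.Analysis"
begin

subsection \<open>Smooth functions, test functions and Schwartz functions\<close>

definition partial_deriv :: "'n::finite \<Rightarrow> (real^'n \<Rightarrow> complex) \<Rightarrow> real^'n \<Rightarrow> complex" where
  "partial_deriv i f x = frechet_derivative f (at x) (axis i 1)"

text \<open>A multi-index is a list of directions; every multi-index of order \<open>k\<close> is represented by
  at least one list of length \<open>k\<close>.\<close>

fun partial_derivs :: "'n::finite list \<Rightarrow> (real^'n \<Rightarrow> complex) \<Rightarrow> real^'n \<Rightarrow> complex" where
  "partial_derivs [] f = f"
| "partial_derivs (i # \<alpha>) f = partial_deriv i (partial_derivs \<alpha> f)"

text \<open>Differentiability of all iterated partial derivatives makes each of them continuous, so this
  is the class of infinitely differentiable functions.\<close>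

definition smooth :: "(real^'n::finite \<Rightarrow> complex) \<Rightarrow> bool" where
  "smooth f \<longleftrightarrow> (\<forall>\<alpha> x. partial_derivs \<alpha> f differentiable (at x))"

definition test_functions :: "(real^'n::finite \<Rightarrow> complex) set" where
  "test_functions = {\<phi>. smooth \<phi> \<and> compact (closure {x. \<phi> x \<noteq> 0})}"

definition schwartz :: "(real^'n::finite \<Rightarrow> complex) set" where
  "schwartz = {\<phi>. smooth \<phi> \<and>
     (\<forall>k \<alpha>. \<exists>C. \<forall>x. (1 + norm x) ^ k * norm (partial_derivs \<alpha> \<phi> x) \<le> C)}"

subsection \<open>Distributions\<close>

text \<open>Functionals are total HOL functions. Only their values on test functions (for
  distributions) or on Schwartz functions (for tempered distributions) are meaningful.\<close>

type_synonym 'n functional = "(real^'n \<Rightarrow> complex) \<Rightarrow> complex"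

definition linear_functional_on :: "(real^'n::finite \<Rightarrow> complex) set \<Rightarrow> 'n functional \<Rightarrow> bool" where
  "linear_functional_on S T \<longleftrightarrow>
     (\<forall>\<phi>\<in>S. \<forall>\<psi>\<in>S. \<forall>a b. T (\<lambda>x. a * \<phi> x + b * \<psi> x) = a * T \<phi> + b * T \<psi>)"

definition Ck_norm :: "nat \<Rightarrow> (real^'n::finite \<Rightarrow> complex) \<Rightarrow> real" where
  "Ck_norm k \<phi> =
     (SUP (\<alpha>, x)\<in>{\<alpha>. length \<alpha> \<le> k} \<times> UNIV. norm (partial_derivs \<alpha> \<phi> x))"

definition schwartz_norm :: "nat \<Rightarrow> (real^'n::finite \<Rightarrow> complex) \<Rightarrow> real" where
  "schwartz_norm k \<phi> =
     (SUP (\<alpha>, x)\<in>{\<alpha>. length \<alpha> \<le> k} \<times> UNIV.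
        (1 + norm x) ^ k * norm (partial_derivs \<alpha> \<phi> x))"

definition is_distribution :: "'n::finite functional \<Rightarrow> bool" where
  "is_distribution T \<longleftrightarrow> linear_functional_on test_functions T \<and>
     (\<forall>K. compact K \<longrightarrow> (\<exists>C k. \<forall>\<phi>\<in>test_functions.
        {x. \<phi> x \<noteq> 0} \<subseteq> K \<longrightarrow> norm (T \<phi>) \<le> C * Ck_norm k \<phi>))"

definition tempered_distribution :: "'n::finite functional \<Rightarrow> bool" where
  "tempered_distribution T \<longleftrightarrow> linear_functional_on schwartz T \<and>
     (\<exists>C k. \<forall>\<phi>\<in>schwartz. norm (T \<phi>) \<le> C * schwartz_norm k \<phi>)"

definition real_valued :: "'n::finite functional \<Rightarrow> bool" where
  "real_valued T \<longleftrightarrow> (\<forall>\<phi>\<in>schwartz. (\<forall>x. \<phi> x \<in> \<real>) \<longrightarrow> T \<phi> \<in> \<real>)"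

definition distr_deriv :: "'n::finite \<Rightarrow> 'n functional \<Rightarrow> 'n functional" where
  "distr_deriv i T \<phi> = - T (partial_deriv i \<phi>)"

definition distr_laplacian :: "'n::finite functional \<Rightarrow> 'n functional" where
  "distr_laplacian T \<phi> = (\<Sum>i\<in>UNIV. distr_deriv i (distr_deriv i T) \<phi>)"

definition fourier :: "(real^'n::finite \<Rightarrow> complex) \<Rightarrow> real^'n \<Rightarrow> complex" where
  "fourier \<phi> \<xi> = (LINT x|lebesgue. cis (- (x \<bullet> \<xi>)) * \<phi> x)"

definition distr_fourier :: "'n::finite functional \<Rightarrow> 'n functional" where
  "distr_fourier T \<phi> = T (fourier \<phi>)"

subsection \<open>Distributions given by functions\<close>

definition locally_Lp :: "real \<Rightarrow> (real^'n::finite \<Rightarrow> complex) \<Rightarrow> bool" where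
  "locally_Lp p f \<longleftrightarrow> f \<in> borel_measurable lebesgue \<and>
     (\<forall>K. compact K \<longrightarrow> set_integrable lebesgue K (\<lambda>x. norm (f x) powr p))"

definition represented_by :: "'n::finite functional \<Rightarrow> (real^'n \<Rightarrow> complex) \<Rightarrow> bool" where
  "represented_by T f \<longleftrightarrow> locally_Lp 1 f \<and>
     (\<forall>\<phi>\<in>test_functions. T \<phi> = (LINT x|lebesgue. f x * \<phi> x))"

definition in_Lp_loc :: "real \<Rightarrow> 'n::finite functional \<Rightarrow> bool" where
  "in_Lp_loc p T \<longleftrightarrow> (\<exists>f. represented_by T f \<and> locally_Lp p f)"

definition Hdot1 :: "'n::finite functional set" where
  "Hdot1 = {T. tempered_distribution T \<and>
     (\<exists>h. represented_by (distr_fourier T) h \<and>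
          integrable lebesgue (\<lambda>\<xi>. (norm \<xi>)\<^sup>2 * (norm (h \<xi>))\<^sup>2))}"

text \<open>The product of two distributions is defined when both factors are locally integrable
  functions with a locally integrable pointwise product. The representing functions are unique
  almost everywhere, so \<open>R\<close> is determined on test functions.\<close>

definition is_distr_product :: "'n::finite functional \<Rightarrow> 'n functional \<Rightarrow> 'n functional \<Rightarrow> bool" where
  "is_distr_product S T R \<longleftrightarrow>
     (\<exists>f g. represented_by S f \<and> represented_by T g \<and> represented_by R (\<lambda>x. f x * g x))"

subsection \<open>The steady-state Navier-Stokes equations\<close>

text \<open>\<open>N i j\<close> is the distribution \<open>U\<^sub>j \<partial>\<^sub>j U\<^sub>i\<close>. On three-dimensional space these products exist for
  every \<open>U\<close> with components in \<open>Hdot1\<close>: there \<open>U\<^sub>j\<close> is in \<open>L\<^sup>6\<close> and \<open>\<partial>\<^sub>j U\<^sub>i\<close> is in \<open>L\<^sup>2\<close>.\<close>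

definition weak_steady_NS :: "(3 \<Rightarrow> 3 functional) \<Rightarrow> bool" where
  "weak_steady_NS U \<longleftrightarrow>
     (\<exists>P N. is_distribution P \<and>
        (\<forall>i j. is_distr_product (U j) (distr_deriv j (U i)) (N i j)) \<and>
        (\<forall>i. \<forall>\<phi>\<in>test_functions.
           - distr_laplacian (U i) \<phi> + (\<Sum>j\<in>UNIV. N i j \<phi>) + distr_deriv i P \<phi> = 0)) \<and>
     (\<forall>\<phi>\<in>test_functions. (\<Sum>i\<in>UNIV. distr_deriv i (U i) \<phi>) = 0)"

end

theory Submission
  imports Defs
begin

text \<open>Local integrability to a power above 6 is only used near frequency zero, where it makes the
  Fourier transform of \<open>U i\<close> square integrable; so \<open>U i\<close> has a density \<open>H i\<close> on the Fourier side
  with \<open>(1 + norm \<xi>) * H i \<xi>\<close> square integrable. Products become convolutions, and taking the curl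
  of the equation removes the pressure: the vector \<open>A \<xi>\<close> with components
  \<open>(norm \<xi>)\<^sup>2 * H i \<xi> + c * (\<Sum>j. convolution (H j) (\<lambda>\<eta>. \<i> * \<eta>\<^sub>j * H i \<eta>) \<xi>)\<close> is parallel to \<open>\<xi>\<close>,
  whereas \<open>H \<xi>\<close> is orthogonal to \<open>\<xi>\<close>. Pairing the two expresses the integral of
  \<open>(norm \<xi>)\<^sup>2 * (norm (H \<xi>))\<^sup>2\<close> by a trilinear form in \<open>H\<close>. The form converges absolutely, because
  \<open>1 / (1 + norm \<xi>) ^ 4\<close> is integrable in dimension three, and its real part vanishes, because \<open>H\<close> is
  divergence free and Hermitian.\<close>

subsection \<open>Partial derivatives and smooth functions\<close>

text \<open>Two obstacles shape the proof. Neither the pressure nor the equation may be Fourier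
  transformed directly: \<open>P\<close> is an arbitrary distribution, and the equation is known
  only on test functions, whose inverse transforms do not have compact support unless they vanish.
  Densities are therefore always paired with \<open>inverse_fourier \<phi>\<close> for a test
  function \<open>\<phi>\<close>, and the pressure disappears before any transform is taken, because
  mixed second derivatives of \<open>\<phi>\<close> commute. The other obstacle is that pairing the
  equation with the field itself produces a cubic term. Square integrability at low frequencies
  places the field in the inhomogeneous Sobolev space of order one, and the cubic term is then
  controlled by the weights of the two factors that carry no derivative. The constant
  \<open>c\<close> is the factor of the convolution theorem, the inverse of
  \<open>inversion_const\<close>; it is real and multiplies a purely imaginary integral, so its
  value never enters.\<close>

lemma partial_deriv_eq:
  assumes "(f has_derivative D) (at x)"
  shows "partial_deriv i f x = D (axis i 1)"
  using frechet_derivative_at[OF assms] by (simp add: partial_deriv_def)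

lemma partial_deriv_add:
  assumes "\<And>x. f differentiable (at x)" "\<And>x. g differentiable (at x)"
  shows "partial_deriv i (\<lambda>x. f x + g x) = (\<lambda>x. partial_deriv i f x + partial_deriv i g x)"
proof
  fix x
  from assms have "(f has_derivative frechet_derivative f (at x)) (at x)"
    "(g has_derivative frechet_derivative g (at x)) (at x)"
    by (simp_all add: frechet_derivative_works)
  from partial_deriv_eq[OF has_derivative_add[OF this]]
  show "partial_deriv i (\<lambda>x. f x + g x) x = partial_deriv i f x + partial_deriv i g x"
    by (simp add: partial_deriv_def)
qed

lemma partial_deriv_mult:
  fixes f g :: "real^'n::finite \<Rightarrow> complex"
  assumes "\<And>x. f differentiable (at x)" "\<And>x. g differentiable (at x)"
  shows "partial_deriv i (\<lambda>x. f x * g x) = (\<lambda>x. partial_deriv i f x * g x + f x * partial_deriv i g x)"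
proof
  fix x
  from assms have "(f has_derivative frechet_derivative f (at x)) (at x)"
    "(g has_derivative frechet_derivative g (at x)) (at x)"
    by (simp_all add: frechet_derivative_works)
  from partial_deriv_eq[OF has_derivative_mult[OF this]]
  show "partial_deriv i (\<lambda>x. f x * g x) x = partial_deriv i f x * g x + f x * partial_deriv i g x"
    by (simp add: partial_deriv_def)
qed

lemma partial_deriv_const [simp]: "partial_deriv i (\<lambda>x. c) = (\<lambda>x. 0)"
  by (rule ext, subst partial_deriv_eq[OF has_derivative_const]) simp

lemma partial_deriv_scaleR:
  fixes f :: "real^'n::finite \<Rightarrow> complex"
  assumes "\<And>x. f differentiable (at x)"
  shows "partial_deriv i (\<lambda>x. f (c *\<^sub>R x)) = (\<lambda>x. of_real c * partial_deriv i f (c *\<^sub>R x))"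
proof
  fix x
  have "(f has_derivative frechet_derivative f (at (c *\<^sub>R x))) (at (c *\<^sub>R x))"
    using assms by (simp add: frechet_derivative_works)
  moreover have "((\<lambda>x. c *\<^sub>R x) has_derivative (\<lambda>x. c *\<^sub>R x)) (at x)"
    by (auto intro!: derivative_eq_intros)
  ultimately have "((\<lambda>x. f (c *\<^sub>R x)) has_derivative (\<lambda>h. frechet_derivative f (at (c *\<^sub>R x)) (c *\<^sub>R h))) (at x)"
    using has_derivative_compose by blast
  from partial_deriv_eq[OF this]
  show "partial_deriv i (\<lambda>x. f (c *\<^sub>R x)) x = of_real c * partial_deriv i f (c *\<^sub>R x)"
    using linear_frechet_derivative[OF assms[of "c *\<^sub>R x"]]
    by (simp add: partial_deriv_def linear_scale scaleR_conv_of_real[where 'a = complex])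
qed

lemma differentiable_scaleR_arg:
  fixes f :: "real^'n::finite \<Rightarrow> complex"
  assumes "\<And>x. f differentiable (at x)"
  shows "(\<lambda>x. f (c *\<^sub>R x)) differentiable (at x)"
proof -
  have "((\<lambda>x. c *\<^sub>R x) has_derivative (\<lambda>x. c *\<^sub>R x)) (at x)"
    by (auto intro!: derivative_eq_intros)
  then show ?thesis
    using assms[of "c *\<^sub>R x"] has_derivative_compose unfolding differentiable_def by blast
qed

lemma partial_deriv_cnj:
  fixes f :: "real^'n::finite \<Rightarrow> complex"
  assumes "\<And>x. f differentiable (at x)"
  shows "partial_deriv i (\<lambda>x. cnj (f x)) = (\<lambda>x. cnj (partial_deriv i f x))"
proof
  fix x
  have "(f has_derivative frechet_derivative f (at x)) (at x)"
    using assms by (simp add: frechet_derivative_works)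
  from partial_deriv_eq[OF has_derivative_cnj[OF this]]
  show "partial_deriv i (\<lambda>x. cnj (f x)) x = cnj (partial_deriv i f x)"
    by (simp add: partial_deriv_def)
qed

lemma has_derivative_coord:
  "((\<lambda>x::real^'n::finite. complex_of_real (x $ j)) has_derivative (\<lambda>h. of_real (h $ j))) (at x)"
  by (rule bounded_linear_imp_has_derivative)
    (intro bounded_linear_compose[OF bounded_linear_of_real] bounded_linear_vec_nth)

lemma differentiable_coord: "(\<lambda>x::real^'n::finite. complex_of_real (x $ j)) differentiable (at x)"
  using has_derivative_coord differentiable_def by blast

lemma partial_deriv_coord:
  "partial_deriv i (\<lambda>x::real^'n::finite. complex_of_real (x $ j)) = (\<lambda>x. if i = j then 1 else 0)"
  by (rule ext, subst partial_deriv_eq[OF has_derivative_coord]) (auto simp: axis_def)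

text \<open>The product rule leads out of a class of products, but into the finite sums of its
  members; closing the class under binary sums restores invariance under differentiation.\<close>

inductive sums_of :: "((real^'n::finite \<Rightarrow> complex) \<Rightarrow> bool) \<Rightarrow> (real^'n \<Rightarrow> complex) \<Rightarrow> bool"
  for C where
  base: "C f \<Longrightarrow> sums_of C f"
| add: "sums_of C f \<Longrightarrow> sums_of C g \<Longrightarrow> sums_of C (\<lambda>x. f x + g x)"

lemma sums_of_partial_derivs:
  assumes "\<And>f x. C f \<Longrightarrow> f differentiable (at x)"
    and "\<And>f i. C f \<Longrightarrow> sums_of C (partial_deriv i f)"
    and "sums_of C f"
  shows "sums_of C (partial_derivs \<alpha> f) \<and> (\<forall>x. partial_derivs \<alpha> f differentiable (at x))"
proof (induction \<alpha>)
  have d: "sums_of C f \<Longrightarrow> f differentiable (at x)" for f x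
    by (induction rule: sums_of.induct) (auto intro: assms(1) differentiable_add)
  have s: "sums_of C f \<Longrightarrow> sums_of C (partial_deriv i f)" for f i
  proof (induction rule: sums_of.induct)
    case (add f g)
    then show ?case by (subst partial_deriv_add) (auto intro: d sums_of.add)
  qed (rule assms(2))
  { case Nil show ?case using assms(3) d by simp }
  { case (Cons i \<alpha>) then show ?case using s d by simp }
qed

text \<open>Coinduction up to sums, so that the Leibniz rule need never be iterated.\<close>

lemma smooth_coinduct:
  assumes "\<And>f x. C f \<Longrightarrow> f differentiable (at x)"
    and "\<And>f i. C f \<Longrightarrow> sums_of C (partial_deriv i f)"
    and "C f"
  shows "smooth f"
  unfolding smooth_def using sums_of_partial_derivs[OF assms(1,2) sums_of.base[of C, OF assms(3)]] by blast

lemma smooth_differentiable: "smooth f \<Longrightarrow> f differentiable (at x)"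
  unfolding smooth_def by (metis partial_derivs.simps(1))

text \<open>The head of the list is the outermost derivative, so a derivative taken first is
  appended at the end. This transfers a condition on all lists from \<open>f\<close> to
  \<open>partial_deriv i f\<close>.\<close>

lemma partial_derivs_snoc: "partial_derivs \<alpha> (partial_deriv i f) = partial_derivs (\<alpha> @ [i]) f"
  by (induction \<alpha>) auto

lemma smooth_partial_deriv: "smooth f \<Longrightarrow> smooth (partial_deriv i f)"
  by (simp add: smooth_def partial_derivs_snoc)

lemma smooth_continuous_on: "smooth f \<Longrightarrow> continuous_on A f"
  by (meson continuous_at_imp_continuous_on differentiable_imp_continuous_within smooth_differentiable)

lemma smooth_borel: "smooth f \<Longrightarrow> f \<in> borel_measurable borel"
  by (intro borel_measurable_continuous_onI smooth_continuous_on)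

lemma smooth_add:
  assumes "smooth f" "smooth g"
  shows "smooth (\<lambda>x. f x + g x)"
proof (rule smooth_coinduct)
  let ?C = "\<lambda>h. \<exists>f g. smooth f \<and> smooth g \<and> h = (\<lambda>x. f x + g x)"
  show "?C (\<lambda>x. f x + g x)" using assms by blast
  show "h differentiable (at x)" if "?C h" for h x
    using that by (auto intro!: differentiable_add intro: smooth_differentiable)
  show "sums_of ?C (partial_deriv i h)" if "?C h" for h i
  proof -
    from that obtain f g where *: "smooth f" "smooth g" "h = (\<lambda>x. f x + g x)" by blast
    then have "partial_deriv i h = (\<lambda>x. partial_deriv i f x + partial_deriv i g x)"
      by (simp add: partial_deriv_add smooth_differentiable)
    then show ?thesis
      using smooth_partial_deriv[OF *(1)] smooth_partial_deriv[OF *(2)] by (intro sums_of.base) blast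
  qed
qed

lemma smooth_mult:
  assumes "smooth f" "smooth g"
  shows "smooth (\<lambda>x. f x * g x)"
proof (rule smooth_coinduct)
  let ?C = "\<lambda>h. \<exists>f g. smooth f \<and> smooth g \<and> h = (\<lambda>x. f x * g x)"
  show "?C (\<lambda>x. f x * g x)" using assms by blast
  show "h differentiable (at x)" if "?C h" for h x
    using that by (auto intro!: differentiable_mult intro: smooth_differentiable)
  show "sums_of ?C (partial_deriv i h)" if "?C h" for h i
  proof -
    from that obtain f g where *: "smooth f" "smooth g" "h = (\<lambda>x. f x * g x)" by blast
    then have "partial_deriv i h = (\<lambda>x. partial_deriv i f x * g x + f x * partial_deriv i g x)"
      by (simp add: partial_deriv_mult smooth_differentiable)
    moreover have "sums_of ?C (\<lambda>x. partial_deriv i f x * g x)" "sums_of ?C (\<lambda>x. f x * partial_deriv i g x)"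
      using * smooth_partial_deriv[OF *(1)] smooth_partial_deriv[OF *(2)]
      by (blast intro: sums_of.base)+
    ultimately show ?thesis
      by (simp add: sums_of.add)
  qed
qed

lemma smooth_const [simp]: "smooth (\<lambda>x. c)"
  by (rule smooth_coinduct[where C = "\<lambda>h. \<exists>c. h = (\<lambda>x. c)"]) (auto intro!: sums_of.base)

lemma smooth_coord [simp]: "smooth (\<lambda>x::real^'n::finite. complex_of_real (x $ j))"
proof -
  let ?C = "\<lambda>h::real^'n \<Rightarrow> complex. h = (\<lambda>x. complex_of_real (x $ j)) \<or> (\<exists>c. h = (\<lambda>x. c))"
  show ?thesis
  proof (rule smooth_coinduct[where C = ?C])
  show "?C (\<lambda>x. complex_of_real (x $ j))" by blast
  show "h differentiable (at x)" if "?C h" for h x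
    using that differentiable_coord by auto
  show "sums_of ?C (partial_deriv i h)" if "?C h" for h i
    using that by (intro sums_of.base) (auto simp: partial_deriv_coord)
  qed
qed

lemma smooth_scaleR:
  fixes f :: "real^'n::finite \<Rightarrow> complex"
  assumes "smooth f"
  shows "smooth (\<lambda>x. f (c *\<^sub>R x))"
proof -
  \<comment> \<open>The scalar \<open>a\<close> belongs to the class because each differentiation
    brings out another factor \<open>c\<close>.\<close>
  define C where "C h \<longleftrightarrow> (\<exists>f a. smooth f \<and> h = (\<lambda>x::real^'n. a * f (c *\<^sub>R x)))" for h
  have C: "C (\<lambda>x. a * f (c *\<^sub>R x))" if "smooth f" for a f
    unfolding C_def using that by (intro exI[of _ f] exI[of _ a] conjI refl)
  show ?thesis
  proof (rule smooth_coinduct[where C = C])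
    show "C (\<lambda>x. f (c *\<^sub>R x))" using C[OF assms, of 1] by simp
    fix h i x assume "C h"
    then obtain f a where f: "smooth f" and h: "h = (\<lambda>x. a * f (c *\<^sub>R x))"
      unfolding C_def by (elim exE conjE)
    have d: "f differentiable (at y)" for y using f by (rule smooth_differentiable)
    show "h differentiable (at x)"
      unfolding h by (intro differentiable_mult differentiable_const differentiable_scaleR_arg[of f c, OF d])
    have "partial_deriv i h = (\<lambda>x. partial_deriv i (\<lambda>x. a) x * f (c *\<^sub>R x) + a * partial_deriv i (\<lambda>x. f (c *\<^sub>R x)) x)"
      unfolding h by (rule partial_deriv_mult) (simp, rule differentiable_scaleR_arg[OF d])
    also have "\<dots> = (\<lambda>x. (a * of_real c) * partial_deriv i f (c *\<^sub>R x))"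
      unfolding partial_deriv_scaleR[of f i c, OF d] by (simp only: partial_deriv_const mult_zero_left add_0 mult.assoc)
    finally have "partial_deriv i h = (\<lambda>x. (a * of_real c) * partial_deriv i f (c *\<^sub>R x))" .
    then show "sums_of C (partial_deriv i h)"
      using C[OF smooth_partial_deriv[OF f]] by (simp only: sums_of.base)
  qed
qed

lemma smooth_cnj:
  assumes "smooth f"
  shows "smooth (\<lambda>x. cnj (f x))"
proof (rule smooth_coinduct)
  let ?C = "\<lambda>h. \<exists>f. smooth f \<and> h = (\<lambda>x. cnj (f x))"
  show "?C (\<lambda>x. cnj (f x))" using assms by blast
  show "h differentiable (at x)" if "?C h" for h x
  proof -
    from that obtain f where *: "smooth f" "h = (\<lambda>x. cnj (f x))" by blast
    then obtain D where "(f has_derivative D) (at x)"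
      using smooth_differentiable[OF *(1)] unfolding differentiable_def by blast
    from has_derivative_cnj[OF this] show ?thesis
      unfolding differentiable_def * by blast
  qed
  show "sums_of ?C (partial_deriv i h)" if "?C h" for h i
    using that
    by (auto intro!: sums_of.base simp: partial_deriv_cnj smooth_differentiable intro: smooth_partial_deriv)
qed

subsection \<open>Schwartz functions\<close>

lemma schwartz_smooth: "\<phi> \<in> schwartz \<Longrightarrow> smooth \<phi>"
  by (simp add: schwartz_def)

lemma schwartz_bound:
  assumes "\<phi> \<in> schwartz"
  obtains C where "C > 0" "\<And>x. (1 + norm x) ^ k * norm (\<phi> x) \<le> C"
proof -
  obtain C where C: "\<And>x. (1 + norm x) ^ k * norm (partial_derivs [] \<phi> x) \<le> C"
    using assms unfolding schwartz_def by blast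
  show ?thesis
    by (rule that[of "max 1 C"]) (use C in \<open>auto simp: le_max_iff_disj\<close>)
qed

lemma schwartz_partial_deriv: "\<phi> \<in> schwartz \<Longrightarrow> partial_deriv i \<phi> \<in> schwartz"
  by (auto simp: schwartz_def smooth_partial_deriv partial_derivs_snoc)

lemma weighted_add_le:
  fixes a b :: complex
  assumes "(1 + norm x) ^ k * norm a \<le> A" "(1 + norm x) ^ k * norm b \<le> B"
  shows "(1 + norm x) ^ k * norm (a + b) \<le> A + B"
proof -
  have "(1 + norm x) ^ k * norm (a + b) \<le> (1 + norm x) ^ k * (norm a + norm b)"
    by (intro mult_left_mono norm_triangle_ineq) auto
  then show ?thesis using assms by (simp add: distrib_left)
qed

text \<open>Every iterated derivative of a member is a finite sum of members, and weighted bounds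
  add. Decay therefore has to be checked for the members only, never for their derivatives.\<close>

lemma schwartz_coinduct:
  assumes "\<And>f x. C f \<Longrightarrow> f differentiable (at x)"
    and "\<And>f i. C f \<Longrightarrow> sums_of C (partial_deriv i f)"
    and bd: "\<And>f k. C f \<Longrightarrow> \<exists>B. \<forall>x. (1 + norm x) ^ k * norm (f x) \<le> B"
    and "C f"
  shows "f \<in> schwartz"
proof -
  have sbd: "\<exists>B. \<forall>x. (1 + norm x) ^ k * norm (f x) \<le> B" if "sums_of C f" for f k
    using that
  proof (induction rule: sums_of.induct)
    case (add f g)
    then obtain B1 B2 where "\<forall>x. (1 + norm x) ^ k * norm (f x) \<le> B1"
      "\<forall>x. (1 + norm x) ^ k * norm (g x) \<le> B2" by blast
    then have "(1 + norm x) ^ k * norm (f x + g x) \<le> B1 + B2" for x::"real^'a"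
      by (intro weighted_add_le) blast+
    then show ?case by blast
  qed (rule bd)
  have "smooth f"
    using assms(1,2,4) by (rule smooth_coinduct)
  moreover have "sums_of C (partial_derivs \<alpha> f)" for \<alpha>
    using sums_of_partial_derivs[OF assms(1,2) sums_of.base[of C, OF \<open>C f\<close>]] by blast
  ultimately show ?thesis
    using sbd unfolding schwartz_def by simp
qed

text \<open>These are the slowly increasing smooth functions, the natural multipliers of the
  Schwartz space. Constants, coordinates and Schwartz functions are all of this kind, so one product
  lemma covers them.\<close>

definition moderate :: "(real^'n::finite \<Rightarrow> complex) \<Rightarrow> bool" where
  "moderate p \<longleftrightarrow> smooth p \<and> (\<forall>\<alpha>. \<exists>C k. \<forall>x. norm (partial_derivs \<alpha> p x) \<le> C * (1 + norm x) ^ k)"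

lemma moderate_smooth: "moderate p \<Longrightarrow> smooth p"
  by (simp add: moderate_def)

lemma moderate_partial_deriv: "moderate p \<Longrightarrow> moderate (partial_deriv i p)"
  by (auto simp: moderate_def smooth_partial_deriv partial_derivs_snoc)

lemma moderate_bound:
  fixes p :: "real^'n::finite \<Rightarrow> complex"
  assumes "moderate p"
  obtains C k where "C > 0" "\<And>x. norm (p x) \<le> C * (1 + norm x) ^ k"
proof -
  obtain C k where C: "\<And>x. norm (partial_derivs [] p x) \<le> C * (1 + norm x) ^ k"
    using assms unfolding moderate_def by blast
  show ?thesis
  proof (rule that[of "max 1 C" k])
    fix x :: "real^'n"
    have "C * (1 + norm x) ^ k \<le> max 1 C * (1 + norm x) ^ k"
      by (intro mult_right_mono) auto
    with C[of x] show "norm (p x) \<le> max 1 C * (1 + norm x) ^ k" by simp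
  qed auto
qed

lemma schwartz_moderate:
  assumes "\<phi> \<in> schwartz"
  shows "moderate \<phi>"
  unfolding moderate_def
proof (intro conjI allI)
  show "smooth \<phi>" using assms by (rule schwartz_smooth)
  fix \<alpha>
  obtain C where "\<forall>x. (1 + norm x) ^ 0 * norm (partial_derivs \<alpha> \<phi> x) \<le> C"
    using assms unfolding schwartz_def by blast
  then show "\<exists>C k. \<forall>x. norm (partial_derivs \<alpha> \<phi> x) \<le> C * (1 + norm x) ^ k"
    by (intro exI[of _ C] exI[of _ 0]) simp
qed

lemma schwartz_mult:
  assumes "moderate p" "\<phi> \<in> schwartz"
  shows "(\<lambda>x. p x * \<phi> x) \<in> schwartz"
proof (rule schwartz_coinduct)
  let ?C = "\<lambda>h. \<exists>p \<phi>. moderate p \<and> \<phi> \<in> schwartz \<and> h = (\<lambda>x. p x * \<phi> x)"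
  show "?C (\<lambda>x. p x * \<phi> x)" using assms by blast
  show "h differentiable (at x)" if "?C h" for h x
    using that by (auto intro!: differentiable_mult intro: smooth_differentiable schwartz_smooth moderate_smooth)
  show "sums_of ?C (partial_deriv i h)" if "?C h" for h i
  proof -
    from that obtain p \<phi> where *: "moderate p" "\<phi> \<in> schwartz" "h = (\<lambda>x. p x * \<phi> x)" by blast
    then have "partial_deriv i h = (\<lambda>x. partial_deriv i p x * \<phi> x + p x * partial_deriv i \<phi> x)"
      by (simp add: partial_deriv_mult smooth_differentiable schwartz_smooth moderate_smooth)
    moreover have "sums_of ?C (\<lambda>x. partial_deriv i p x * \<phi> x)" "sums_of ?C (\<lambda>x. p x * partial_deriv i \<phi> x)"
      using * schwartz_partial_deriv[OF *(2)] moderate_partial_deriv[OF *(1)]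
      by (blast intro: sums_of.base)+
    ultimately show ?thesis
      by (simp add: sums_of.add)
  qed
  show "\<exists>B. \<forall>x. (1 + norm x) ^ k * norm (h x) \<le> B" if "?C h" for h k
  proof -
    from that obtain p \<phi> where *: "moderate p" "\<phi> \<in> schwartz" "h = (\<lambda>x. p x * \<phi> x)" by blast
    obtain C l where C: "C > 0" "\<And>x. norm (p x) \<le> C * (1 + norm x) ^ l"
      using moderate_bound[OF *(1)] by blast
    \<comment> \<open>The growth of \<open>p\<close> costs \<open>l\<close> powers of the weight,
      which the decay of \<open>\<phi>\<close> supplies in advance.\<close>
    obtain B where B: "\<And>x. (1 + norm x) ^ (k + l) * norm (\<phi> x) \<le> B"
      using schwartz_bound[OF *(2)] by blast
    have "(1 + norm x) ^ k * norm (h x) \<le> C * B" for x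
    proof -
      have "(1 + norm x) ^ k * norm (h x) \<le> (1 + norm x) ^ k * ((C * (1 + norm x) ^ l) * norm (\<phi> x))"
        unfolding * norm_mult by (intro mult_left_mono mult_right_mono C) auto
      also have "\<dots> = C * ((1 + norm x) ^ (k + l) * norm (\<phi> x))"
        by (simp add: power_add)
      also have "\<dots> \<le> C * B" using C B by (intro mult_left_mono) auto
      finally show ?thesis .
    qed
    then show ?thesis by blast
  qed
qed

lemma schwartz_add:
  assumes "\<phi> \<in> schwartz" "\<psi> \<in> schwartz"
  shows "(\<lambda>x. \<phi> x + \<psi> x) \<in> schwartz"
proof (rule schwartz_coinduct)
  let ?C = "\<lambda>h. \<exists>f g. f \<in> schwartz \<and> g \<in> schwartz \<and> h = (\<lambda>x. f x + g x)"
  show "?C (\<lambda>x. \<phi> x + \<psi> x)" using assms by blast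
  show "h differentiable (at x)" if "?C h" for h x
    using that by (auto intro!: differentiable_add intro: smooth_differentiable schwartz_smooth)
  show "sums_of ?C (partial_deriv i h)" if "?C h" for h i
  proof -
    from that obtain f g where *: "f \<in> schwartz" "g \<in> schwartz" "h = (\<lambda>x. f x + g x)" by blast
    then have "partial_deriv i h = (\<lambda>x. partial_deriv i f x + partial_deriv i g x)"
      by (simp add: partial_deriv_add smooth_differentiable schwartz_smooth)
    then show ?thesis
      using schwartz_partial_deriv[OF *(1)] schwartz_partial_deriv[OF *(2)] by (intro sums_of.base) blast
  qed
  show "\<exists>B. \<forall>x. (1 + norm x) ^ k * norm (h x) \<le> B" if "?C h" for h k
  proof -
    from that obtain f g where *: "f \<in> schwartz" "g \<in> schwartz" "h = (\<lambda>x. f x + g x)" by blast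
    obtain A B where "\<And>x. (1 + norm x) ^ k * norm (f x) \<le> A" "\<And>x. (1 + norm x) ^ k * norm (g x) \<le> B"
      using schwartz_bound[OF *(1), of k] schwartz_bound[OF *(2), of k] by metis
    then have "(1 + norm x) ^ k * norm (h x) \<le> A + B" for x
      unfolding *
      by (rule weighted_add_le)
    then show ?thesis by blast
  qed
qed

lemma moderate_const [simp]: "moderate (\<lambda>x::real^'n::finite. c)"
  unfolding moderate_def
proof (intro conjI allI)
  fix \<alpha> :: "'n list"
  have z: "partial_derivs \<alpha> (\<lambda>x. 0) = (\<lambda>x. 0)" for \<alpha> :: "'n list"
    by (induction \<alpha>) auto
  have "partial_derivs \<alpha> (\<lambda>x. c) = (\<lambda>x. if \<alpha> = [] then c else 0)"
    by (induction \<alpha>) auto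
  then show "\<exists>C k. \<forall>x. norm (partial_derivs \<alpha> (\<lambda>x. c) x) \<le> C * (1 + norm x) ^ k"
    by (intro exI[of _ "norm c"] exI[of _ 0]) auto
qed simp

lemma moderate_coord [simp]: "moderate (\<lambda>x::real^'n::finite. complex_of_real (x $ j))"
  unfolding moderate_def
proof (intro conjI allI)
  fix \<alpha> :: "'n list"
  show "\<exists>C k. \<forall>x. norm (partial_derivs \<alpha> (\<lambda>x. complex_of_real (x $ j)) x) \<le> C * (1 + norm x) ^ k"
  \<comment> \<open>The last entry of the list is the derivative applied first, and it already turns
    the coordinate into a constant.\<close>
  proof (cases \<alpha> rule: rev_cases)
    case Nil
    have "\<bar>x $ j\<bar> \<le> 1 * (1 + norm x) ^ 1" for x :: "real^'n"
      using component_le_norm_cart[of x j] by simp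
    then show ?thesis using Nil by (intro exI[of _ 1]) simp
  next
    case (snoc \<beta> i)
    then have eq: "partial_derivs \<alpha> (\<lambda>x. complex_of_real (x $ j)) = partial_derivs \<beta> (\<lambda>x. if i = j then 1 else 0)"
      by (simp add: partial_derivs_snoc[symmetric] partial_deriv_coord)
    have "moderate (\<lambda>x::real^'n. if i = j then 1 else 0)" by (rule moderate_const)
    then show ?thesis
      unfolding moderate_def eq by blast
  qed
qed simp

lemma schwartz_cmult: "\<phi> \<in> schwartz \<Longrightarrow> (\<lambda>x. c * \<phi> x) \<in> schwartz"
  by (rule schwartz_mult) auto

lemma schwartz_coord_mult: "\<phi> \<in> schwartz \<Longrightarrow> (\<lambda>x. of_real (x $ j) * \<phi> x) \<in> schwartz"
  by (rule schwartz_mult) auto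

lemma schwartz_lincomb:
  "\<phi> \<in> schwartz \<Longrightarrow> \<psi> \<in> schwartz \<Longrightarrow> (\<lambda>x. a * \<phi> x + b * \<psi> x) \<in> schwartz"
  by (intro schwartz_add schwartz_cmult)

lemma schwartz_diff:
  "\<phi> \<in> schwartz \<Longrightarrow> \<psi> \<in> schwartz \<Longrightarrow> (\<lambda>x. \<phi> x - \<psi> x) \<in> schwartz"
  using schwartz_lincomb[of \<phi> \<psi> 1 "-1"] by simp

lemma schwartz_cnj:
  assumes "\<phi> \<in> schwartz"
  shows "(\<lambda>x. cnj (\<phi> x)) \<in> schwartz"
proof (rule schwartz_coinduct)
  let ?C = "\<lambda>h. \<exists>f. f \<in> schwartz \<and> h = (\<lambda>x. cnj (f x))"
  show "?C (\<lambda>x. cnj (\<phi> x))" using assms by blast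
  show "h differentiable (at x)" if "?C h" for h x
    using that by (auto intro: smooth_differentiable smooth_cnj schwartz_smooth)
  show "sums_of ?C (partial_deriv i h)" if "?C h" for h i
    using that
    by (auto intro!: sums_of.base simp: partial_deriv_cnj smooth_differentiable schwartz_smooth intro: schwartz_partial_deriv)
  show "\<exists>B. \<forall>x. (1 + norm x) ^ k * norm (h x) \<le> B" if "?C h" for h k
  proof -
    from that obtain f where *: "f \<in> schwartz" "h = (\<lambda>x. cnj (f x))" by auto
    obtain B where "\<And>x. (1 + norm x) ^ k * norm (f x) \<le> B"
      using schwartz_bound[OF *(1), of k] by metis
    then show ?thesis unfolding * by auto
  qed
qed

lemma schwartz_uminus:
  assumes "\<phi> \<in> schwartz"
  shows "(\<lambda>x. \<phi> (- x)) \<in> schwartz"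
proof (rule schwartz_coinduct)
  let ?C = "\<lambda>h. \<exists>f. f \<in> schwartz \<and> h = (\<lambda>x. f (- x))"
  show "?C (\<lambda>x. \<phi> (- x))" using assms by blast
  show "h differentiable (at x)" if "?C h" for h x
  proof -
    from that obtain f where "f \<in> schwartz" "h = (\<lambda>x. f ((-1) *\<^sub>R x))" by auto
    then show ?thesis by (simp only: smooth_scaleR smooth_differentiable schwartz_smooth)
  qed
  show "sums_of ?C (partial_deriv i h)" if "?C h" for h i
  proof -
    from that obtain f where *: "f \<in> schwartz" "h = (\<lambda>x. f (- x))" by auto
    then have "partial_deriv i h = (\<lambda>x. - partial_deriv i f (- x))"
      using partial_deriv_scaleR[of f i "-1"] by (simp add: smooth_differentiable schwartz_smooth)
    then show ?thesis
      using * schwartz_cmult[OF schwartz_partial_deriv[OF *(1)], of "-1" i]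
      by (intro sums_of.base exI[of _ "\<lambda>x. - partial_deriv i f x"]) auto
  qed
  show "\<exists>B. \<forall>x. (1 + norm x) ^ k * norm (h x) \<le> B" if "?C h" for h k
  proof -
    from that obtain f where *: "f \<in> schwartz" "h = (\<lambda>x. f (- x))" by auto
    obtain B where "\<And>x. (1 + norm x) ^ k * norm (f x) \<le> B"
      using schwartz_bound[OF *(1), of k] by metis
    from this[of "- x" for x] show ?thesis unfolding * by auto
  qed
qed

subsection \<open>Lebesgue integration on Euclidean space\<close>

text \<open>Dyadic balls: at scale \<open>2 ^ k\<close> the integrand is of order
  \<open>1 / (2 ^ k) ^ (d + 1)\<close> and the ball has volume of order \<open>(2 ^ k) ^ d\<close>,
  so that a geometric series with ratio one half remains.\<close>

lemma integrable_inverse_power_norm: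
  "integrable lborel (\<lambda>x::'a::euclidean_space. 1 / (1 + norm x) ^ (DIM('a) + 1))"
proof (rule integrableI_bounded)
  define d where "d = DIM('a)"
  \<comment> \<open>The factor \<open>2 ^ (d + 1)\<close> arises because minimality of the dyadic
    index \<open>k\<close> bounds the weight from below only by \<open>2 ^ (k - 1)\<close>.\<close>
  define a :: "nat \<Rightarrow> real" where "a k = 2 ^ (d + 1) / (2 ^ k) ^ (d + 1)" for k
  have [measurable]: "ball (0::'a) (2 ^ k) \<in> sets borel" for k by simp
  have le: "ennreal (norm (1 / (1 + norm x) ^ (DIM('a) + 1))) \<le> (\<Sum>k. ennreal (a k) * indicator (ball 0 (2 ^ k)) x)" for x :: 'a
  proof -
    obtain n :: nat where n: "1 + norm x < 2 ^ n"
      using real_arch_pow[of 2 "1 + norm x"] by auto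
    define k where "k = (LEAST n::nat. 1 + norm x < 2 ^ n)"
    have k: "1 + norm x < 2 ^ k" unfolding k_def by (rule LeastI[of _ n]) (rule n)
    then have "k \<noteq> 0" by (intro notI) (simp add: not_less[symmetric])
    then obtain m where m: "k = Suc m" by (cases k) auto
    have "\<not> 1 + norm x < 2 ^ m"
      by (rule not_less_Least) (use m k_def in simp)
    then have "(2 ^ m) ^ (d + 1) \<le> (1 + norm x) ^ (d + 1)"
      by (intro power_mono) auto
    then have "1 / (1 + norm x) ^ (d + 1) \<le> 1 / (2 ^ m) ^ (d + 1)"
      by (intro divide_left_mono mult_pos_pos zero_less_power add_pos_nonneg) auto
    also have "\<dots> = a k"
      unfolding a_def m power_Suc[of 2 m] power_mult_distrib by simp
    finally have "ennreal (norm (1 / (1 + norm x) ^ (DIM('a) + 1))) \<le> ennreal (a k)"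
      unfolding d_def by (intro ennreal_leI) simp
    also have "\<dots> = (\<Sum>i\<in>{k}. ennreal (a i) * indicator (ball 0 (2 ^ i)) x)"
    proof -
      have "norm x < 2 ^ k" using k by linarith
      then have "indicator (ball 0 (2 ^ k)) x = (1 :: ennreal)" by (intro indicator_eq_1_iff[THEN iffD2]) (simp only: mem_ball_0)
      then show ?thesis by (simp only: sum.insert sum.empty finite.emptyI empty_iff not_False_eq_True mult_1_right add_0_right)
    qed
    also have "\<dots> \<le> (\<Sum>k. ennreal (a k) * indicator (ball 0 (2 ^ k)) x)"
      by (rule sum_le_suminf) auto
    finally show ?thesis .
  qed
  have "(\<integral>\<^sup>+x. ennreal (norm (1 / (1 + norm x) ^ (DIM('a) + 1))) \<partial>(lborel :: 'a measure))
      \<le> (\<integral>\<^sup>+x. (\<Sum>k. ennreal (a k) * indicator (ball 0 (2 ^ k)) x) \<partial>(lborel :: 'a measure))"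
    by (intro nn_integral_mono le)
  also have "\<dots> = (\<Sum>k. \<integral>\<^sup>+x. ennreal (a k) * indicator (ball 0 (2 ^ k)) x \<partial>(lborel :: 'a measure))"
    by (rule nn_integral_suminf) measurable
  also have "\<dots> = (\<Sum>k. ennreal (2 ^ (d + 1) * unit_ball_vol d * (1 / 2) ^ k))"
  proof (intro suminf_cong)
    fix k :: nat
    have "(\<integral>\<^sup>+x. ennreal (a k) * indicator (ball 0 (2 ^ k)) x \<partial>(lborel :: 'a measure))
        = ennreal (a k) * ennreal (unit_ball_vol d * (2 ^ k) ^ d)"
      by (simp add: nn_integral_cmult_indicator emeasure_ball d_def)
    also have "\<dots> = ennreal (a k * (unit_ball_vol d * (2 ^ k) ^ d))"
      by (rule ennreal_mult[symmetric]) (auto simp: a_def unit_ball_vol_def)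
    also have "a k * (unit_ball_vol d * (2 ^ k) ^ d) = 2 ^ (d + 1) * unit_ball_vol d * (1 / 2) ^ k"
      by (simp add: a_def field_simps power_one_over)
    finally show "(\<integral>\<^sup>+x. ennreal (a k) * indicator (ball 0 (2 ^ k)) x \<partial>(lborel :: 'a measure))
        = ennreal (2 ^ (d + 1) * unit_ball_vol d * (1 / 2) ^ k)" .
  qed
  also have "\<dots> < \<infinity>"
    by (subst suminf_ennreal2) (auto intro!: summable_mult summable_geometric mult_nonneg_nonneg simp: unit_ball_vol_def)
  finally show "(\<integral>\<^sup>+x. ennreal (norm (1 / (1 + norm x) ^ (DIM('a) + 1))) \<partial>(lborel :: 'a measure)) < \<infinity>" .
qed measurable

section \<open>Affine changes of variables\<close>

lemma lborel_integrable_affine_iff: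
  fixes f :: "'a::euclidean_space \<Rightarrow> 'b::{banach, second_countable_topology}"
  assumes [measurable]: "f \<in> borel_measurable borel" and "c \<noteq> 0"
  shows "integrable lborel (\<lambda>x. f (t + c *\<^sub>R x)) \<longleftrightarrow> integrable lborel f"
proof -
  have "integrable lborel f \<longleftrightarrow> integrable (density (distr lborel borel (\<lambda>x. t + c *\<^sub>R x)) (\<lambda>_. \<bar>c\<bar>^DIM('a))) f"
    using lborel_affine[OF assms(2), of t] by metis
  also have "\<dots> \<longleftrightarrow> integrable lborel (\<lambda>x. \<bar>c\<bar>^DIM('a) *\<^sub>R f (t + c *\<^sub>R x))"
    by (simp add: integrable_density integrable_distr_eq)
  also have "\<dots> \<longleftrightarrow> integrable lborel (\<lambda>x. f (t + c *\<^sub>R x))"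
    using integrable_scaleR_right[of "inverse (\<bar>c\<bar>^DIM('a))" lborel "\<lambda>x. \<bar>c\<bar>^DIM('a) *\<^sub>R f (t + c *\<^sub>R x)"] assms(2)
    by auto
  finally show ?thesis ..
qed

lemma lborel_integral_affine:
  fixes f :: "'a::euclidean_space \<Rightarrow> 'b::{banach, second_countable_topology}"
  assumes [measurable]: "f \<in> borel_measurable borel" and "c \<noteq> 0"
  shows "integral\<^sup>L lborel f = \<bar>c\<bar>^DIM('a) *\<^sub>R (LINT x|lborel. f (t + c *\<^sub>R x))"
proof -
  have "integral\<^sup>L lborel f = integral\<^sup>L (density (distr lborel borel (\<lambda>x. t + c *\<^sub>R x)) (\<lambda>_. \<bar>c\<bar>^DIM('a))) f"
    using lborel_affine[OF assms(2), of t] by metis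
  also have "\<dots> = (LINT x|lborel. \<bar>c\<bar>^DIM('a) *\<^sub>R f (t + c *\<^sub>R x))"
    by (simp add: integral_density integral_distr)
  finally show ?thesis by simp
qed

lemma lborel_integral_translate:
  fixes f :: "'a::euclidean_space \<Rightarrow> 'b::{banach, second_countable_topology}"
  assumes "f \<in> borel_measurable borel"
  shows "(LINT x|lborel. f (t + x)) = integral\<^sup>L lborel f"
  using lborel_integral_affine[OF assms, of 1 t] by simp

lemma lborel_integrable_translate:
  fixes f :: "'a::euclidean_space \<Rightarrow> 'b::{banach, second_countable_topology}"
  assumes "f \<in> borel_measurable borel" "integrable lborel f"
  shows "integrable lborel (\<lambda>x. f (t + x))"
  using lborel_integrable_affine_iff[OF assms(1), of 1 t] assms(2) by simp

lemma lborel_integral_uminus: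
  fixes f :: "'a::euclidean_space \<Rightarrow> 'b::{banach, second_countable_topology}"
  assumes "f \<in> borel_measurable borel"
  shows "(LINT x|lborel. f (- x)) = integral\<^sup>L lborel f"
  using lborel_integral_affine[OF assms, of "-1" 0] by simp

lemma lborel_integrable_uminus:
  fixes f :: "'a::euclidean_space \<Rightarrow> 'b::{banach, second_countable_topology}"
  assumes "f \<in> borel_measurable borel" "integrable lborel f"
  shows "integrable lborel (\<lambda>x. f (- x))"
  using lborel_integrable_affine_iff[OF assms(1), of "-1" 0] assms(2) by simp

lemma (in pair_sigma_finite) integrable_pair_mult:
  fixes f g :: "_ \<Rightarrow> 'c::{banach, second_countable_topology, real_normed_div_algebra}"
  assumes f: "integrable M1 f" and g: "integrable M2 g"
  shows "integrable (M1 \<Otimes>\<^sub>M M2) (\<lambda>(x, y). f x * g y)"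
proof (rule Fubini_integrable)
  have [measurable]: "f \<in> borel_measurable M1" "g \<in> borel_measurable M2" using f g by auto
  show "(\<lambda>(x, y). f x * g y) \<in> borel_measurable (M1 \<Otimes>\<^sub>M M2)" by measurable
  show "integrable M1 (\<lambda>x. \<integral>y. norm (case (x, y) of (x, y) \<Rightarrow> f x * g y) \<partial>M2)"
    using f by (simp add: norm_mult)
  show "AE x in M1. integrable M2 (\<lambda>y. case (x, y) of (x, y) \<Rightarrow> f x * g y)"
    using g by simp
qed

lemma cis_inner_borel [measurable]:
  assumes [measurable]: "f \<in> borel_measurable M" "g \<in> borel_measurable M"
  shows "(\<lambda>x. cis (- (f x \<bullet> (g x :: 'a::euclidean_space)))) \<in> borel_measurable M"
proof -
  have [measurable]: "cis \<in> borel_measurable borel"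
    by (intro borel_measurable_continuous_onI continuous_on_cis continuous_on_id)
  show ?thesis by measurable
qed

subsection \<open>Fourier transforms of Schwartz functions\<close>

lemma schwartz_borel [measurable_dest]: "\<phi> \<in> schwartz \<Longrightarrow> \<phi> \<in> borel_measurable borel"
  by (rule smooth_borel[OF schwartz_smooth])

lemma decay_integrable:
  fixes f :: "real^'n::finite \<Rightarrow> 'b::{banach, second_countable_topology}"
  assumes "f \<in> borel_measurable borel" "\<And>x. (1 + norm x) ^ (CARD('n) + 1) * norm (f x) \<le> B"
  shows "integrable lborel f"
proof (rule Bochner_Integration.integrable_bound)
  show "integrable lborel (\<lambda>x::real^'n. B * (1 / (1 + norm x) ^ (CARD('n) + 1)))"
    using integrable_inverse_power_norm[where 'a = "real^'n"] by (intro integrable_mult_right) simp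
  have "norm (f x) \<le> norm (B * (1 / (1 + norm x) ^ (CARD('n) + 1)))" for x
  proof -
    have p: "0 < (1 + norm x) ^ (CARD('n) + 1)" by (intro zero_less_power) (simp add: add_pos_nonneg)
    have "norm (f x) \<le> B / (1 + norm x) ^ (CARD('n) + 1)"
      using assms(2)[of x] p by (simp add: pos_le_divide_eq mult.commute)
    also have "\<dots> \<le> norm (B / (1 + norm x) ^ (CARD('n) + 1))" by (simp only: real_norm_def abs_ge_self)
    finally show ?thesis by simp
  qed
  then show "AE x in lborel. norm (f x) \<le> norm (B * (1 / (1 + norm x) ^ (CARD('n) + 1)))" by simp
qed (use assms(1) in simp)

lemma schwartz_integrable:
  fixes \<phi> :: "real^'n::finite \<Rightarrow> complex"
  assumes "\<phi> \<in> schwartz"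
  shows "integrable lborel \<phi>"
  using schwartz_bound[OF assms, of "CARD('n) + 1"] schwartz_borel[OF assms] decay_integrable by metis

lemma norm_mult_cnj_power2: "norm (z * cnj z) = (norm z)\<^sup>2"
  by (simp add: norm_mult power2_eq_square)

lemma schwartz_mult_schwartz: "\<phi> \<in> schwartz \<Longrightarrow> \<psi> \<in> schwartz \<Longrightarrow> (\<lambda>x. \<phi> x * \<psi> x) \<in> schwartz"
  by (rule schwartz_mult[OF schwartz_moderate])

lemma schwartz_sq_integrable:
  assumes "\<phi> \<in> schwartz"
  shows "integrable lborel (\<lambda>x. (norm (\<phi> x))\<^sup>2)"
  using integrable_norm[OF schwartz_integrable[OF schwartz_mult_schwartz[OF assms schwartz_cnj[OF assms]]]]
  by (simp only: norm_mult_cnj_power2)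

lemma fourier_lborel:
  assumes [measurable]: "\<phi> \<in> borel_measurable borel"
  shows "fourier \<phi> \<xi> = (LINT x|lborel. cis (- (x \<bullet> \<xi>)) * \<phi> x)"
  unfolding fourier_def by (rule integral_completion) measurable

lemma integrable_cis_mult:
  fixes \<phi> :: "real^'n::finite \<Rightarrow> complex"
  assumes [measurable]: "\<phi> \<in> borel_measurable borel" and "integrable lborel \<phi>"
  shows "integrable lborel (\<lambda>x. cis (- (x \<bullet> \<xi>)) * \<phi> x)"
  by (rule Bochner_Integration.integrable_bound[OF assms(2)]) (measurable, simp add: norm_mult)

lemma norm_fourier_le:
  assumes "\<phi> \<in> borel_measurable borel"
  shows "norm (fourier \<phi> \<xi>) \<le> (LINT x|lborel. norm (\<phi> x))"
proof -
  have "norm (fourier \<phi> \<xi>) \<le> (LINT x|lborel. norm (cis (- (x \<bullet> \<xi>)) * \<phi> x))"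
    unfolding fourier_lborel[OF assms] by (rule integral_norm_bound)
  then show ?thesis by (simp add: norm_mult)
qed

text \<open>On the imaginary axis the factor \<open>exp \<bar>Re z\<bar>\<close> of the Taylor
  remainder is 1, so the quadratic bound is global. It serves both the derivative of a Fourier
  transform and the Fourier transform of a derivative.\<close>

lemma norm_cis_taylor: "norm (cis (- t) - 1 + \<i> * of_real t) \<le> t\<^sup>2"
proof -
  have "norm (exp (\<i> * of_real (- t)) - (\<Sum>k\<le>1. (\<i> * of_real (- t)) ^ k / fact k))
      \<le> exp \<bar>Re (\<i> * of_real (- t))\<bar> * norm (\<i> * of_real (- t)) ^ Suc 1 / fact 1"
    by (rule Taylor_exp)
  then show ?thesis
    by (simp add: cis_conv_exp norm_mult power2_eq_square algebra_simps)
qed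

text \<open>The remainder is bounded by the second moment of \<open>\<phi>\<close> times the square
  of the increment. Differentiation under the integral thus becomes a direct estimate, without an
  interchange of limits.\<close>

lemma fourier_has_derivative:
  fixes \<phi> :: "real^'n::finite \<Rightarrow> complex"
  assumes S: "\<phi> \<in> schwartz"
  shows "(fourier \<phi> has_derivative
    (\<lambda>h. \<Sum>j\<in>UNIV. of_real (h $ j) * fourier (\<lambda>x. - \<i> * (of_real (x $ j) * \<phi> x)) \<xi>)) (at \<xi>)"
proof -
  let ?D = "\<lambda>h. \<Sum>j\<in>UNIV. of_real (h $ j) * fourier (\<lambda>x. - \<i> * (of_real (x $ j) * \<phi> x)) \<xi>"
  have S1: "(\<lambda>x. - \<i> * (of_real (x $ j) * \<phi> x)) \<in> schwartz" for j
    by (intro schwartz_cmult schwartz_coord_mult S)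
  have [measurable]: "\<phi> \<in> borel_measurable borel" using S by measurable
  define M where "M = (LINT x|lborel. (norm x)\<^sup>2 * norm (\<phi> x))"
  have int2: "integrable lborel (\<lambda>x. (norm x)\<^sup>2 * norm (\<phi> x))"
  proof -
    \<comment> \<open>Two powers of the weight absorb \<open>(norm x)\<^sup>2\<close>; the others
      give integrability.\<close>
    obtain B where B: "\<And>x. (1 + norm x) ^ (CARD('n) + 1 + 2) * norm (\<phi> x) \<le> B"
      using schwartz_bound[OF S, of "CARD('n) + 1 + 2"] by metis
    have "(1 + norm x) ^ (CARD('n) + 1) * norm ((norm x)\<^sup>2 * norm (\<phi> x)) \<le> B" for x
    proof -
      have "(1 + norm x) ^ (CARD('n) + 1) * ((norm x)\<^sup>2 * norm (\<phi> x))
        \<le> (1 + norm x) ^ (CARD('n) + 1) * ((1 + norm x)\<^sup>2 * norm (\<phi> x))"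
        by (intro mult_left_mono mult_right_mono power_mono) auto
      also have "\<dots> = (1 + norm x) ^ (CARD('n) + 1 + 2) * norm (\<phi> x)"
        by (simp only: power_add mult.assoc)
      finally show ?thesis using B[of x] by (simp add: norm_mult)
    qed
    then show ?thesis by (intro decay_integrable) auto
  qed
  have key: "norm (fourier \<phi> (\<xi> + h) - fourier \<phi> \<xi> - ?D h) \<le> M * (norm h)\<^sup>2" for h
  proof -
    let ?g = "\<lambda>x. cis (- (x \<bullet> \<xi>)) * \<phi> x"
    have i0: "integrable lborel (\<lambda>x. cis (- (x \<bullet> \<zeta>)) * \<phi> x)" for \<zeta>
      by (intro integrable_cis_mult schwartz_integrable S) simp
    have i1: "integrable lborel (\<lambda>x. cis (- (x \<bullet> \<xi>)) * (- \<i> * (of_real (x $ j) * \<phi> x)))" for j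
      by (intro integrable_cis_mult schwartz_integrable S1 schwartz_borel)
    have "?D h = (\<Sum>j\<in>UNIV. (LINT x|lborel. of_real (h $ j) * (cis (- (x \<bullet> \<xi>)) * (- \<i> * (of_real (x $ j) * \<phi> x)))))"
      by (simp only: fourier_lborel[OF schwartz_borel[OF S1]] integral_mult_right_zero)
    also have "\<dots> = (LINT x|lborel. (\<Sum>j\<in>UNIV. of_real (h $ j) * (cis (- (x \<bullet> \<xi>)) * (- \<i> * (of_real (x $ j) * \<phi> x)))))"
      by (rule Bochner_Integration.integral_sum[symmetric]) (intro integrable_mult_right i1)
    also have "\<dots> = (LINT x|lborel. ?g x * (- \<i> * of_real (x \<bullet> h)))"
      by (intro Bochner_Integration.integral_cong refl)
        (simp add: inner_vec_def sum_distrib_left sum_distrib_right algebra_simps)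
    finally have D: "?D h = (LINT x|lborel. ?g x * (- \<i> * of_real (x \<bullet> h)))" .
    have iD: "integrable lborel (\<lambda>x. ?g x * (- \<i> * of_real (x \<bullet> h)))"
    proof -
      have "integrable lborel (\<lambda>x. \<Sum>j\<in>UNIV. of_real (h $ j) * (cis (- (x \<bullet> \<xi>)) * (- \<i> * (of_real (x $ j) * \<phi> x))))"
        by (intro Bochner_Integration.integrable_sum integrable_mult_right i1)
      then show ?thesis
        by (simp add: inner_vec_def sum_distrib_left sum_distrib_right algebra_simps)
    qed
    have pt: "cis (- (x \<bullet> (\<xi> + h))) * \<phi> x - ?g x - ?g x * (- \<i> * of_real (x \<bullet> h))
        = ?g x * (cis (- (x \<bullet> h)) - 1 + \<i> * of_real (x \<bullet> h))" for x
    proof -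
      have "cis (- (x \<bullet> (\<xi> + h))) = cis (- (x \<bullet> \<xi>)) * cis (- (x \<bullet> h))"
        by (simp add: cis_mult inner_add_right)
      then show ?thesis by (simp add: algebra_simps)
    qed
    have "fourier \<phi> (\<xi> + h) - fourier \<phi> \<xi> - ?D h
        = (LINT x|lborel. ?g x * (cis (- (x \<bullet> h)) - 1 + \<i> * of_real (x \<bullet> h)))"
      unfolding D fourier_lborel[OF schwartz_borel[OF S]] pt[symmetric]
      using i0 iD by simp
    also have "norm \<dots> \<le> (LINT x|lborel. (norm h)\<^sup>2 * ((norm x)\<^sup>2 * norm (\<phi> x)))"
    proof (rule order_trans[OF integral_norm_bound integral_mono])
      show "integrable lborel (\<lambda>x. norm (?g x * (cis (- (x \<bullet> h)) - 1 + \<i> * of_real (x \<bullet> h))))"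
        unfolding pt[symmetric] by (intro integrable_norm Bochner_Integration.integrable_diff i0 iD)
      show "integrable lborel (\<lambda>x. (norm h)\<^sup>2 * ((norm x)\<^sup>2 * norm (\<phi> x)))"
        using int2 by simp
      fix x
      have "norm (cis (- (x \<bullet> h)) - 1 + \<i> * of_real (x \<bullet> h)) \<le> \<bar>x \<bullet> h\<bar>\<^sup>2"
        using norm_cis_taylor[of "x \<bullet> h"] by simp
      also have "\<dots> \<le> (norm x * norm h)\<^sup>2"
        by (intro power_mono Cauchy_Schwarz_ineq2) auto
      finally have "norm (\<phi> x) * norm (cis (- (x \<bullet> h)) - 1 + \<i> * of_real (x \<bullet> h)) \<le> norm (\<phi> x) * (norm x * norm h)\<^sup>2"
        by (intro mult_left_mono) auto
      then show "norm (?g x * (cis (- (x \<bullet> h)) - 1 + \<i> * of_real (x \<bullet> h))) \<le> (norm h)\<^sup>2 * ((norm x)\<^sup>2 * norm (\<phi> x))"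
        by (simp only: norm_mult norm_cis power_mult_distrib mult_1 ac_simps)
    qed
    also have "\<dots> = M * (norm h)\<^sup>2" by (simp add: M_def)
    finally show ?thesis .
  qed
  show ?thesis
  proof (rule has_derivativeI_sandwich[of 1])
    show "bounded_linear ?D"
      by (intro bounded_linear_sum bounded_linear_compose[OF bounded_linear_mult_left]
          bounded_linear_compose[OF bounded_linear_of_real] bounded_linear_vec_nth)
    show "norm (fourier \<phi> y - fourier \<phi> \<xi> - ?D (y - \<xi>)) / norm (y - \<xi>) \<le> M * norm (y - \<xi>)" if "y \<noteq> \<xi>" for y
      using key[of "y - \<xi>"] that by (simp add: divide_le_eq power2_eq_square mult.assoc)
    show "((\<lambda>y. M * norm (y - \<xi>)) \<longlongrightarrow> 0) (at \<xi>)"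
      by (rule tendsto_eq_intros refl | simp)+
  qed auto
qed

lemma fourier_differentiable: "\<phi> \<in> schwartz \<Longrightarrow> fourier \<phi> differentiable (at x)"
  using fourier_has_derivative differentiable_def by blast

lemma partial_deriv_fourier:
  assumes "\<phi> \<in> schwartz"
  shows "partial_deriv i (fourier \<phi>) = fourier (\<lambda>x. - \<i> * (of_real (x $ i) * \<phi> x))"
proof
  fix \<xi>
  have "partial_deriv i (fourier \<phi>) \<xi> =
      (\<Sum>j\<in>UNIV. of_real (axis i 1 $ j) * fourier (\<lambda>x. - \<i> * (of_real (x $ j) * \<phi> x)) \<xi>)"
    by (rule partial_deriv_eq[OF fourier_has_derivative[OF assms]])
  also have "\<dots> = (\<Sum>j\<in>UNIV. if j = i then fourier (\<lambda>x. - \<i> * (of_real (x $ i) * \<phi> x)) \<xi> else 0)"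
    by (intro sum.cong) (auto simp: axis_def)
  finally show "partial_deriv i (fourier \<phi>) \<xi> = fourier (\<lambda>x. - \<i> * (of_real (x $ i) * \<phi> x)) \<xi>"
    by simp
qed

lemma directional_derivative:
  fixes f :: "real^'n::finite \<Rightarrow> complex"
  assumes "f differentiable (at (x + s *\<^sub>R axis i 1))"
  shows "((\<lambda>s. f (x + s *\<^sub>R axis i 1)) has_vector_derivative partial_deriv i f (x + s *\<^sub>R axis i 1)) (at s)"
proof -
  let ?y = "x + s *\<^sub>R axis i 1"
  have "(f has_derivative frechet_derivative f (at ?y)) (at ?y)"
    using assms by (simp add: frechet_derivative_works)
  moreover have "((\<lambda>s. x + s *\<^sub>R axis i 1) has_derivative (\<lambda>h. h *\<^sub>R axis i 1)) (at s)"
    by (auto intro!: derivative_eq_intros)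
  ultimately have "((\<lambda>s. f (x + s *\<^sub>R axis i 1)) has_derivative (\<lambda>h. frechet_derivative f (at ?y) (h *\<^sub>R axis i 1))) (at s)"
    using has_derivative_compose by blast
  then show ?thesis
    unfolding has_vector_derivative_def partial_deriv_def
    using linear_frechet_derivative[OF assms] by (simp add: linear_scale)
qed

text \<open>Difference quotients take the place of integration by parts: by translation invariance
  the transform of a difference quotient of \<open>\<phi>\<close> is an explicit multiple of the
  transform of \<open>\<phi>\<close>, and both the quotient and the multiple converge.\<close>

lemma fourier_partial_deriv:
  fixes \<phi> :: "real^'n::finite \<Rightarrow> complex"
  assumes S: "\<phi> \<in> schwartz"
  shows "fourier (partial_deriv i \<phi>) \<xi> = \<i> * of_real (\<xi> $ i) * fourier \<phi> \<xi>"
proof -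
  let ?e = "axis i 1 :: real^'n"
  define t where "t n = 1 / real (Suc n)" for n
  have t: "0 < t n" "t n \<le> 1" for n by (auto simp: t_def)
  have t0: "t \<longlonglongrightarrow> 0" unfolding t_def by (rule LIMSEQ_Suc[OF lim_1_over_n])
  have [measurable]: "\<phi> \<in> borel_measurable borel" "partial_deriv i \<phi> \<in> borel_measurable borel"
    using S schwartz_partial_deriv[OF S, of i] by measurable
  define s where "s n x = cis (- (x \<bullet> \<xi>)) * ((\<phi> (x + t n *\<^sub>R ?e) - \<phi> x) / of_real (t n))" for n x
  have dd: "((\<lambda>s. \<phi> (x + s *\<^sub>R ?e)) has_vector_derivative partial_deriv i \<phi> (x + s *\<^sub>R ?e)) (at s)" for x s
    by (rule directional_derivative[OF smooth_differentiable[OF schwartz_smooth[OF S]]])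
  obtain B where B: "\<And>x. (1 + norm x) ^ (CARD('n) + 1) * norm (partial_deriv i \<phi> x) \<le> B"
    using schwartz_bound[OF schwartz_partial_deriv[OF S], of "CARD('n) + 1" i] by metis
  have dq: "norm ((\<phi> (x + t n *\<^sub>R ?e) - \<phi> x) / of_real (t n)) \<le> B * 2 ^ (CARD('n) + 1) * (1 / (1 + norm x) ^ (CARD('n) + 1))" (is "_ \<le> ?R x") for n x
  proof -
    have "norm (\<phi> (x + t n *\<^sub>R ?e) - \<phi> (x + 0 *\<^sub>R ?e)) \<le> ?R x * norm (t n - 0)"
    proof (rule differentiable_bound[where f' = "\<lambda>s h. h *\<^sub>R partial_deriv i \<phi> (x + s *\<^sub>R ?e)"])
      show "convex {0..t n}" by simp
      show "((\<lambda>s. \<phi> (x + s *\<^sub>R ?e)) has_derivative (\<lambda>h. h *\<^sub>R partial_deriv i \<phi> (x + s *\<^sub>R ?e))) (at s within {0..t n})" for s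
        using dd[of x s] unfolding has_vector_derivative_def by (rule has_derivative_at_withinI)
      fix s assume s: "s \<in> {0..t n}"
      let ?y = "x + s *\<^sub>R ?e"
      have "norm x \<le> norm ?y + norm (s *\<^sub>R ?e)"
        using norm_triangle_ineq4[of ?y "s *\<^sub>R ?e"] by simp
      moreover have "norm (s *\<^sub>R ?e) \<le> 1" using s t[of n] by auto
      \<comment> \<open>The shift is at most 1, so the weight changes by at most a factor 2 along
        the segment; hence the \<open>2 ^ (CARD('n) + 1)\<close> in the majorant.\<close>
      moreover have "1 + a \<le> 2 * (1 + b)" if "a \<le> b + c" "c \<le> 1" "0 \<le> b" for a b c :: real using that by argo
      ultimately have "1 + norm x \<le> 2 * (1 + norm ?y)" by (meson norm_ge_zero)
      then have "(1 + norm x) ^ (CARD('n) + 1) \<le> (2 * (1 + norm ?y)) ^ (CARD('n) + 1)"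
        by (intro power_mono) auto
      also have "\<dots> = 2 ^ (CARD('n) + 1) * (1 + norm ?y) ^ (CARD('n) + 1)" by (rule power_mult_distrib)
      finally have "(1 + norm x) ^ (CARD('n) + 1) * norm (partial_deriv i \<phi> ?y)
          \<le> 2 ^ (CARD('n) + 1) * (1 + norm ?y) ^ (CARD('n) + 1) * norm (partial_deriv i \<phi> ?y)"
        by (intro mult_right_mono) auto
      also have "\<dots> \<le> 2 ^ (CARD('n) + 1) * B"
        using B[of ?y] by (simp only: mult.assoc) (intro mult_left_mono, auto)
      finally have *: "norm (partial_deriv i \<phi> ?y) \<le> ?R x"
        using zero_less_power[of "1 + norm x" "CARD('n) + 1"]
        by (simp add: pos_le_divide_eq mult.commute add_pos_nonneg)
      show "onorm (\<lambda>h. h *\<^sub>R partial_deriv i \<phi> ?y) \<le> ?R x"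
      proof (rule onorm_le)
        fix h :: real
        show "norm (h *\<^sub>R partial_deriv i \<phi> ?y) \<le> ?R x * norm h"
          using mult_right_mono[OF *, of "\<bar>h\<bar>"] by (simp add: mult.commute)
      qed
    qed (use t[of n] in auto)
    then show ?thesis
      using t[of n] by (simp add: norm_divide pos_divide_le_eq)
  qed
  have "(\<lambda>n. integral\<^sup>L lborel (s n)) \<longlonglongrightarrow> (LINT x|lborel. cis (- (x \<bullet> \<xi>)) * partial_deriv i \<phi> x)"
  proof (rule integral_dominated_convergence)
    show "integrable lborel (\<lambda>x::real^'n. B * 2 ^ (CARD('n) + 1) * (1 / (1 + norm x) ^ (CARD('n) + 1)))"
      using integrable_inverse_power_norm[where 'a = "real^'n"] by (intro integrable_mult_right) simp
    show "AE x in lborel. norm (s n x) \<le> B * 2 ^ (CARD('n) + 1) * (1 / (1 + norm x) ^ (CARD('n) + 1))" for n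
      unfolding s_def norm_mult norm_cis mult_1 using dq by (intro AE_I2)
    show "AE x in lborel. (\<lambda>n. s n x) \<longlonglongrightarrow> cis (- (x \<bullet> \<xi>)) * partial_deriv i \<phi> x"
    proof (rule AE_I2)
      fix x
      let ?d = "partial_deriv i \<phi> x"
      have "((\<lambda>h. norm (\<phi> (x + h *\<^sub>R ?e) - \<phi> x - h *\<^sub>R ?d) / norm h) \<longlongrightarrow> 0) (at 0)"
        using dd[of x 0] by (simp add: has_vector_derivative_def has_derivative_at)
      then have "(\<lambda>n. norm (\<phi> (x + t n *\<^sub>R ?e) - \<phi> x - t n *\<^sub>R ?d) / norm (t n)) \<longlonglongrightarrow> 0"
        by (rule filterlim_compose) (use t t0 in \<open>auto simp: filterlim_at less_imp_neq[symmetric]\<close>)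
      moreover have "norm (\<phi> (x + t n *\<^sub>R ?e) - \<phi> x - t n *\<^sub>R ?d) / norm (t n)
          = norm ((\<phi> (x + t n *\<^sub>R ?e) - \<phi> x) / of_real (t n) - ?d)" for n
      proof -
        have "(\<phi> (x + t n *\<^sub>R ?e) - \<phi> x) / of_real (t n) - ?d
            = (\<phi> (x + t n *\<^sub>R ?e) - \<phi> x - t n *\<^sub>R ?d) / of_real (t n)"
          using t(1)[of n] by (simp add: diff_divide_distrib scaleR_conv_of_real)
        then show ?thesis by (simp only: norm_divide norm_of_real real_norm_def)
      qed
      ultimately have "(\<lambda>n. norm ((\<phi> (x + t n *\<^sub>R ?e) - \<phi> x) / of_real (t n) - ?d)) \<longlonglongrightarrow> 0"
        by (simp only:)
      from LIM_zero_cancel[OF tendsto_norm_zero_cancel[OF this]]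
      show "(\<lambda>n. s n x) \<longlonglongrightarrow> cis (- (x \<bullet> \<xi>)) * ?d"
        unfolding s_def by (intro tendsto_mult tendsto_const)
    qed
    show "(\<lambda>x. cis (- (x \<bullet> \<xi>)) * partial_deriv i \<phi> x) \<in> borel_measurable lborel" by measurable
    show "s n \<in> borel_measurable lborel" for n unfolding s_def by measurable
  qed
  moreover have "integral\<^sup>L lborel (s n) = (cis (t n * (\<xi> $ i)) - 1) / of_real (t n) * fourier \<phi> \<xi>" for n
  proof -
    let ?g = "\<lambda>x. cis (- (x \<bullet> \<xi>)) * \<phi> x"
    have g: "integrable lborel ?g" "?g \<in> borel_measurable borel"
      using integrable_cis_mult[OF schwartz_borel[OF S] schwartz_integrable[OF S]] by (auto, measurable)
    \<comment> \<open>Recentring the kernel at the shifted point produces the phase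
      \<open>cis (t n * (\<xi> $ i))\<close>; the shift itself then disappears under the
      integral.\<close>
    have c: "cis (- (x \<bullet> \<xi>)) * \<phi> (x + t n *\<^sub>R ?e) = cis (t n * (\<xi> $ i)) * ?g (t n *\<^sub>R ?e + x)" for x
    proof -
      have "cis (t n * (\<xi> $ i)) * cis (- ((t n *\<^sub>R ?e + x) \<bullet> \<xi>)) = cis (- (x \<bullet> \<xi>))"
        by (simp add: cis_mult inner_add_left inner_axis' )
      then show ?thesis by (simp add: mult.assoc[symmetric] add.commute)
    qed
    have "s n = (\<lambda>x. (cis (t n * (\<xi> $ i)) * ?g (t n *\<^sub>R ?e + x) - ?g x) / of_real (t n))"
      by (rule ext) (simp add: s_def c[symmetric] right_diff_distrib)
    then have "integral\<^sup>L lborel (s n) = (cis (t n * (\<xi> $ i)) * integral\<^sup>L lborel ?g - integral\<^sup>L lborel ?g) / of_real (t n)"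
      using g lborel_integrable_translate[OF g(2,1), of "t n *\<^sub>R ?e"] lborel_integral_translate[OF g(2), of "t n *\<^sub>R ?e"]
      by simp
    then show ?thesis
      by (simp add: fourier_lborel[OF schwartz_borel[OF S]] algebra_simps diff_divide_distrib)
  qed
  moreover have "(\<lambda>n. (cis (t n * (\<xi> $ i)) - 1) / of_real (t n) * fourier \<phi> \<xi>) \<longlonglongrightarrow> \<i> * of_real (\<xi> $ i) * fourier \<phi> \<xi>"
  proof (intro tendsto_mult tendsto_const)
    let ?a = "\<xi> $ i"
    show "(\<lambda>n. (cis (t n * ?a) - 1) / of_real (t n)) \<longlonglongrightarrow> \<i> * of_real ?a"
    proof (rule LIM_zero_cancel, rule tendsto_0_le[of t])
      show "t \<longlonglongrightarrow> 0" by (rule t0)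
      show "\<forall>\<^sub>F n in sequentially. norm ((cis (t n * ?a) - 1) / of_real (t n) - \<i> * of_real ?a) \<le> norm (t n) * ?a\<^sup>2"
      proof (rule always_eventually, rule allI)
        fix n
        \<comment> \<open>The Taylor bound is stated for \<open>cis (- t)\<close>, which is why
          \<open>- ?a\<close> is inserted.\<close>
        have "(cis (t n * ?a) - 1) / of_real (t n) - \<i> * of_real ?a = (cis (- (t n * - ?a)) - 1 + \<i> * of_real (t n * - ?a)) / of_real (t n)"
          using t[of n] by (simp add: field_simps)
        also have "norm \<dots> \<le> (t n * - ?a)\<^sup>2 / t n"
          using norm_cis_taylor[of "t n * - ?a"] t[of n] by (simp add: norm_divide divide_right_mono)
        also have "\<dots> = norm (t n) * ?a\<^sup>2" using t[of n] by (simp add: power2_eq_square)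
        finally show "norm ((cis (t n * ?a) - 1) / of_real (t n) - \<i> * of_real ?a) \<le> norm (t n) * ?a\<^sup>2" .
      qed
    qed
  qed
  ultimately show ?thesis
    unfolding fourier_lborel[OF \<open>partial_deriv i \<phi> \<in> borel_measurable borel\<close>] by (simp add: LIMSEQ_unique)
qed

section \<open>Invariance of the Schwartz space under the Fourier transform\<close>

lemma borel_measurable_cnj [measurable (raw)]:
  assumes "f \<in> borel_measurable M"
  shows "(\<lambda>x. cnj (f x)) \<in> borel_measurable M"
proof -
  have "cnj \<in> borel_measurable borel" by (intro borel_measurable_continuous_onI continuous_on_cnj continuous_on_id)
  from measurable_compose[OF assms this] show ?thesis .
qed

lemma norm_coord_mult_fourier:
  assumes "\<phi> \<in> schwartz"
  shows "\<bar>\<xi> $ i\<bar> * norm (fourier \<phi> \<xi>) = norm (fourier (partial_deriv i \<phi>) \<xi>)"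
  by (simp add: fourier_partial_deriv[OF assms] norm_mult)

text \<open>One more power of the weight is traded for one derivative of \<open>\<phi>\<close>,
  since a coordinate times the transform has the modulus of the transform of a derivative. Decay of
  every order then follows by induction from boundedness.\<close>

lemma weight_Suc_le:
  fixes \<xi> :: "real^'n::finite"
  assumes "\<phi> \<in> schwartz"
  shows "(1 + norm \<xi>) ^ Suc k * norm (fourier \<phi> \<xi>)
    \<le> (1 + norm \<xi>) ^ k * norm (fourier \<phi> \<xi>) + (\<Sum>i\<in>UNIV. (1 + norm \<xi>) ^ k * norm (fourier (partial_deriv i \<phi>) \<xi>))"
proof -
  have "(1 + norm \<xi>) * norm (fourier \<phi> \<xi>) \<le> (1 + (\<Sum>i\<in>UNIV. \<bar>\<xi> $ i\<bar>)) * norm (fourier \<phi> \<xi>)"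
    using norm_le_l1_cart[of \<xi>] by (intro mult_right_mono) auto
  also have "\<dots> = norm (fourier \<phi> \<xi>) + (\<Sum>i\<in>UNIV. norm (fourier (partial_deriv i \<phi>) \<xi>))"
    by (simp only: distrib_right mult_1 sum_distrib_right norm_coord_mult_fourier[OF assms])
  finally have "(1 + norm \<xi>) ^ k * ((1 + norm \<xi>) * norm (fourier \<phi> \<xi>))
    \<le> (1 + norm \<xi>) ^ k * (norm (fourier \<phi> \<xi>) + (\<Sum>i\<in>UNIV. norm (fourier (partial_deriv i \<phi>) \<xi>)))"
    by (intro mult_left_mono) auto
  also have "\<dots> = (1 + norm \<xi>) ^ k * norm (fourier \<phi> \<xi>) + (\<Sum>i\<in>UNIV. (1 + norm \<xi>) ^ k * norm (fourier (partial_deriv i \<phi>) \<xi>))"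
    by (simp only: distrib_left sum_distrib_left)
  finally show ?thesis by (simp only: power_Suc2 mult.assoc)
qed

text \<open>The class of Fourier transforms of Schwartz functions is closed under
  \<open>partial_deriv i\<close> outright, so no sums arise. The bounds go by induction on the
  weight with \<open>\<phi>\<close> varying, because the step passes to derivatives of
  \<open>\<phi>\<close>.\<close>

lemma schwartz_fourier:
  fixes \<phi> :: "real^'n::finite \<Rightarrow> complex"
  assumes "\<phi> \<in> schwartz"
  shows "fourier \<phi> \<in> schwartz"
proof (rule schwartz_coinduct[where C = "\<lambda>h. \<exists>\<phi>\<in>schwartz. h = fourier \<phi>"])
  show "\<exists>\<psi>\<in>schwartz. fourier \<phi> = fourier \<psi>" using assms by blast
  show "h differentiable (at x)" if "\<exists>\<phi>\<in>schwartz. h = fourier \<phi>" for h and x :: "real^'n"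
    using that by (auto intro: fourier_differentiable)
  show "sums_of (\<lambda>h. \<exists>\<phi>\<in>schwartz. h = fourier \<phi>) (partial_deriv i h)" if "\<exists>\<phi>\<in>schwartz. h = fourier \<phi>" for h and i :: 'n
  proof -
    from that obtain \<phi> where \<phi>: "\<phi> \<in> schwartz" and h: "h = fourier \<phi>" by blast
    show ?thesis
      unfolding h partial_deriv_fourier[OF \<phi>]
      using schwartz_cmult[OF schwartz_coord_mult[OF \<phi>], of "- \<i>" i] by (intro sums_of.base) blast
  qed
  have "\<exists>B. \<forall>x. (1 + norm x) ^ k * norm (fourier \<phi> x) \<le> B" if "\<phi> \<in> schwartz" for k and \<phi> :: "real^'n \<Rightarrow> complex"
    using that
  proof (induction k arbitrary: \<phi>)
    case 0
    show ?case
      using norm_fourier_le[OF schwartz_borel[OF 0]] unfolding power_0 mult_1 by (intro exI allI)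
  next
    case (Suc k)
    obtain B0 where B0: "\<And>x. (1 + norm x) ^ k * norm (fourier \<phi> x) \<le> B0"
      using Suc.IH[OF Suc.prems] by blast
    have "\<forall>i. \<exists>B. \<forall>x. (1 + norm x) ^ k * norm (fourier (partial_deriv i \<phi>) x) \<le> B"
      using Suc.IH[OF schwartz_partial_deriv[OF Suc.prems]] by blast
    then obtain B where B: "\<And>i x. (1 + norm x) ^ k * norm (fourier (partial_deriv i \<phi>) x) \<le> B i"
      by metis
    have "(1 + norm x) ^ Suc k * norm (fourier \<phi> x) \<le> B0 + (\<Sum>i\<in>UNIV. B i)" for x
      by (rule order_trans[OF weight_Suc_le[OF Suc.prems]]) (intro add_mono B0 sum_mono B)
    then show ?case by blast
  qed
  then show "\<exists>B. \<forall>x. (1 + norm x) ^ k * norm (h x) \<le> B" if "\<exists>\<phi>\<in>schwartz. h = fourier \<phi>" for h :: "real^'n \<Rightarrow> complex" and k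
    using that by blast
qed

section \<open>Symmetries of the Fourier transform and the multiplication formula\<close>

lemma fourier_cnj:
  assumes "\<phi> \<in> borel_measurable borel"
  shows "fourier (\<lambda>x. cnj (\<phi> x)) \<xi> = cnj (fourier \<phi> (- \<xi>))"
proof -
  have [measurable]: "\<phi> \<in> borel_measurable borel" by fact
  have m: "(\<lambda>x. cnj (\<phi> x)) \<in> borel_measurable borel" by measurable
  show ?thesis
    unfolding fourier_lborel[OF assms] fourier_lborel[OF m]
    by (simp only: Bochner_Integration.integral_cnj[symmetric] complex_cnj_mult cis_cnj inner_minus_right minus_minus)
qed

lemma fourier_uminus:
  assumes "\<phi> \<in> borel_measurable borel"
  shows "fourier (\<lambda>x. \<phi> (- x)) \<xi> = fourier \<phi> (- \<xi>)"
proof -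
  have [measurable]: "\<phi> \<in> borel_measurable borel" by fact
  have m: "(\<lambda>x. \<phi> (- x)) \<in> borel_measurable borel" by measurable
  have "(\<lambda>x. cis (- (x \<bullet> - \<xi>)) * \<phi> x) \<in> borel_measurable borel" by measurable
  from lborel_integral_uminus[OF this] show ?thesis
    unfolding fourier_lborel[OF assms] fourier_lborel[OF m] by simp
qed

lemma fourier_cmult:
  assumes "\<phi> \<in> borel_measurable borel"
  shows "fourier (\<lambda>x. c * \<phi> x) \<xi> = c * fourier \<phi> \<xi>"
proof -
  have m: "(\<lambda>x. c * \<phi> x) \<in> borel_measurable borel" using assms by measurable
  show ?thesis
    unfolding fourier_lborel[OF assms] fourier_lborel[OF m]
    by (simp only: mult.left_commute[of _ c] integral_mult_right_zero)
qed

lemma fourier_diff: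
  assumes "\<phi> \<in> schwartz" "\<psi> \<in> schwartz"
  shows "fourier (\<lambda>x. \<phi> x - \<psi> x) \<xi> = fourier \<phi> \<xi> - fourier \<psi> \<xi>"
  unfolding fourier_lborel[OF schwartz_borel[OF assms(1)]] fourier_lborel[OF schwartz_borel[OF assms(2)]]
    fourier_lborel[OF schwartz_borel[OF schwartz_diff[OF assms]]] right_diff_distrib
  by (intro Bochner_Integration.integral_diff integrable_cis_mult schwartz_borel schwartz_integrable assms)

lemma fourier_borel:
  assumes "\<phi> \<in> borel_measurable borel"
  shows "fourier \<phi> \<in> borel_measurable borel"
proof -
  have [measurable]: "\<phi> \<in> borel_measurable borel" by fact
  have "(\<lambda>(\<xi>, x). cis (- (x \<bullet> \<xi>)) * \<phi> x) \<in> borel_measurable (borel \<Otimes>\<^sub>M lborel)" by measurable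
  from lborel.borel_measurable_lebesgue_integral[OF this]
  show ?thesis by (simp add: fourier_lborel[OF assms, abs_def] cong: measurable_cong)
qed

text \<open>The multiplication formula: Fubini for a kernel that is symmetric in its two variables.
  Inversion, Plancherel and the convolution theorem all start from it.\<close>

lemma fourier_swap:
  fixes a b :: "real^'n::finite \<Rightarrow> complex"
  assumes [measurable]: "a \<in> borel_measurable borel" "b \<in> borel_measurable borel"
    and int: "integrable lborel a" "integrable lborel b"
  shows "(LINT \<xi>|lborel. fourier a \<xi> * b \<xi>) = (LINT x|lborel. a x * fourier b x)"
proof -
  have "integrable (lborel \<Otimes>\<^sub>M lborel) (\<lambda>(x, \<xi>). cis (- (x \<bullet> \<xi>)) * (a x * b \<xi>))"
    by (rule Bochner_Integration.integrable_bound[OF lborel_pair.integrable_pair_mult[OF int]])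
      (measurable, auto simp: norm_mult)
  from lborel_pair.Fubini_integral[OF this]
  have "(LINT \<xi>|lborel. LINT x|lborel. cis (- (x \<bullet> \<xi>)) * (a x * b \<xi>))
      = (LINT x|lborel. LINT \<xi>|lborel. cis (- (x \<bullet> \<xi>)) * (a x * b \<xi>))" .
  moreover have "(LINT x|lborel. cis (- (x \<bullet> \<xi>)) * (a x * b \<xi>)) = fourier a \<xi> * b \<xi>" for \<xi>
    by (simp add: fourier_lborel mult.assoc[symmetric])
  moreover have "(LINT \<xi>|lborel. cis (- (x \<bullet> \<xi>)) * (a x * b \<xi>)) = a x * fourier b x" for x
    by (simp add: fourier_lborel mult.left_commute[of _ "a x"] inner_commute)
  ultimately show ?thesis by simp
qed

subsection \<open>The Gaussian and Fourier inversion\<close>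

lemma moderate_mult:
  fixes p q :: "real^'n::finite \<Rightarrow> complex"
  assumes "moderate p" "moderate q"
  shows "moderate (\<lambda>x. p x * q x)"
  unfolding moderate_def
proof (intro conjI allI)
  show "smooth (\<lambda>x. p x * q x)" using assms by (intro smooth_mult moderate_smooth)
  fix \<alpha> :: "'n list"
  define C where "C h \<longleftrightarrow> (\<exists>p q. moderate p \<and> moderate q \<and> h = (\<lambda>x::real^'n. p x * q x))" for h
  have C: "C (\<lambda>x. p x * q x)" if "moderate p" "moderate q" for p q
    unfolding C_def using that by blast
  have bound: "\<exists>C k. \<forall>x. norm (h x) \<le> C * (1 + norm x) ^ k" if "sums_of C h" for h
    using that
  proof (induction rule: sums_of.induct)
    case (base h)
    then obtain p q where pq: "moderate p" "moderate q" and h: "h = (\<lambda>x. p x * q x)"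
      unfolding C_def by blast
    obtain A k where A: "A > 0" "\<And>x. norm (p x) \<le> A * (1 + norm x) ^ k" using moderate_bound[OF pq(1)] by blast
    obtain B l where B: "B > 0" "\<And>x. norm (q x) \<le> B * (1 + norm x) ^ l" using moderate_bound[OF pq(2)] by blast
    have "norm (h x) \<le> (A * B) * (1 + norm x) ^ (k + l)" for x
    proof -
      have "norm (h x) \<le> (A * (1 + norm x) ^ k) * (B * (1 + norm x) ^ l)"
        unfolding h norm_mult using A B by (intro mult_mono) auto
      then show ?thesis by (simp add: power_add algebra_simps)
    qed
    then show ?case by blast
  next
    case (add f g)
    obtain A k where A: "\<And>x. norm (f x) \<le> A * (1 + norm x) ^ k" using add.IH(1) by blast
    obtain B l where B: "\<And>x. norm (g x) \<le> B * (1 + norm x) ^ l" using add.IH(2) by blast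
    have "norm (f x + g x) \<le> (\<bar>A\<bar> + \<bar>B\<bar>) * (1 + norm x) ^ (k + l)" for x
    proof -
      have "A * (1 + norm x) ^ k \<le> \<bar>A\<bar> * (1 + norm x) ^ (k + l)"
        by (intro mult_mono power_increasing) auto
      moreover have "B * (1 + norm x) ^ l \<le> \<bar>B\<bar> * (1 + norm x) ^ (k + l)"
        by (intro mult_mono power_increasing) auto
      ultimately show ?thesis
        using A[of x] B[of x] norm_triangle_ineq[of "f x" "g x"] by (simp add: distrib_right)
    qed
    then show ?case by blast
  qed
  have "sums_of C (partial_derivs \<alpha> (\<lambda>x. p x * q x))"
  proof (rule sums_of_partial_derivs[THEN conjunct1])
    show "sums_of C (\<lambda>x. p x * q x)" using C[OF assms] by (rule sums_of.base)
    fix h assume "C h"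
    then obtain p q where pq: "moderate p" "moderate q" and h: "h = (\<lambda>x. p x * q x)"
      unfolding C_def by blast
    note d = smooth_differentiable[OF moderate_smooth[OF pq(1)]] smooth_differentiable[OF moderate_smooth[OF pq(2)]]
    show "h differentiable (at x)" for x unfolding h by (intro differentiable_mult d)
    show "sums_of C (partial_deriv i h)" for i
      unfolding h partial_deriv_mult[of p q, OF d]
      by (intro sums_of.add sums_of.base C pq moderate_partial_deriv)
  qed
  then show "\<exists>C k. \<forall>x. norm (partial_derivs \<alpha> (\<lambda>x. p x * q x) x) \<le> C * (1 + norm x) ^ k"
    by (rule bound)
qed

text \<open>The factor one half in the exponent makes the Gaussian a multiple of its own Fourier
  transform.\<close>

definition gauss :: "real^'n::finite \<Rightarrow> complex" where
  "gauss x = of_real (exp (- (x \<bullet> x) / 2))"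

lemma gauss_has_derivative: "(gauss has_derivative (\<lambda>h. - of_real (x \<bullet> h) * gauss x)) (at x)"
proof -
  have "((\<lambda>x. exp (- (x \<bullet> x) / 2)) has_derivative (\<lambda>h. - (x \<bullet> h) * exp (- (x \<bullet> x) / 2))) (at x)"
    by (auto intro!: derivative_eq_intros simp: inner_commute algebra_simps)
  from has_derivative_of_real[OF this, where 'a = complex]
  show ?thesis by (simp add: gauss_def[abs_def])
qed

lemma partial_deriv_gauss: "partial_deriv i gauss = (\<lambda>x. - (of_real (x $ i) * gauss x))"
  by (rule ext, subst partial_deriv_eq[OF gauss_has_derivative]) (simp add: inner_axis)

text \<open>A single term of the exponential series is at most the whole series. The exponential
  thereby absorbs powers, here for the Gaussian and later for the flat function behind the
  bump.\<close>

lemma power_le_fact_mult_exp: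
  fixes y :: real
  assumes "0 \<le> y"
  shows "y ^ k \<le> fact k * exp y"
proof -
  have "(\<Sum>n\<in>{k}. y ^ n /\<^sub>R fact n) \<le> (\<Sum>n. y ^ n /\<^sub>R fact n)"
    using assms summable_exp_generic[of y] by (intro sum_le_suminf) auto
  then show ?thesis
    by (simp add: exp_def field_simps)
qed

lemma schwartz_gauss: "(gauss :: real^'n::finite \<Rightarrow> complex) \<in> schwartz"
proof -
  define C where "C h \<longleftrightarrow> (\<exists>p. moderate p \<and> h = (\<lambda>x::real^'n. p x * gauss x))" for h
  have C: "C (\<lambda>x. p x * gauss x)" if "moderate p" for p
    unfolding C_def using that by blast
  have dg: "gauss differentiable (at x)" for x :: "real^'n"
    using gauss_has_derivative differentiable_def by blast
  show ?thesis
  proof (rule schwartz_coinduct[where C = C])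
    show "C gauss" using C[OF moderate_const[of 1]] by simp
    fix h assume "C h"
    then obtain p where p: "moderate p" and h: "h = (\<lambda>x. p x * gauss x)"
      unfolding C_def by blast
    note dp = smooth_differentiable[OF moderate_smooth[OF p]]
    show "h differentiable (at x)" for x unfolding h by (intro differentiable_mult dp dg)
    show "sums_of C (partial_deriv i h)" for i
    proof -
      have "C (\<lambda>x. ((- 1) * (p x * of_real (x $ i))) * gauss x)"
        by (rule C) (intro moderate_mult p moderate_const moderate_coord)
      moreover have "(\<lambda>x. ((- 1) * (p x * of_real (x $ i))) * gauss x) = (\<lambda>x. p x * - (of_real (x $ i) * gauss x))"
        by (simp add: mult.assoc)
      ultimately have "C (\<lambda>x. p x * - (of_real (x $ i) * gauss x))" by (simp only:)
      then show ?thesis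
        unfolding h partial_deriv_mult[of p gauss, OF dp dg] partial_deriv_gauss
        by (intro sums_of.add sums_of.base C moderate_partial_deriv p)
    qed
    show "\<exists>B. \<forall>x. (1 + norm x) ^ k * norm (h x) \<le> B" for k
    proof -
      obtain A l where A: "A > 0" "\<And>x. norm (p x) \<le> A * (1 + norm x) ^ l" using moderate_bound[OF p] by blast
      have "(1 + norm x) ^ k * norm (h x) \<le> A * fact (k + l) * exp (3 / 2)" for x
      proof -
        have "(1 + norm x) ^ k * norm (h x) \<le> (1 + norm x) ^ k * ((A * (1 + norm x) ^ l) * exp (- (x \<bullet> x) / 2))"
          unfolding h norm_mult gauss_def using A by (intro mult_left_mono mult_mono) auto
        also have "\<dots> = A * ((1 + norm x) ^ (k + l) * exp (- (x \<bullet> x) / 2))"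
          by (simp add: power_add)
        also have "\<dots> \<le> A * ((fact (k + l) * exp (1 + norm x)) * exp (- (x \<bullet> x) / 2))"
          using A by (intro mult_left_mono mult_right_mono power_le_fact_mult_exp) auto
        also have "\<dots> = A * fact (k + l) * exp (1 + norm x + - (x \<bullet> x) / 2)"
          by (simp only: mult.assoc exp_add[symmetric])
        also have "\<dots> \<le> A * fact (k + l) * exp (3 / 2)"
        proof -
          \<comment> \<open>Completing the square: \<open>1 + s - s * s / 2\<close> is largest at
            \<open>s = 1\<close>, which gives the exponent \<open>3 / 2\<close>.\<close>
          have "0 \<le> (norm x - 1)\<^sup>2" by simp
          then have "1 + norm x + - (x \<bullet> x) / 2 \<le> 3 / 2"
            by (simp add: power2_diff dot_square_norm)
          then show ?thesis using A by (intro mult_left_mono) auto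
        qed
        finally show ?thesis .
      qed
      then show ?thesis by blast
    qed
  qed
qed

section \<open>The Fourier transform of the Gaussian\<close>

lemma frechet_derivative_partial_derivs:
  fixes q :: "real^'n::finite \<Rightarrow> complex"
  assumes "q differentiable (at x)"
  shows "frechet_derivative q (at x) h = (\<Sum>i\<in>UNIV. (h $ i) *\<^sub>R partial_deriv i q x)"
proof -
  have lin: "linear (frechet_derivative q (at x))"
    using linear_frechet_derivative[OF assms] .
  have "h = (\<Sum>i\<in>UNIV. (h $ i) *\<^sub>R axis i 1)"
    using basis_expansion[of h] by (simp only: scalar_mult_eq_scaleR)
  from arg_cong[OF this, of "frechet_derivative q (at x)"]
  show ?thesis
    by (simp only: linear_sum[OF lin] linear_scale[OF lin] partial_deriv_def)
qed

lemma constant_if_partial_derivs_zero: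
  fixes q :: "real^'n::finite \<Rightarrow> complex"
  assumes d: "\<And>x. q differentiable (at x)" and z: "\<And>i x. partial_deriv i q x = 0"
  shows "q x = q 0"
proof -
  have "frechet_derivative q (at x) = (\<lambda>h. 0)" for x
    by (simp add: frechet_derivative_partial_derivs[OF d] z fun_eq_iff)
  then have "(q has_derivative (\<lambda>h. 0)) (at x within UNIV)" for x
    using d[of x] unfolding frechet_derivative_works by simp
  from has_derivative_zero_constant[OF convex_UNIV this]
  obtain c where "\<And>x. q x = c" by auto
  then show ?thesis by simp
qed

text \<open>The Gaussian and its transform solve the same system, in which the derivative in
  direction \<open>i\<close> is \<open>- (x $ i)\<close> times the function, because the transform
  exchanges derivatives and coordinates. Their quotient is therefore constant; \<open>e\<close> is
  the reciprocal of the Gaussian.\<close>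

lemma fourier_gauss:
  fixes \<xi> :: "real^'n::finite"
  shows "fourier gauss \<xi> = fourier gauss (0 :: real^'n) * gauss \<xi>"
proof -
  define e where "e x = complex_of_real (exp ((x \<bullet> x) / 2))" for x :: "real^'n"
  have e': "(e has_derivative (\<lambda>h. of_real (x \<bullet> h) * e x)) (at x)" for x
  proof -
    have "((\<lambda>x. exp ((x \<bullet> x) / 2)) has_derivative (\<lambda>h. (x \<bullet> h) * exp ((x \<bullet> x) / 2))) (at x)"
      by (auto intro!: derivative_eq_intros simp: inner_commute algebra_simps)
    from has_derivative_of_real[OF this, where 'a = complex]
    show ?thesis by (simp add: e_def[abs_def])
  qed
  have de: "e differentiable (at x)" for x using e' differentiable_def by blast
  have pe: "partial_deriv i e = (\<lambda>x. of_real (x $ i) * e x)" for i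
    by (rule ext, subst partial_deriv_eq[OF e']) (simp add: inner_axis)
  have df: "fourier gauss differentiable (at x)" for x :: "real^'n"
    by (rule fourier_differentiable[OF schwartz_gauss])
  have pf: "partial_deriv i (fourier gauss) x = - (of_real (x $ i) * fourier gauss x)" for i and x :: "real^'n"
  proof -
    have b: "partial_deriv i gauss \<in> borel_measurable borel"
      by (intro schwartz_borel schwartz_partial_deriv schwartz_gauss)
    have "(\<lambda>x. - \<i> * (of_real (x $ i) * gauss x)) = (\<lambda>x. \<i> * partial_deriv i gauss x)"
      by (simp add: partial_deriv_gauss)
    then have "partial_deriv i (fourier gauss) x = fourier (\<lambda>x. \<i> * partial_deriv i gauss x) x"
      by (simp only: partial_deriv_fourier[OF schwartz_gauss])
    also have "\<dots> = \<i> * (\<i> * of_real (x $ i) * fourier gauss x)"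
      by (simp only: fourier_cmult[OF b] fourier_partial_deriv[OF schwartz_gauss])
    finally show ?thesis by (simp add: mult.assoc[symmetric])
  qed
  have "fourier gauss \<xi> * e \<xi> = fourier gauss (0 :: real^'n) * e 0"
  proof (rule constant_if_partial_derivs_zero[of "\<lambda>x. fourier gauss x * e x"])
    show "(\<lambda>x. fourier gauss x * e x) differentiable (at x)" for x by (intro differentiable_mult df de)
    show "partial_deriv i (\<lambda>x. fourier gauss x * e x) x = 0" for i x
      unfolding partial_deriv_mult[of "fourier gauss" e, OF df de] pe pf by (simp add: algebra_simps)
  qed
  moreover have "e \<xi> * gauss \<xi> = 1" "e 0 = 1"
    by (simp_all add: e_def gauss_def exp_minus flip: of_real_mult)
  ultimately show ?thesis by (metis mult.assoc mult.right_neutral)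
qed

text \<open>Its value is \<open>(2 * pi) ^ CARD('n)\<close>; only its positivity matters below.\<close>

definition inversion_const :: "'n::finite itself \<Rightarrow> real" where
  "inversion_const _ = (LINT x|lborel. exp (- ((x :: real^'n) \<bullet> x) / 2))\<^sup>2"

lemma gauss_integrable: "integrable lborel (\<lambda>x::real^'n::finite. exp (- (x \<bullet> x) / 2))"
  using integrable_norm[OF schwartz_integrable[OF schwartz_gauss[where 'n = 'n]]] by (simp add: gauss_def)

lemma inversion_const_pos: "inversion_const TYPE('n::finite) > 0"
proof -
  have "(LINT x|lborel. exp (- ((x :: real^'n) \<bullet> x) / 2)) \<noteq> 0"
  proof
    assume "(LINT x|lborel. exp (- ((x :: real^'n) \<bullet> x) / 2)) = 0"
    then have "AE x in lborel. exp (- ((x :: real^'n) \<bullet> x) / 2) = 0"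
      by (subst (asm) integral_nonneg_eq_0_iff_AE[OF gauss_integrable]) auto
    then have "AE x in (lborel :: (real^'n) measure). False" by simp
    then show False by (simp add: AE_iff_null null_sets_def)
  qed
  then show ?thesis by (simp add: inversion_const_def)
qed

lemma fourier_gauss_0: "(fourier gauss (0 :: real^'n::finite))\<^sup>2 = of_real (inversion_const TYPE('n))"
  by (simp add: fourier_lborel schwartz_borel schwartz_gauss inversion_const_def gauss_def[abs_def] cis_zero)

text \<open>Multiplying by the dilated Gaussian turns the iterated integral into an average of \<open>\<phi>\<close>
  against a dilated Gaussian, in which the dilation parameter can be sent to zero.\<close>

theorem fourier_inversion:
  fixes \<phi> :: "real^'n::finite \<Rightarrow> complex"
  assumes S: "\<phi> \<in> schwartz"
  shows "fourier (fourier \<phi>) x = of_real (inversion_const TYPE('n)) * \<phi> (- x)"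
proof -
  define K where "K = fourier gauss (0 :: real^'n)"
  define t where "t n = 1 / real (Suc n)" for n
  have t: "0 < t n" "t n \<noteq> 0" for n by (auto simp: t_def)
  have t0: "t \<longlonglongrightarrow> 0" unfolding t_def by (rule LIMSEQ_Suc[OF lim_1_over_n])
  have F: "fourier \<phi> \<in> schwartz" by (rule schwartz_fourier[OF S])
  note [measurable] = schwartz_borel[OF S] schwartz_borel[OF F] schwartz_borel[OF schwartz_gauss[where 'n = 'n]]
  have gi: "integrable lborel (gauss :: real^'n \<Rightarrow> complex)" by (rule schwartz_integrable[OF schwartz_gauss])
  have cg: "continuous_on UNIV (gauss :: real^'n \<Rightarrow> complex)"
    by (rule smooth_continuous_on[OF schwartz_smooth[OF schwartz_gauss]])
  \<comment> \<open>A Gaussian regularisation of the kernel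
    \<open>cis (- (\<xi> \<bullet> x))\<close>; it makes the second factor integrable, as the
    multiplication formula requires.\<close>
  define b where "b n \<xi> = cis (- (\<xi> \<bullet> x)) * gauss (t n *\<^sub>R \<xi>)" for n and \<xi> :: "real^'n"
  have [measurable]: "b n \<in> borel_measurable borel" for n unfolding b_def by measurable
  have bi: "integrable lborel (b n)" for n
  proof -
    have "integrable lborel (\<lambda>\<xi>::real^'n. gauss (0 + t n *\<^sub>R \<xi>))"
      using lborel_integrable_affine_iff[OF schwartz_borel[OF schwartz_gauss] t(2)[of n], of "0::real^'n"] gi by simp
    then show ?thesis unfolding b_def by (intro integrable_cis_mult) auto
  qed
  \<comment> \<open>The transform of a modulated, dilated Gaussian is again a Gaussian, now
    concentrated at \<open>- x\<close> on the scale \<open>t n\<close>.\<close>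
  have Fb: "of_real (\<bar>t n\<bar> ^ DIM(real^'n)) * fourier (b n) y = K * gauss (inverse (t n) *\<^sub>R (x + y))" for n y
  proof -
    let ?z = "inverse (t n) *\<^sub>R (x + y)"
    have "(\<lambda>\<eta>. cis (- (\<eta> \<bullet> ?z)) * gauss \<eta>) \<in> borel_measurable borel" by measurable
    from lborel_integral_affine[OF this t(2)[of n], of 0]
    have "fourier gauss ?z = of_real (\<bar>t n\<bar> ^ DIM(real^'n)) * (LINT \<xi>|lborel. cis (- ((t n *\<^sub>R \<xi>) \<bullet> ?z)) * gauss (t n *\<^sub>R \<xi>))"
      by (simp add: fourier_lborel scaleR_conv_of_real[where 'a = complex])
    also have "(LINT \<xi>|lborel. cis (- ((t n *\<^sub>R \<xi>) \<bullet> ?z)) * gauss (t n *\<^sub>R \<xi>)) = (LINT \<xi>|lborel. cis (- (\<xi> \<bullet> y)) * b n \<xi>)"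
    proof (intro Bochner_Integration.integral_cong refl)
      fix \<xi> :: "real^'n"
      have "(t n *\<^sub>R \<xi>) \<bullet> ?z = \<xi> \<bullet> (x + y)" using t[of n] by simp
      then have "cis (- ((t n *\<^sub>R \<xi>) \<bullet> ?z)) = cis (- (\<xi> \<bullet> y)) * cis (- (\<xi> \<bullet> x))"
        by (simp only: cis_mult inner_add_right) (simp add: algebra_simps)
      then show "cis (- ((t n *\<^sub>R \<xi>) \<bullet> ?z)) * gauss (t n *\<^sub>R \<xi>) = cis (- (\<xi> \<bullet> y)) * b n \<xi>"
        by (simp only: b_def mult.assoc)
    qed
    finally show ?thesis
      by (simp only: fourier_lborel[of "b n"] \<open>b n \<in> borel_measurable borel\<close> fourier_gauss[of ?z] K_def)
  qed
  have R: "(LINT \<xi>|lborel. fourier \<phi> \<xi> * b n \<xi>) = K * (LINT z|lborel. \<phi> (- x + t n *\<^sub>R z) * gauss z)" for n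
  proof -
    have "(LINT \<xi>|lborel. fourier \<phi> \<xi> * b n \<xi>) = (LINT y|lborel. \<phi> y * fourier (b n) y)"
      by (rule fourier_swap) (auto intro: bi schwartz_integrable S)
    \<comment> \<open>The substitution moves the parameter from the Gaussian into the argument of
      \<open>\<phi>\<close>, where continuity can be used.\<close>
    also have "\<dots> = \<bar>t n\<bar> ^ DIM(real^'n) *\<^sub>R (LINT z|lborel. \<phi> (- x + t n *\<^sub>R z) * fourier (b n) (- x + t n *\<^sub>R z))"
    proof (rule lborel_integral_affine)
      have [measurable]: "fourier (b n) \<in> borel_measurable borel" by (rule fourier_borel) simp
      show "(\<lambda>y. \<phi> y * fourier (b n) y) \<in> borel_measurable borel" by measurable
    qed (rule t)
    also have "\<dots> = (LINT z|lborel. \<phi> (- x + t n *\<^sub>R z) * (of_real (\<bar>t n\<bar> ^ DIM(real^'n)) * fourier (b n) (- x + t n *\<^sub>R z)))"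
      by (simp only: scaleR_conv_of_real[where 'a = complex] mult.left_commute[of _ "of_real _"] integral_mult_right_zero)
    also have "\<dots> = (LINT z|lborel. K * (\<phi> (- x + t n *\<^sub>R z) * gauss z))"
      unfolding Fb using t[of n] by (simp add: mult.left_commute)
    finally show ?thesis by simp
  qed
  \<comment> \<open>The limit of one sequence is computed twice: here with
    \<open>fourier \<phi>\<close> as majorant, below in the form \<open>R\<close> with a bound of
    \<open>\<phi>\<close> times the Gaussian.\<close>
  have "(\<lambda>n. LINT \<xi>|lborel. fourier \<phi> \<xi> * b n \<xi>) \<longlonglongrightarrow> (LINT \<xi>|lborel. fourier \<phi> \<xi> * cis (- (\<xi> \<bullet> x)))"
  proof (rule integral_dominated_convergence)
    show "integrable lborel (\<lambda>\<xi>. norm (fourier \<phi> \<xi>))" by (intro integrable_norm schwartz_integrable F)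
    show "AE \<xi> in lborel. norm (fourier \<phi> \<xi> * b n \<xi>) \<le> norm (fourier \<phi> \<xi>)" for n
      by (rule AE_I2) (auto simp: b_def norm_mult gauss_def less_imp_le[OF t(1)] intro!: mult_left_le)
    show "AE \<xi> in lborel. (\<lambda>n. fourier \<phi> \<xi> * b n \<xi>) \<longlonglongrightarrow> fourier \<phi> \<xi> * cis (- (\<xi> \<bullet> x))"
    proof (rule AE_I2)
      fix \<xi> :: "real^'n"
      have "(\<lambda>n. t n *\<^sub>R \<xi>) \<longlonglongrightarrow> 0 *\<^sub>R \<xi>" by (intro tendsto_scaleR t0 tendsto_const)
      then have "(\<lambda>n. gauss (t n *\<^sub>R \<xi>)) \<longlonglongrightarrow> gauss (0 :: real^'n)"
        using continuous_on_tendsto_compose[OF cg] by simp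
      then have "(\<lambda>n. fourier \<phi> \<xi> * b n \<xi>) \<longlonglongrightarrow> fourier \<phi> \<xi> * (cis (- (\<xi> \<bullet> x)) * gauss (0 :: real^'n))"
        unfolding b_def by (intro tendsto_mult tendsto_const)
      then show "(\<lambda>n. fourier \<phi> \<xi> * b n \<xi>) \<longlonglongrightarrow> fourier \<phi> \<xi> * cis (- (\<xi> \<bullet> x))"
        by (simp add: gauss_def)
    qed
  qed measurable
  moreover have "(\<lambda>n. K * (LINT z|lborel. \<phi> (- x + t n *\<^sub>R z) * gauss z)) \<longlonglongrightarrow> K * (LINT z|lborel. \<phi> (- x) * gauss (z :: real^'n))"
  proof (intro tendsto_mult tendsto_const)
    obtain B where B: "B > 0" "\<And>x. (1 + norm x) ^ 0 * norm (\<phi> x) \<le> B" using schwartz_bound[OF S] by metis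
    show "(\<lambda>n. LINT z|lborel. \<phi> (- x + t n *\<^sub>R z) * gauss z) \<longlonglongrightarrow> (LINT z|lborel. \<phi> (- x) * gauss (z :: real^'n))"
    proof (rule integral_dominated_convergence)
      show "integrable lborel (\<lambda>z::real^'n. B * norm (gauss z))" by (intro integrable_mult_right integrable_norm gi)
      show "AE z in lborel. norm (\<phi> (- x + t n *\<^sub>R z) * gauss z) \<le> B * norm (gauss z)" for n
        using B by (intro AE_I2) (auto simp: norm_mult intro!: mult_right_mono)
      show "AE z in lborel. (\<lambda>n. \<phi> (- x + t n *\<^sub>R z) * gauss z) \<longlonglongrightarrow> \<phi> (- x) * gauss z"
      proof (intro AE_I2 tendsto_mult tendsto_const)
        fix z :: "real^'n"
        have "(\<lambda>n. - x + t n *\<^sub>R z) \<longlonglongrightarrow> - x + 0 *\<^sub>R z" by (intro tendsto_intros t0)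
        then show "(\<lambda>n. \<phi> (- x + t n *\<^sub>R z)) \<longlonglongrightarrow> \<phi> (- x)"
          using continuous_on_tendsto_compose[OF smooth_continuous_on[OF schwartz_smooth[OF S], of UNIV]] by simp
      qed
    qed measurable
  qed
  ultimately have "(LINT \<xi>|lborel. fourier \<phi> \<xi> * cis (- (\<xi> \<bullet> x))) = K * (LINT z|lborel. \<phi> (- x) * gauss (z :: real^'n))"
    unfolding R by (rule LIMSEQ_unique)
  also have "\<dots> = K\<^sup>2 * \<phi> (- x)"
    by (simp add: K_def fourier_lborel power2_eq_square)
  finally show ?thesis
    by (simp add: fourier_lborel[of "fourier \<phi>"] K_def fourier_gauss_0 mult.commute)
qed

definition inverse_fourier :: "(real^'n::finite \<Rightarrow> complex) \<Rightarrow> real^'n \<Rightarrow> complex" where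
  "inverse_fourier \<phi> \<xi> = of_real (1 / inversion_const TYPE('n)) * fourier \<phi> (- \<xi>)"

lemma schwartz_inverse_fourier: "\<phi> \<in> schwartz \<Longrightarrow> inverse_fourier \<phi> \<in> schwartz"
  unfolding inverse_fourier_def[abs_def] by (intro schwartz_cmult schwartz_uminus schwartz_fourier)

lemma fourier_inverse_fourier:
  fixes \<phi> :: "real^'n::finite \<Rightarrow> complex"
  assumes S: "\<phi> \<in> schwartz"
  shows "fourier (inverse_fourier \<phi>) = \<phi>"
proof
  fix x
  have b: "(\<lambda>\<xi>. fourier \<phi> (- \<xi>)) \<in> borel_measurable borel"
    by (intro schwartz_borel schwartz_uminus schwartz_fourier S)
  have "fourier (inverse_fourier \<phi>) x = of_real (1 / inversion_const TYPE('n)) * fourier (fourier \<phi>) (- x)"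
    unfolding inverse_fourier_def[abs_def]
    by (simp only: fourier_cmult[OF b] fourier_uminus[OF schwartz_borel[OF schwartz_fourier[OF S]]])
  then show "fourier (inverse_fourier \<phi>) x = \<phi> x"
    using inversion_const_pos[where 'n = 'n] by (simp add: fourier_inversion[OF S])
qed

text \<open>The multiplication formula is applied with the conjugate of
  \<open>fourier \<phi>\<close> as second function. Conjugation reflects the argument of a
  transform, and this cancels the reflection in the inversion formula.\<close>

theorem plancherel:
  fixes \<phi> :: "real^'n::finite \<Rightarrow> complex"
  assumes S: "\<phi> \<in> schwartz"
  shows "(LINT \<xi>|lborel. (norm (fourier \<phi> \<xi>))\<^sup>2) = inversion_const TYPE('n) * (LINT x|lborel. (norm (\<phi> x))\<^sup>2)"
proof -
  let ?c = "inversion_const TYPE('n)"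
  have F: "fourier \<phi> \<in> schwartz" by (rule schwartz_fourier[OF S])
  have sq: "of_real ((norm z)\<^sup>2) = z * cnj z" for z by (rule complex_norm_square)
  have "of_real (LINT \<xi>|lborel. (norm (fourier \<phi> \<xi>))\<^sup>2) = (LINT \<xi>|lborel. fourier \<phi> \<xi> * cnj (fourier \<phi> \<xi>))"
    by (simp only: integral_complex_of_real[symmetric] sq)
  also have "\<dots> = (LINT x|lborel. \<phi> x * fourier (\<lambda>\<xi>. cnj (fourier \<phi> \<xi>)) x)"
    by (rule fourier_swap) (auto intro: schwartz_borel schwartz_integrable schwartz_cnj S F)
  also have "\<dots> = (LINT x|lborel. of_real ?c * (\<phi> x * cnj (\<phi> x)))"
    by (simp add: fourier_cnj[OF schwartz_borel[OF F]] fourier_inversion[OF S] mult.left_commute)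
  also have "\<dots> = of_real (?c * (LINT x|lborel. (norm (\<phi> x))\<^sup>2))"
    by (simp only: integral_mult_right_zero of_real_mult integral_complex_of_real[symmetric] sq)
  finally show ?thesis by (simp only: of_real_eq_iff)
qed

subsection \<open>Sequences tending to zero in the Schwartz space\<close>

text \<open>Convergence to zero in the Schwartz topology, expressed through its seminorms. Sequences
  suffice because every such limit below is along a sequence of cut-offs.\<close>

definition schwartz_null :: "(nat \<Rightarrow> real^'n::finite \<Rightarrow> complex) \<Rightarrow> bool" where
  "schwartz_null \<Phi> \<longleftrightarrow> (\<forall>n. \<Phi> n \<in> schwartz) \<and>
     (\<forall>k \<alpha> e. e > 0 \<longrightarrow> (\<forall>\<^sub>F n in sequentially. \<forall>x. (1 + norm x) ^ k * norm (partial_derivs \<alpha> (\<Phi> n) x) \<le> e))"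

lemma schwartz_null_bound:
  assumes "schwartz_null \<Phi>" "e > 0"
  shows "\<forall>\<^sub>F n in sequentially. \<forall>x. (1 + norm x) ^ k * norm (\<Phi> n x) \<le> e"
proof -
  have "\<forall>\<^sub>F n in sequentially. \<forall>x. (1 + norm x) ^ k * norm (partial_derivs [] (\<Phi> n) x) \<le> e"
    using assms unfolding schwartz_null_def by blast
  then show ?thesis by simp
qed

lemma schwartz_null_partial_deriv: "schwartz_null \<Phi> \<Longrightarrow> schwartz_null (\<lambda>n. partial_deriv i (\<Phi> n))"
  unfolding schwartz_null_def by (simp add: schwartz_partial_deriv partial_derivs_snoc)

text \<open>Continuity of the Fourier transform at zero. A high enough weight controls the integral
  of the norm and with it the transform; each further power of the weight costs one derivative of
  \<open>\<Phi>\<close>, so the induction ranges over all null sequences.\<close>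

lemma weighted_fourier_null:
  fixes \<Phi> :: "nat \<Rightarrow> real^'n::finite \<Rightarrow> complex"
  assumes "schwartz_null \<Phi>" "e > 0"
  shows "\<forall>\<^sub>F n in sequentially. \<forall>x. (1 + norm x) ^ k * norm (fourier (\<Phi> n) x) \<le> e"
  using assms
proof (induction k arbitrary: \<Phi> e)
  case 0
  let ?d = "CARD('n) + 1"
  define I where "I = (LINT x|lborel. 1 / (1 + norm (x :: real^'n)) ^ ?d)"
  have int: "integrable lborel (\<lambda>x::real^'n. 1 / (1 + norm x) ^ ?d)"
    using integrable_inverse_power_norm[where 'a = "real^'n"] by simp
  have I: "I \<ge> 0" unfolding I_def by (intro Bochner_Integration.integral_nonneg) auto
  \<comment> \<open>With \<open>I + 1\<close> in place of \<open>I\<close> the quotient is positive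
    as soon as \<open>I\<close> is nonnegative.\<close>
  have "e / (I + 1) > 0" using 0 I by simp
  from schwartz_null_bound[OF 0(1) this, of ?d] show ?case
  proof eventually_elim
    case (elim n)
    have S: "\<Phi> n \<in> schwartz" using 0(1) by (simp add: schwartz_null_def)
    have pt: "norm (\<Phi> n x) \<le> e / (I + 1) * (1 / (1 + norm x) ^ ?d)" for x
    proof -
      have "(1 + norm x) ^ ?d > 0" by (intro zero_less_power) (simp add: add_pos_nonneg)
      with elim show ?thesis by (simp only: times_divide_eq_right mult_1_right pos_le_divide_eq mult.commute[of "norm (\<Phi> n x)"])
    qed
    have "norm (fourier (\<Phi> n) x) \<le> e" for x
    proof -
      have "norm (fourier (\<Phi> n) x) \<le> (LINT x|lborel. norm (\<Phi> n x))"
        by (rule norm_fourier_le[OF schwartz_borel[OF S]])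
      also have "\<dots> \<le> (LINT x|lborel. e / (I + 1) * (1 / (1 + norm (x :: real^'n)) ^ ?d))"
        by (intro integral_mono integrable_norm schwartz_integrable S integrable_mult_right int pt)
      also have "\<dots> = e / (I + 1) * I" by (simp only: integral_mult_right_zero I_def)
      also have "\<dots> \<le> e" using I 0(2) by (simp add: field_simps)
      finally show ?thesis .
    qed
    then show ?case by simp
  qed
next
  case (Suc k)
  \<comment> \<open>One share for the term without derivative and one for each direction.\<close>
  define d where "d = e / (real CARD('n) + 1)"
  have d: "d > 0" unfolding d_def using Suc.prems by (intro divide_pos_pos) auto
  have "\<forall>\<^sub>F n in sequentially. \<forall>i. \<forall>x. (1 + norm x) ^ k * norm (fourier (partial_deriv i (\<Phi> n)) x) \<le> d"
    by (intro eventually_all_finite Suc.IH schwartz_null_partial_deriv Suc.prems d)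
  with Suc.IH[OF Suc.prems(1) d] show ?case
  proof eventually_elim
    case (elim n)
    have S: "\<Phi> n \<in> schwartz" using Suc.prems by (simp add: schwartz_null_def)
    have "(1 + norm x) ^ Suc k * norm (fourier (\<Phi> n) x) \<le> d + (\<Sum>i\<in>(UNIV::'n set). d)" for x
      by (rule order_trans[OF weight_Suc_le[OF S]]) (intro add_mono sum_mono; use elim in blast)
    also have "d + (\<Sum>i\<in>(UNIV::'n set). d) = e"
    proof -
      have "(real CARD('n) + 1) * d = e" unfolding d_def using nonzero_mult_div_cancel_left[of "real CARD('n) + 1" e] by simp
      then show ?thesis by (simp add: distrib_right)
    qed
    finally show ?case by blast
  qed
qed

inductive seq_sums_of :: "((nat \<Rightarrow> real^'n::finite \<Rightarrow> complex) \<Rightarrow> bool) \<Rightarrow> (nat \<Rightarrow> real^'n \<Rightarrow> complex) \<Rightarrow> bool"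
  for C where
  base: "C \<Phi> \<Longrightarrow> seq_sums_of C \<Phi>"
| add: "seq_sums_of C \<Phi> \<Longrightarrow> seq_sums_of C \<Psi> \<Longrightarrow> seq_sums_of C (\<lambda>n x. \<Phi> n x + \<Psi> n x)"

text \<open>Coinduction up to sums for whole sequences: convergence to zero is not a property of the
  single functions, so the class consists of sequences that are differentiated for all
  \<open>n\<close> at once.\<close>

lemma schwartz_null_coinduct:
  fixes \<Phi> :: "nat \<Rightarrow> real^'n::finite \<Rightarrow> complex"
  assumes S: "\<And>\<Phi> n. C \<Phi> \<Longrightarrow> \<Phi> n \<in> schwartz"
    and P: "\<And>\<Phi> i. C \<Phi> \<Longrightarrow> seq_sums_of C (\<lambda>n. partial_deriv i (\<Phi> n))"
    and B: "\<And>\<Phi> k e. C \<Phi> \<Longrightarrow> e > 0 \<Longrightarrow> \<forall>\<^sub>F n in sequentially. \<forall>x. (1 + norm x) ^ k * norm (\<Phi> n x) \<le> e"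
    and "C \<Phi>"
  shows "schwartz_null \<Phi>"
proof -
  have S': "\<Psi> n \<in> schwartz" if "seq_sums_of C \<Psi>" for \<Psi> n
    using that by (induction rule: seq_sums_of.induct) (auto intro: S schwartz_add)
  have B': "\<forall>\<^sub>F n in sequentially. \<forall>x. (1 + norm x) ^ k * norm (\<Psi> n x) \<le> e" if "seq_sums_of C \<Psi>" "e > 0" for \<Psi> k e
    using that
  proof (induction arbitrary: e rule: seq_sums_of.induct)
    case (add \<Phi> \<Psi>)
    have "e / 2 > 0" using add.prems by simp
    from add.IH(1)[OF this] add.IH(2)[OF this] show ?case
    proof eventually_elim
      case (elim n)
      have "(1 + norm x) ^ k * norm (\<Phi> n x + \<Psi> n x) \<le> e / 2 + e / 2" for x
        by (intro weighted_add_le) (use elim in blast)+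
      then show ?case by simp
    qed
  qed (rule B)
  have P': "seq_sums_of C (\<lambda>n. partial_deriv i (\<Psi> n))" if "seq_sums_of C \<Psi>" for \<Psi> i
    using that
  proof (induction rule: seq_sums_of.induct)
    case (add \<Phi> \<Psi>)
    have "partial_deriv i (\<lambda>x. \<Phi> n x + \<Psi> n x) = (\<lambda>x. partial_deriv i (\<Phi> n) x + partial_deriv i (\<Psi> n) x)" for n
      using add.hyps by (intro partial_deriv_add smooth_differentiable schwartz_smooth S')
    then show ?case using seq_sums_of.add[OF add.IH] by simp
  qed (rule P)
  have "seq_sums_of C (\<lambda>n. partial_derivs \<alpha> (\<Phi> n))" for \<alpha>
    by (induction \<alpha>) (auto intro: seq_sums_of.base[of C, OF \<open>C \<Phi>\<close>] P')
  then show ?thesis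
    unfolding schwartz_null_def using S[OF \<open>C \<Phi>\<close>] B' by blast
qed

lemma schwartz_null_mult:
  assumes "moderate p" "schwartz_null \<Phi>"
  shows "schwartz_null (\<lambda>n x. p x * \<Phi> n x)"
proof -
  define C where "C \<Theta> \<longleftrightarrow> (\<exists>p \<Phi>. moderate p \<and> schwartz_null \<Phi> \<and> \<Theta> = (\<lambda>n x. p x * \<Phi> n x))"
    for \<Theta> :: "nat \<Rightarrow> real^'a \<Rightarrow> complex"
  have C: "C (\<lambda>n x. p x * \<Phi> n x)" if "moderate p" "schwartz_null \<Phi>" for p \<Phi>
    unfolding C_def using that by (intro exI[of _ p] exI[of _ \<Phi>] conjI refl)
  show ?thesis
  proof (rule schwartz_null_coinduct[where C = C])
    show "C (\<lambda>n x. p x * \<Phi> n x)" by (rule C[OF assms])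
    fix \<Theta> assume "C \<Theta>"
    then obtain p \<Phi> where p: "moderate p" and n: "schwartz_null \<Phi>" and T: "\<Theta> = (\<lambda>n x. p x * \<Phi> n x)"
      unfolding C_def by (elim exE conjE)
    have S: "\<Phi> n \<in> schwartz" for n using n by (simp add: schwartz_null_def)
    show "\<Theta> n \<in> schwartz" for n unfolding T by (rule schwartz_mult[OF p S])
    show "seq_sums_of C (\<lambda>n. partial_deriv i (\<Theta> n))" for i
    proof -
      have "(\<lambda>n. partial_deriv i (\<Theta> n)) = (\<lambda>n x. partial_deriv i p x * \<Phi> n x + p x * partial_deriv i (\<Phi> n) x)"
        unfolding T
        by (rule ext, rule partial_deriv_mult; intro smooth_differentiable schwartz_smooth[OF S] moderate_smooth[OF p])
      then show ?thesis
        using C[OF moderate_partial_deriv[OF p] n] C[OF p schwartz_null_partial_deriv[OF n]]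
        by (simp only: seq_sums_of.add seq_sums_of.base)
    qed
    show "\<forall>\<^sub>F n in sequentially. \<forall>x. (1 + norm x) ^ k * norm (\<Theta> n x) \<le> e" if "e > 0" for k e
    proof -
      obtain A l where A: "A > 0" "\<And>x. norm (p x) \<le> A * (1 + norm x) ^ l" using moderate_bound[OF p] by blast
      have "e / A > 0" using that A by simp
      from schwartz_null_bound[OF n this, of "k + l"] show ?thesis
      proof eventually_elim
        case (elim n)
        have "(1 + norm x) ^ k * norm (\<Theta> n x) \<le> e" for x
        proof -
          have "(1 + norm x) ^ k * norm (\<Theta> n x) \<le> (1 + norm x) ^ k * ((A * (1 + norm x) ^ l) * norm (\<Phi> n x))"
            unfolding T norm_mult by (intro mult_left_mono mult_right_mono A) auto
          also have "\<dots> = A * ((1 + norm x) ^ (k + l) * norm (\<Phi> n x))" by (simp add: power_add)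
          also have "\<dots> \<le> A * (e / A)" using elim A(1) by (intro mult_left_mono) auto
          finally show ?thesis using A(1) by simp
        qed
        then show ?case by simp
      qed
    qed
  qed
qed

lemmas schwartz_null_cmult = schwartz_null_mult[OF moderate_const]

lemma schwartz_null_fourier:
  assumes "schwartz_null \<Phi>"
  shows "schwartz_null (\<lambda>n. fourier (\<Phi> n))"
proof (rule schwartz_null_coinduct[where C = "\<lambda>\<Theta>. \<exists>\<Phi>. schwartz_null \<Phi> \<and> \<Theta> = (\<lambda>n. fourier (\<Phi> n))"])
  let ?C = "\<lambda>\<Theta>::nat \<Rightarrow> real^'a \<Rightarrow> complex. \<exists>\<Phi>. schwartz_null \<Phi> \<and> \<Theta> = (\<lambda>n. fourier (\<Phi> n))"
  show "?C (\<lambda>n. fourier (\<Phi> n))" using assms by blast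
  fix \<Theta> assume "?C \<Theta>"
  then obtain \<Phi> where n: "schwartz_null \<Phi>" and T: "\<Theta> = (\<lambda>n. fourier (\<Phi> n))" by blast
  have S: "\<Phi> n \<in> schwartz" for n using n by (auto simp: schwartz_null_def)
  show "\<Theta> n \<in> schwartz" for n unfolding T by (intro schwartz_fourier S)
  show "seq_sums_of ?C (\<lambda>n. partial_deriv i (\<Theta> n))" for i
    unfolding T partial_deriv_fourier[OF S]
    using schwartz_null_cmult[OF schwartz_null_mult[OF moderate_coord n, of i], of "- \<i>"]
    by (intro seq_sums_of.base exI[of _ "\<lambda>n x. - \<i> * (of_real (x $ i) * \<Phi> n x)"]) blast
  show "\<forall>\<^sub>F n in sequentially. \<forall>x. (1 + norm x) ^ k * norm (\<Theta> n x) \<le> e" if "e > 0" for k e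
    unfolding T by (rule weighted_fourier_null[OF n that])
qed

lemma tempered_distribution_null:
  fixes T :: "'n::finite functional"
  assumes T: "tempered_distribution T" and n: "schwartz_null \<Phi>"
  shows "(\<lambda>n. T (\<Phi> n)) \<longlonglongrightarrow> 0"
proof -
  from T obtain C k where C: "\<And>\<phi>. \<phi> \<in> schwartz \<Longrightarrow> norm (T \<phi>) \<le> C * schwartz_norm k \<phi>"
    unfolding tempered_distribution_def by blast
  have S: "\<Phi> n \<in> schwartz" for n using n by (auto simp: schwartz_null_def)
  have fin: "finite {\<alpha> :: 'n list. length \<alpha> \<le> k}"
    using finite_lists_length_le[of "UNIV :: 'n set" k] by simp
  have "(\<lambda>n. schwartz_norm k (\<Phi> n)) \<longlonglongrightarrow> 0"
  proof (rule tendstoI)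
    fix e :: real assume "e > 0"
    then have e: "e / 2 > 0" by simp
    have "\<forall>\<^sub>F n in sequentially. \<forall>\<alpha>\<in>{\<alpha> :: 'n list. length \<alpha> \<le> k}. \<forall>x. (1 + norm x) ^ k * norm (partial_derivs \<alpha> (\<Phi> n) x) \<le> e / 2"
      using n e unfolding schwartz_null_def by (intro eventually_ball_finite fin ballI) blast
    then show "\<forall>\<^sub>F n in sequentially. dist (schwartz_norm k (\<Phi> n)) 0 < e"
    proof eventually_elim
      case (elim n)
      let ?I = "{\<alpha> :: 'n list. length \<alpha> \<le> k} \<times> (UNIV :: (real^'n) set)"
      let ?f = "\<lambda>(\<alpha>, x). (1 + norm x) ^ k * norm (partial_derivs \<alpha> (\<Phi> n) x)"
      have le: "?f p \<le> e / 2" if "p \<in> ?I" for p using that elim by auto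
      have p0: "([], 0) \<in> ?I" by simp
      have "schwartz_norm k (\<Phi> n) \<le> e / 2"
        unfolding schwartz_norm_def by (rule cSUP_least) (use p0 le in blast)+
      \<comment> \<open>A real supremum is controlled only over a nonempty set that is bounded
        above. This member bounds it below by zero, so that its distance to zero is small as
        well.\<close>
      moreover have "?f ([], 0) \<le> schwartz_norm k (\<Phi> n)"
        unfolding schwartz_norm_def using p0 by (rule cSUP_upper) (rule bdd_aboveI2[OF le])
      moreover have "0 \<le> ?f ([], 0)" by simp
      ultimately show ?case using \<open>e > 0\<close> unfolding dist_real_def by linarith
    qed
  qed
  then have "(\<lambda>n. C * schwartz_norm k (\<Phi> n)) \<longlonglongrightarrow> 0" by (rule tendsto_mult_right_zero)
  then show ?thesis
    by (rule Lim_null_comparison[rotated]) (auto intro!: always_eventually C S)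
qed

subsection \<open>Test functions\<close>

lemma test_functions_iff: "\<phi> \<in> test_functions \<longleftrightarrow> smooth \<phi> \<and> bounded {x. \<phi> x \<noteq> 0}"
  by (simp add: test_functions_def compact_closure)

lemma test_functionsI:
  assumes "smooth \<phi>" "\<And>x. R \<le> norm x \<Longrightarrow> \<phi> x = 0"
  shows "\<phi> \<in> test_functions"
proof -
  have "norm x \<le> R" if "\<phi> x \<noteq> 0" for x using assms(2)[of x] that by linarith
  then have "{x. \<phi> x \<noteq> 0} \<subseteq> cball 0 R" by (intro subsetI) (simp only: mem_cball_0 mem_Collect_eq)
  from bounded_subset[OF bounded_cball this] show ?thesis using assms(1) by (simp only: test_functions_iff)
qed

lemma test_functions_smooth: "\<phi> \<in> test_functions \<Longrightarrow> smooth \<phi>"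
  by (simp add: test_functions_def)

lemma test_functions_support:
  assumes "\<phi> \<in> test_functions"
  obtains R where "R > 0" "\<forall>x. R \<le> norm x \<longrightarrow> \<phi> x = 0"
proof -
  obtain B where B: "B > 0" "\<forall>x\<in>{x. \<phi> x \<noteq> 0}. norm x \<le> B"
    using assms unfolding test_functions_iff bounded_pos by (elim conjE exE) (rule that)
  show ?thesis
  proof (rule that[of "B + 1"])
    show "B + 1 > 0" using B by simp
    show "\<forall>x. B + 1 \<le> norm x \<longrightarrow> \<phi> x = 0"
    proof (intro allI impI, rule ccontr)
      fix x assume x: "B + 1 \<le> norm x" and "\<phi> x \<noteq> 0"
      then have "norm x \<le> B" by (intro B(2)[rule_format]) simp
      with x show False by linarith
    qed
  qed
qed

lemma test_partial_deriv:
  assumes "\<phi> \<in> test_functions"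
  shows "partial_deriv i \<phi> \<in> test_functions"
proof -
  obtain R where R: "R > 0" "\<forall>x. R \<le> norm x \<longrightarrow> \<phi> x = 0" by (rule test_functions_support[OF assms])
  show ?thesis
  proof (rule test_functionsI[of _ "R + 1"])
    show "smooth (partial_deriv i \<phi>)" using assms by (intro smooth_partial_deriv test_functions_smooth)
    fix x :: "real^'a" assume x: "R + 1 \<le> norm x"
    have "((\<lambda>x. 0 :: complex) has_derivative (\<lambda>h. 0)) (at x)" by (rule has_derivative_const)
    moreover have "open {y :: real^'a. R < norm y}"
      by (intro open_Collect_less continuous_intros)
    ultimately have "(\<phi> has_derivative (\<lambda>h. 0)) (at x)"
      by (rule has_derivative_transform_within_open) (use x R in auto)
    from partial_deriv_eq[OF this] show "partial_deriv i \<phi> x = 0" .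
  qed
qed

lemma test_weighted_bound:
  assumes "\<phi> \<in> test_functions"
  shows "\<exists>B. \<forall>x. (1 + norm x) ^ k * norm (\<phi> x) \<le> B"
proof -
  obtain R where R: "R > 0" "\<forall>x. R \<le> norm x \<longrightarrow> \<phi> x = 0" by (rule test_functions_support[OF assms])
  have "continuous_on (cball 0 R) (\<lambda>x. (1 + norm x) ^ k * norm (\<phi> x))"
    using smooth_continuous_on[OF test_functions_smooth[OF assms]] by (intro continuous_intros)
  then have "compact ((\<lambda>x. (1 + norm x) ^ k * norm (\<phi> x)) ` cball 0 R)"
    by (rule compact_continuous_image) simp
  from compact_imp_bounded[OF this]
  obtain B where B: "\<forall>y\<in>(\<lambda>x. (1 + norm x) ^ k * norm (\<phi> x)) ` cball 0 R. norm y \<le> B"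
    unfolding bounded_iff by (elim exE) (rule that)
  have "(1 + norm x) ^ k * norm (\<phi> x) \<le> max B 0" for x
  proof (cases "norm x \<le> R")
    case True
    then have "norm ((1 + norm x) ^ k * norm (\<phi> x)) \<le> B" by (intro B[rule_format] imageI) simp
    then show ?thesis by (simp add: norm_mult le_max_iff_disj)
  next
    case False
    then show ?thesis using R(2)[rule_format, of x] by simp
  qed
  then show ?thesis by blast
qed

lemma test_schwartz: "\<phi> \<in> test_functions \<Longrightarrow> \<phi> \<in> schwartz"
  by (rule schwartz_coinduct[where C = "\<lambda>\<phi>. \<phi> \<in> test_functions"])
    (auto intro: smooth_differentiable test_functions_smooth test_partial_deriv sums_of.base test_weighted_bound)

lemma test_mult:
  assumes "\<eta> \<in> test_functions" "smooth \<psi>"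
  shows "(\<lambda>x. \<eta> x * \<psi> x) \<in> test_functions"
proof -
  obtain R where R: "R > 0" "\<forall>x. R \<le> norm x \<longrightarrow> \<eta> x = 0" by (rule test_functions_support[OF assms(1)])
  show ?thesis
  proof (rule test_functionsI[of _ R])
    show "smooth (\<lambda>x. \<eta> x * \<psi> x)" by (intro smooth_mult test_functions_smooth assms)
    show "\<eta> x * \<psi> x = 0" if "R \<le> norm x" for x using R(2)[rule_format, OF that] by simp
  qed
qed

lemma test_scaleR:
  assumes "\<eta> \<in> test_functions" "c > 0"
  shows "(\<lambda>x. \<eta> (c *\<^sub>R x)) \<in> test_functions"
proof -
  obtain R where R: "R > 0" "\<forall>x. R \<le> norm x \<longrightarrow> \<eta> x = 0" by (rule test_functions_support[OF assms(1)])
  show ?thesis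
  proof (rule test_functionsI[of _ "R / c"])
    show "smooth (\<lambda>x. \<eta> (c *\<^sub>R x))" by (intro smooth_scaleR test_functions_smooth assms)
    show "\<eta> (c *\<^sub>R x) = 0" if "R / c \<le> norm x" for x
      using that assms(2) by (intro R(2)[rule_format]) (simp add: pos_divide_le_eq mult.commute)
  qed
qed

text \<open>For \<open>k = 0\<close> this is the classical flat function. The powers of
  \<open>1 / t\<close> are carried along because the derivative of a member is a combination of two
  other members, which makes smoothness a closure property.\<close>

definition bump_aux :: "nat \<Rightarrow> real \<Rightarrow> real" where
  "bump_aux k t = (if t > 0 then exp (- (1 / t)) * (1 / t) ^ k else 0)"

text \<open>The exponential beats one power more than \<open>k\<close>, which leaves a factor
  \<open>t\<close>. Continuity and differentiability at the origin rest on this linear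
  bound.\<close>

lemma bump_aux_le: "\<bar>bump_aux k t\<bar> \<le> fact (Suc k) * \<bar>t\<bar>"
proof (cases "t > 0")
  case True
  have "(1 / t) ^ Suc k \<le> fact (Suc k) * exp (1 / t)"
    using True by (intro power_le_fact_mult_exp) auto
  then have "t * exp (- (1 / t)) * (1 / t) ^ Suc k \<le> t * exp (- (1 / t)) * (fact (Suc k) * exp (1 / t))"
    using True by (intro mult_left_mono) auto
  also have "\<dots> = fact (Suc k) * t" by (simp add: exp_minus)
  also have "t * exp (- (1 / t)) * (1 / t) ^ Suc k = bump_aux k t" using True by (simp add: bump_aux_def)
  finally show ?thesis using True by (simp add: bump_aux_def abs_mult)
next
  case False
  have "0 \<le> (fact (Suc k) :: real) * \<bar>t\<bar>" by (intro mult_nonneg_nonneg) auto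
  then show ?thesis using False by (simp only: bump_aux_def if_False abs_zero)
qed

lemma bump_aux_Suc: "bump_aux k t = t * bump_aux (Suc k) t"
  by (simp add: bump_aux_def)

lemma bump_aux_has_derivative:
  "(bump_aux k has_real_derivative bump_aux (Suc (Suc k)) t - real k * bump_aux (Suc k) t) (at t)"
proof -
  consider "t > 0" | "t = 0" | "t < 0" by linarith
  then show ?thesis
  proof cases
    case 1
    have "((\<lambda>t. exp (- (1 / t)) * (1 / t) ^ k) has_real_derivative
        exp (- (1 / t)) * (1 / t)\<^sup>2 * (1 / t) ^ k + exp (- (1 / t)) * (real k * (1 / t) ^ (k - 1) * - ((1 / t)\<^sup>2))) (at t)"
      using 1 by (auto intro!: derivative_eq_intros simp: power2_eq_square)
    also have "exp (- (1 / t)) * (1 / t)\<^sup>2 * (1 / t) ^ k + exp (- (1 / t)) * (real k * (1 / t) ^ (k - 1) * - ((1 / t)\<^sup>2))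
        = bump_aux (Suc (Suc k)) t - real k * bump_aux (Suc k) t"
    proof (cases k)
      case 0
      then show ?thesis using 1 by (simp add: bump_aux_def power2_eq_square)
    next
      case (Suc m)
      have "(1 / t)\<^sup>2 * (1 / t) ^ k = (1 / t) ^ Suc (Suc k)" "(1 / t) ^ (k - 1) * (1 / t)\<^sup>2 = (1 / t) ^ Suc k"
        by (simp_all add: Suc power2_eq_square)
      then show ?thesis using 1
        by (simp only: bump_aux_def if_True mult.assoc mult_minus_right) (simp add: mult.left_commute)
    qed
    finally show ?thesis
      by (rule has_field_derivative_transform_within_open[of _ _ _ "{0<..}"]) (use 1 in \<open>auto simp: bump_aux_def\<close>)
  next
    case 2
    \<comment> \<open>At the origin the difference quotient of \<open>bump_aux k\<close> is exactly
      \<open>bump_aux (Suc k)\<close>, by \<open>bump_aux_Suc\<close>.\<close>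
    have "((\<lambda>h. bump_aux (Suc k) h) \<longlongrightarrow> 0) (at 0)"
    proof (rule Lim_null_comparison)
      show "\<forall>\<^sub>F h in at 0. norm (bump_aux (Suc k) h) \<le> fact (Suc (Suc k)) * \<bar>h\<bar>"
        using bump_aux_le by (intro always_eventually allI) (simp only: real_norm_def)
      show "((\<lambda>h. fact (Suc (Suc k)) * \<bar>h\<bar>) \<longlongrightarrow> (0::real)) (at 0)"
        by (rule tendsto_eq_intros refl | simp)+
    qed
    then have "((\<lambda>h. (bump_aux k (0 + h) - bump_aux k 0) / h) \<longlongrightarrow> 0) (at 0)"
      by (rule Lim_transform_eventually) (auto simp: eventually_at_filter bump_aux_Suc[of k] intro!: always_eventually)
    then have "(bump_aux k has_real_derivative 0) (at 0)" unfolding DERIV_def .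
    then show ?thesis using 2 by (simp add: bump_aux_def)
  next
    case 3
    have "((\<lambda>t. 0) has_real_derivative 0) (at t)" by simp
    then have "(bump_aux k has_real_derivative 0) (at t)"
      by (rule has_field_derivative_transform_within_open[of _ _ _ "{..<0}"]) (use 3 in \<open>auto simp: bump_aux_def\<close>)
    then show ?thesis using 3 by (simp add: bump_aux_def)
  qed
qed

lemma bump_aux_comp_has_derivative:
  fixes x :: "real^'n::finite"
  shows "((\<lambda>x. complex_of_real (bump_aux k (1 - x \<bullet> x))) has_derivative
    (\<lambda>h. of_real (- 2 * (x \<bullet> h) * (bump_aux (Suc (Suc k)) (1 - x \<bullet> x) - real k * bump_aux (Suc k) (1 - x \<bullet> x))))) (at x)"
proof -
  have "((\<lambda>x::real^'n. 1 - x \<bullet> x) has_derivative (\<lambda>h. - 2 * (x \<bullet> h))) (at x)"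
    by (auto intro!: derivative_eq_intros simp: inner_commute)
  from has_derivative_compose[OF this bump_aux_has_derivative[unfolded has_field_derivative_def]]
  have "((\<lambda>x. bump_aux k (1 - x \<bullet> x)) has_derivative
    (\<lambda>h. (bump_aux (Suc (Suc k)) (1 - x \<bullet> x) - real k * bump_aux (Suc k) (1 - x \<bullet> x)) * (- 2 * (x \<bullet> h)))) (at x)" .
  from has_derivative_of_real[OF this, where 'a = complex]
  show ?thesis by (simp only: mult.commute)
qed

lemma smooth_bump_aux: "smooth (\<lambda>x::real^'n::finite. complex_of_real (bump_aux k (1 - x \<bullet> x)))"
proof -
  define b where "b k x = complex_of_real (bump_aux k (1 - x \<bullet> x))" for k and x :: "real^'n"
  \<comment> \<open>Differentiation raises the index by one or two and produces coordinate factors,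
    which the smooth coefficient \<open>q\<close> collects.\<close>
  define C where "C h \<longleftrightarrow> (\<exists>q k. smooth q \<and> h = (\<lambda>x::real^'n. q x * b k x))" for h
  have C: "C (\<lambda>x. q x * b k x)" if "smooth q" for q k
    unfolding C_def using that by blast
  have db: "b k differentiable (at x)" for k x
    using bump_aux_comp_has_derivative[of k x] unfolding differentiable_def b_def[abs_def] by blast
  have pb: "partial_deriv i (b k) x = (- 2 * of_real (x $ i)) * b (Suc (Suc k)) x + (2 * of_real k * of_real (x $ i)) * b (Suc k) x" for i k x
    unfolding b_def[abs_def]
    by (subst partial_deriv_eq[OF bump_aux_comp_has_derivative]) (simp add: inner_axis algebra_simps)
  have "smooth (\<lambda>x. 1 * b k x)"
  proof (rule smooth_coinduct[where C = C])
    show "C (\<lambda>x. 1 * b k x)" by (rule C) simp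
    fix h assume "C h"
    then obtain q k where q: "smooth q" and h: "h = (\<lambda>x. q x * b k x)" unfolding C_def by blast
    note dq = smooth_differentiable[OF q]
    show "h differentiable (at x)" for x unfolding h by (intro differentiable_mult dq db)
    show "sums_of C (partial_deriv i h)" for i
    proof -
      have "partial_deriv i h = (\<lambda>x. partial_deriv i q x * b k x + ((q x * (- 2 * of_real (x $ i))) * b (Suc (Suc k)) x
          + (q x * (2 * of_real k * of_real (x $ i))) * b (Suc k) x))"
        unfolding h partial_deriv_mult[of q "b k", OF dq db] pb by (simp only: distrib_left mult.assoc)
      moreover have "smooth (\<lambda>x. q x * (- 2 * of_real (x $ i)))" "smooth (\<lambda>x. q x * (2 * of_real k * of_real (x $ i)))"
        by (intro smooth_mult q smooth_const smooth_coord)+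
      ultimately show ?thesis
        using C smooth_partial_deriv[OF q] by (simp only: sums_of.add sums_of.base)
    qed
  qed
  then show ?thesis by (simp add: b_def)
qed

text \<open>The factor \<open>exp 1\<close> normalises the value at the origin to 1, so that dilated
  copies serve as cut-offs tending to 1.\<close>

definition bump :: "real^'n::finite \<Rightarrow> complex" where
  "bump x = of_real (exp 1 * bump_aux 0 (1 - x \<bullet> x))"

lemma bump_test: "bump \<in> test_functions"
proof (rule test_functionsI[of _ 1])
  have "smooth (\<lambda>x::real^'a. of_real (exp 1) * complex_of_real (bump_aux 0 (1 - x \<bullet> x)))"
    by (intro smooth_mult smooth_const smooth_bump_aux)
  then show "smooth (bump :: real^'a \<Rightarrow> complex)" by (simp add: bump_def[abs_def])
  fix x :: "real^'a" assume "1 \<le> norm x"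
  then have "1 \<le> x \<bullet> x" by (simp add: dot_square_norm)
  then show "bump x = 0" by (simp add: bump_def bump_aux_def)
qed

lemma bump_0: "bump 0 = 1"
  by (simp add: bump_def bump_aux_def flip: exp_add)

lemma norm_bump_le: "norm (bump x) \<le> 1"
proof (cases "0 < 1 - x \<bullet> x")
  case True
  have "1 \<le> 1 / (1 - x \<bullet> x)" using True by (simp add: pos_le_divide_eq)
  then have "exp 1 * exp (- (1 / (1 - x \<bullet> x))) \<le> 1" by (simp flip: exp_add)
  then show ?thesis using True by (simp add: bump_def bump_aux_def norm_mult)
qed (simp add: bump_def bump_aux_def)

lemma bump_nonzero:
  assumes "norm x < 1"
  shows "bump x \<noteq> 0"
proof -
  have "x \<bullet> x < 1" using assms by (simp add: dot_square_norm abs_square_less_1)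
  then show ?thesis by (simp add: bump_def bump_aux_def)
qed

section \<open>Cut-off by dilated bumps\<close>

lemma schwartz_lipschitz_0:
  fixes f :: "real^'n::finite \<Rightarrow> complex"
  assumes "f \<in> schwartz"
  obtains L where "L > 0" "\<forall>x. norm (f x - f 0) \<le> L * norm x"
proof -
  have d: "f differentiable (at x)" for x using assms by (intro smooth_differentiable schwartz_smooth)
  have "\<forall>i. \<exists>B. \<forall>x. norm (partial_deriv i f x) \<le> B"
  proof
    fix i
    obtain B where "\<And>x. (1 + norm x) ^ 0 * norm (partial_deriv i f x) \<le> B"
      using schwartz_bound[OF schwartz_partial_deriv[OF assms]] by metis
    then show "\<exists>B. \<forall>x. norm (partial_deriv i f x) \<le> B" by auto
  qed
  then obtain B where B: "\<And>i x. norm (partial_deriv i f x) \<le> B i" by metis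
  define L where "L = 1 + (\<Sum>i\<in>UNIV. B i)"
  have B0: "0 \<le> B i" for i using B[of i 0] norm_ge_zero order_trans by blast
  have L: "L > 0" unfolding L_def by (intro add_pos_nonneg sum_nonneg B0) simp
  have "norm (f x - f 0) \<le> L * norm (x - 0)" for x
  proof (rule differentiable_bound[where S = UNIV and f' = "\<lambda>x. frechet_derivative f (at x)"])
    show "(f has_derivative frechet_derivative f (at x)) (at x within UNIV)" for x
      using d[of x] by (simp add: frechet_derivative_works)
    show "onorm (frechet_derivative f (at x)) \<le> L" for x
    proof (rule onorm_le)
      fix h :: "real^'n"
      have "norm (frechet_derivative f (at x) h) \<le> (\<Sum>i\<in>UNIV. norm ((h $ i) *\<^sub>R partial_deriv i f x))"
        unfolding frechet_derivative_partial_derivs[OF d] by (rule norm_sum)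
      also have "\<dots> \<le> (\<Sum>i\<in>UNIV. norm h * B i)"
        using B component_le_norm_cart[of h] by (intro sum_mono) (auto intro!: mult_mono)
      also have "\<dots> = norm h * (\<Sum>i\<in>UNIV. B i)" by (rule sum_distrib_left[symmetric])
      also have "\<dots> \<le> norm h * L" unfolding L_def by (intro mult_left_mono) auto
      also have "\<dots> = L * norm h" by (rule mult.commute)
      finally show "norm (frechet_derivative f (at x) h) \<le> L * norm h" .
    qed
  qed auto
  then show ?thesis using that[OF L] by simp
qed

definition dilation :: "nat \<Rightarrow> real" where "dilation n = 1 / real (Suc n)"

lemma dilation: "dilation n > 0" "dilation \<longlonglongrightarrow> 0"
  unfolding dilation_def by (simp, rule LIMSEQ_Suc[OF lim_1_over_n])

lemma schwartz_scaleR_mult: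
  assumes "\<theta> \<in> test_functions" "\<psi> \<in> schwartz" "c > 0"
  shows "(\<lambda>x. \<theta> (c *\<^sub>R x) * \<psi> x) \<in> schwartz"
  by (rule schwartz_mult_schwartz[OF test_schwartz[OF test_scaleR[OF assms(1,3)]] assms(2)])

text \<open>The product rule produces terms of a second kind, in which a derivative has fallen on
  the cut-off and brought out \<open>dilation n\<close>; these are small because of that scalar. In
  terms of the first kind the cut-off differs from 1 by at most a constant times
  \<open>dilation n * norm x\<close>, and the decay of \<open>\<psi>\<close> absorbs the
  \<open>norm x\<close>.\<close>

theorem bump_cutoff_null:
  fixes \<psi> :: "real^'n::finite \<Rightarrow> complex"
  assumes "\<psi> \<in> schwartz"
  shows "schwartz_null (\<lambda>n x. (bump (dilation n *\<^sub>R x) - 1) * \<psi> x)"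
proof -
  define A where "A \<psi> = (\<lambda>n x. (bump (dilation n *\<^sub>R x) - 1) * \<psi> x)" for \<psi> :: "real^'n \<Rightarrow> complex"
  \<comment> \<open>An arbitrary null sequence \<open>c\<close> is allowed because repeated
    differentiation accumulates factors \<open>dilation n\<close>.\<close>
  define B where "B c \<theta> \<psi> = (\<lambda>n x. of_real (c n) * (\<theta> (dilation n *\<^sub>R x) * \<psi> x))"
    for c :: "nat \<Rightarrow> real" and \<theta> \<psi> :: "real^'n \<Rightarrow> complex"
  define C where "C \<Theta> \<longleftrightarrow> (\<exists>\<psi>\<in>schwartz. \<Theta> = A \<psi>) \<or> (\<exists>c. \<exists>\<theta>\<in>test_functions. \<exists>\<psi>\<in>schwartz. c \<longlonglongrightarrow> 0 \<and> \<Theta> = B c \<theta> \<psi>)" for \<Theta>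
  have CA: "C (A \<psi>)" if "\<psi> \<in> schwartz" for \<psi> unfolding C_def
    by (rule disjI1, rule bexI[of _ \<psi>], rule refl, rule that)
  have CB: "C (B c \<theta> \<psi>)" if "c \<longlonglongrightarrow> 0" "\<theta> \<in> test_functions" "\<psi> \<in> schwartz" for c \<theta> \<psi>
    unfolding C_def by (rule disjI2) (intro exI[of _ c] bexI[of _ \<theta>] bexI[of _ \<psi>] conjI refl that)
  have test_d: "(\<lambda>x. \<theta> (dilation n *\<^sub>R x)) differentiable (at x)" if "\<theta> \<in> test_functions" for \<theta> n and x :: "real^'n"
    using that by (intro smooth_differentiable smooth_scaleR test_functions_smooth)
  have test_p: "partial_deriv i (\<lambda>x. \<theta> (dilation n *\<^sub>R x)) = (\<lambda>x. of_real (dilation n) * partial_deriv i \<theta> (dilation n *\<^sub>R x))"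
    if "\<theta> \<in> test_functions" for \<theta> :: "real^'n \<Rightarrow> complex" and i n
    using that by (intro partial_deriv_scaleR smooth_differentiable test_functions_smooth)
  have SB: "B c \<theta> \<psi> n \<in> schwartz" if "\<theta> \<in> test_functions" "\<psi> \<in> schwartz" for c \<theta> \<psi> n
    unfolding B_def using that by (intro schwartz_cmult schwartz_scaleR_mult dilation)
  have SA: "A \<psi> n \<in> schwartz" if "\<psi> \<in> schwartz" for \<psi> n
  proof -
    have "(\<lambda>x. bump (dilation n *\<^sub>R x) * \<psi> x - \<psi> x) \<in> schwartz"
      using that by (intro schwartz_diff schwartz_scaleR_mult bump_test dilation)
    then show ?thesis by (simp add: A_def left_diff_distrib)
  qed
  obtain L where L: "L > 0" "\<forall>x::real^'n. norm (bump x - bump (0 :: real^'n)) \<le> L * norm x"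
    by (rule schwartz_lipschitz_0[OF test_schwartz[OF bump_test]])
  have "schwartz_null (A \<psi>)"
  proof (rule schwartz_null_coinduct[where C = C])
    show "C (A \<psi>)" using CA assms .
    fix \<Theta> assume "C \<Theta>"
    then consider \<psi> where "\<psi> \<in> schwartz" "\<Theta> = A \<psi>"
      | c \<theta> \<psi> where "c \<longlonglongrightarrow> 0" "\<theta> \<in> test_functions" "\<psi> \<in> schwartz" "\<Theta> = B c \<theta> \<psi>"
      unfolding C_def by (elim disjE bexE exE conjE) ((rule that(1); assumption), (rule that(2); assumption))
    note cases = this
    show "\<Theta> n \<in> schwartz" for n using cases by cases (auto intro: SA SB)
    show "seq_sums_of C (\<lambda>n. partial_deriv i (\<Theta> n))" for i
      using cases
    proof cases
      case (1 \<psi>)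
      have d: "\<psi> differentiable (at x)" for x using 1 by (intro smooth_differentiable schwartz_smooth)
      have d1: "(\<lambda>x. bump (dilation n *\<^sub>R x) - 1) differentiable (at x)" for n and x :: "real^'n"
        using test_d[OF bump_test] by (intro differentiable_diff) auto
      have "partial_deriv i (\<lambda>x. bump (dilation n *\<^sub>R x) + (- 1)) = (\<lambda>x. partial_deriv i (\<lambda>x. bump (dilation n *\<^sub>R x)) x + partial_deriv i (\<lambda>x::real^'n. - 1) x)" for n
        by (rule partial_deriv_add) (auto intro: test_d[OF bump_test])
      then have p1: "partial_deriv i (\<lambda>x. bump (dilation n *\<^sub>R x) - 1) = (\<lambda>x::real^'n. of_real (dilation n) * partial_deriv i bump (dilation n *\<^sub>R x))" for n
        by (simp add: test_p[OF bump_test])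
      have "(\<lambda>n. partial_deriv i (\<Theta> n)) = (\<lambda>n x. B dilation (partial_deriv i bump) \<psi> n x + A (partial_deriv i \<psi>) n x)"
        unfolding 1 A_def B_def partial_deriv_mult[of "\<lambda>x. bump (dilation n *\<^sub>R x) - 1" \<psi> for n, OF d1 d] p1 mult.assoc ..
      then show ?thesis
        using CA[OF schwartz_partial_deriv[OF 1(1)]] CB[OF dilation(2) test_partial_deriv[OF bump_test] 1(1)]
        by (simp only: seq_sums_of.add seq_sums_of.base)
    next
      case (2 c \<theta> \<psi>)
      have d: "\<psi> differentiable (at x)" for x using 2 by (intro smooth_differentiable schwartz_smooth)
      have d2: "(\<lambda>x. \<theta> (dilation n *\<^sub>R x) * \<psi> x) differentiable (at x)" for n x
        using d test_d[OF 2(2)] by (intro differentiable_mult)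
      have "partial_deriv i (\<Theta> n) = (\<lambda>x. partial_deriv i (\<lambda>x. of_real (c n)) x * (\<theta> (dilation n *\<^sub>R x) * \<psi> x)
          + of_real (c n) * partial_deriv i (\<lambda>x. \<theta> (dilation n *\<^sub>R x) * \<psi> x) x)" for n
        unfolding 2 B_def by (rule partial_deriv_mult) (auto intro: d2)
      moreover have "partial_deriv i (\<lambda>x. \<theta> (dilation n *\<^sub>R x) * \<psi> x)
          = (\<lambda>x. (of_real (dilation n) * partial_deriv i \<theta> (dilation n *\<^sub>R x)) * \<psi> x + \<theta> (dilation n *\<^sub>R x) * partial_deriv i \<psi> x)" for n
        unfolding partial_deriv_mult[of "\<lambda>x. \<theta> (dilation n *\<^sub>R x)" \<psi>, OF test_d[OF 2(2)] d] test_p[OF 2(2)] ..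
      ultimately have "(\<lambda>n. partial_deriv i (\<Theta> n)) = (\<lambda>n x. B (\<lambda>n. c n * dilation n) (partial_deriv i \<theta>) \<psi> n x + B c \<theta> (partial_deriv i \<psi>) n x)"
        by (simp add: B_def algebra_simps)
      moreover have "(\<lambda>n. c n * dilation n) \<longlonglongrightarrow> 0" using tendsto_mult[OF 2(1) dilation(2)] by simp
      ultimately show ?thesis
        using CB[OF _ test_partial_deriv[OF 2(2)] 2(3)] CB[OF 2(1,2) schwartz_partial_deriv[OF 2(3)]]
        by (simp only: seq_sums_of.add seq_sums_of.base)
    qed
    show "\<forall>\<^sub>F n in sequentially. \<forall>x. (1 + norm x) ^ k * norm (\<Theta> n x) \<le> e" if "e > 0" for k e
      using cases
    proof cases
      case (1 \<psi>)
      obtain M where M: "M > 0" "\<And>x. (1 + norm x) ^ Suc k * norm (\<psi> x) \<le> M" using schwartz_bound[OF 1(1)] by metis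
      have le: "(1 + norm x) ^ k * norm (\<Theta> n x) \<le> L * M * dilation n" for n x
      proof -
        have "norm (bump (dilation n *\<^sub>R x) - 1) \<le> L * norm (dilation n *\<^sub>R x)"
          using L(2)[rule_format, of "dilation n *\<^sub>R x"] by (simp only: bump_0)
        also have "\<dots> \<le> L * dilation n * (1 + norm x)"
          using L(1) dilation(1)[of n] by simp
        finally have "(1 + norm x) ^ k * norm (\<Theta> n x) \<le> (1 + norm x) ^ k * ((L * dilation n * (1 + norm x)) * norm (\<psi> x))"
          unfolding 1 A_def norm_mult by (intro mult_left_mono mult_right_mono) auto
        also have "\<dots> = L * dilation n * ((1 + norm x) ^ Suc k * norm (\<psi> x))" by (simp only: power_Suc ac_simps)
        also have "\<dots> \<le> L * dilation n * M"
          using L(1) dilation(1)[of n] M(2)[of x] by (intro mult_left_mono) auto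
        finally show ?thesis by (simp only: ac_simps)
      qed
      have "(\<lambda>n. L * M * dilation n) \<longlonglongrightarrow> 0" by (rule tendsto_mult_right_zero[OF dilation(2)])
      from order_tendstoD(2)[OF this that] show ?thesis
        by eventually_elim (use le in \<open>meson less_imp_le order_trans\<close>)
    next
      case (2 c \<theta> \<psi>)
      obtain M where M: "M > 0" "\<And>x. (1 + norm x) ^ k * norm (\<psi> x) \<le> M" using schwartz_bound[OF 2(3)] by metis
      obtain N where N: "N > 0" "\<And>x. (1 + norm x) ^ 0 * norm (\<theta> x) \<le> N" using schwartz_bound[OF test_schwartz[OF 2(2)]] by metis
      have le: "(1 + norm x) ^ k * norm (\<Theta> n x) \<le> N * M * \<bar>c n\<bar>" for n x
      proof -
        have "(1 + norm x) ^ k * norm (\<Theta> n x) = \<bar>c n\<bar> * (norm (\<theta> (dilation n *\<^sub>R x)) * ((1 + norm x) ^ k * norm (\<psi> x)))"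
          by (simp add: 2 B_def norm_mult)
        also have "\<dots> \<le> \<bar>c n\<bar> * (N * M)"
          using N M by (intro mult_left_mono mult_mono) auto
        finally show ?thesis by (simp only: ac_simps)
      qed
      have "(\<lambda>n. N * M * \<bar>c n\<bar>) \<longlonglongrightarrow> 0"
        using tendsto_mult_right_zero[OF tendsto_rabs_zero[OF 2(1)]] .
      from order_tendstoD(2)[OF this that] show ?thesis
        by eventually_elim (use le in \<open>meson less_imp_le order_trans\<close>)
    qed
  qed
  then show ?thesis by (simp add: A_def)
qed

lemma bump_cutoff_test:
  assumes "\<psi> \<in> schwartz"
  shows "(\<lambda>x. bump (dilation n *\<^sub>R x) * \<psi> x) \<in> test_functions"
  using assms by (intro test_mult test_scaleR bump_test dilation schwartz_smooth)

subsection \<open>Density of test functions and duality\<close>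

lemma smooth_of_real_linear:
  fixes f :: "real^'n::finite \<Rightarrow> real"
  assumes "bounded_linear f"
  shows "smooth (\<lambda>x. complex_of_real (f x))"
proof -
  let ?g = "\<lambda>x. complex_of_real (f x)"
  have d: "(?g has_derivative ?g) (at x)" for x
    by (rule bounded_linear_imp_has_derivative) (intro bounded_linear_compose[OF bounded_linear_of_real assms])
  define C where "C h \<longleftrightarrow> h = ?g \<or> (\<exists>c. h = (\<lambda>x. c))" for h
  show ?thesis
  proof (rule smooth_coinduct[where C = C])
    show "C ?g" by (simp add: C_def)
    fix h assume "C h"
    then consider "h = ?g" | c where "h = (\<lambda>x. c)" unfolding C_def by (elim disjE exE)
    note cases = this
    show "h differentiable (at x)" for x
      using cases by cases (use d in \<open>auto simp: differentiable_def\<close>)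
    show "sums_of C (partial_deriv i h)" for i
    proof -
      have "\<exists>c. partial_deriv i h = (\<lambda>x. c)"
        using cases by cases (use partial_deriv_eq[OF d] in \<open>auto intro!: exI\<close>)
      then show ?thesis unfolding C_def by (intro sums_of.base) simp
    qed
  qed
qed

lemma smooth_of_real_polynomial:
  fixes p :: "real^'n::finite \<Rightarrow> real"
  assumes "real_polynomial_function p"
  shows "smooth (\<lambda>x. complex_of_real (p x))"
  using assms
proof (induction rule: real_polynomial_function.induct)
  case (add f g)
  from smooth_add[OF add.IH] show ?case by simp
next
  case (mult f g)
  from smooth_mult[OF mult.IH] show ?case by simp
qed (simp_all add: smooth_of_real_linear)

lemma smooth_polynomial:
  fixes p :: "real^'n::finite \<Rightarrow> complex"
  assumes "polynomial_function p"
  shows "smooth p"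
proof -
  have "real_polynomial_function (Re \<circ> p)" "real_polynomial_function (Im \<circ> p)"
    using assms unfolding polynomial_function_def by (auto intro: bounded_linear_Re bounded_linear_Im)
  from this[THEN smooth_of_real_polynomial]
  have "smooth (\<lambda>x. complex_of_real (Re (p x)) + \<i> * complex_of_real (Im (p x)))"
    by (intro smooth_add smooth_mult smooth_const) (simp_all add: o_def)
  then show ?thesis by (simp add: complex_eq[symmetric])
qed

text \<open>Polynomials approximate the quotient by a bump function, which extends continuously by zero.\<close>

lemma test_functions_uniformly_dense:
  fixes f :: "real^'n::finite \<Rightarrow> complex"
  assumes cont: "continuous_on UNIV f" and supp: "\<And>x. R \<le> norm x \<Longrightarrow> f x = 0" and "R > 0" "e > 0"
  obtains \<phi> where "\<phi> \<in> test_functions" "\<forall>x. norm (\<phi> x - f x) < e" "\<forall>x. R + 1 \<le> norm x \<longrightarrow> \<phi> x = 0"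
proof -
  \<comment> \<open>The bump is scaled to vanish exactly from radius \<open>R + 1\<close> on, so it
    has no zero on the ball that carries \<open>f\<close>.\<close>
  define c where "c = 1 / (R + 1)"
  have c: "c > 0" unfolding c_def using assms(3) by simp
  define b where "b x = bump (c *\<^sub>R x)" for x :: "real^'n"
  have b0: "b x \<noteq> 0" if "norm x < R + 1" for x
    unfolding b_def using that assms(3) by (intro bump_nonzero) (simp add: c_def)
  have b1: "b x = 0" if "R + 1 \<le> norm x" for x
  proof -
    have "1 \<le> norm (c *\<^sub>R x)" using that assms(3) by (simp add: c_def pos_le_divide_eq)
    then have "1 \<le> (c *\<^sub>R x) \<bullet> (c *\<^sub>R x)" by (simp only: dot_square_norm) simp
    then show ?thesis unfolding b_def bump_def bump_aux_def by simp
  qed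
  have bt: "b \<in> test_functions" unfolding b_def[abs_def] by (rule test_scaleR[OF bump_test c])
  have cb: "continuous_on A b" for A by (rule smooth_continuous_on[OF test_functions_smooth[OF bt]])
  define g where "g x = f x / b x" for x
  \<comment> \<open>On the first open set the denominator has no zero; on the second the numerator
    vanishes, and from radius \<open>R + 1\<close> on the quotient is a division by zero with value
    0. The two sets overlap in a shell and cover the space.\<close>
  have "continuous_on ({x. norm x < R + 1} \<union> {x. R < norm x}) g"
  proof (rule continuous_on_open_Un)
    show "open {x::real^'n. norm x < R + 1}" "open {x::real^'n. R < norm x}"
      by (intro open_Collect_less continuous_intros)+
    show "continuous_on {x. norm x < R + 1} g"
      unfolding g_def using b0 by (intro continuous_on_divide continuous_on_subset[OF cont] cb) auto
    have "continuous_on {x::real^'n. R < norm x} (\<lambda>x. 0 :: complex)" by simp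
    then show "continuous_on {x. R < norm x} g"
      by (rule continuous_on_eq) (simp add: g_def supp)
  qed
  moreover have "{x. norm x < R + 1} \<union> {x. R < norm x} = (UNIV :: (real^'n) set)" by auto
  ultimately have "continuous_on (cball 0 (R + 1)) g" by (metis continuous_on_subset subset_UNIV)
  from Stone_Weierstrass_polynomial_function[OF compact_cball this assms(4)]
  obtain p where p: "polynomial_function p" "\<forall>x\<in>cball 0 (R + 1). norm (g x - p x) < e" by blast
  show ?thesis
  proof (rule that[of "\<lambda>x. b x * p x"])
    show "(\<lambda>x. b x * p x) \<in> test_functions" by (rule test_mult[OF bt smooth_polynomial[OF p(1)]])
    show "\<forall>x. R + 1 \<le> norm x \<longrightarrow> b x * p x = 0" using b1 by simp
    show "\<forall>x. norm (b x * p x - f x) < e"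
    proof
      fix x
      show "norm (b x * p x - f x) < e"
      proof (cases "norm x < R + 1")
        case True
        have "f x = b x * g x" using b0[OF True] by (simp add: g_def)
        then have "norm (b x * p x - f x) = norm (b x) * norm (g x - p x)"
          by (simp add: norm_mult[symmetric] right_diff_distrib norm_minus_commute)
        also have "\<dots> \<le> 1 * norm (g x - p x)"
          unfolding b_def by (intro mult_right_mono norm_bump_le) simp
        also have "\<dots> < e" using p(2) True by simp
        finally show ?thesis .
      next
        case False
        then show ?thesis using b1[of x] supp[of x] assms(4) by simp
      qed
    qed
  qed
qed

text \<open>A measurable function is an almost everywhere limit of continuous ones. Clipping the
  values and cutting off in space keep these within a common bound and a common ball, as dominated
  convergence will require. Each is then replaced by a test function at uniform distance
  \<open>1 / (n + 1)\<close>; hence the margins in \<open>B + 1\<close> and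
  \<open>R + 2\<close>.\<close>

lemma test_functions_ae_dense:
  fixes g :: "real^'n::finite \<Rightarrow> complex"
  assumes [measurable]: "g \<in> borel_measurable borel" and bd: "\<And>x. norm (g x) \<le> B"
    and supp: "\<And>x. R \<le> norm x \<Longrightarrow> g x = 0" and "R > 0" "B > 0"
  obtains \<phi> where "\<forall>n. \<phi> n \<in> test_functions" "\<forall>n x. norm (\<phi> n x) \<le> B + 1"
    "\<forall>n x. R + 2 \<le> norm x \<longrightarrow> \<phi> n x = 0" "AE x in lborel. (\<lambda>n. \<phi> n x) \<longlonglongrightarrow> g x"
proof -
  have "g \<in> borel_measurable lebesgue" by (rule measurable_completion) simp
  then have "g measurable_on UNIV"
    by (rule lebesgue_measurable_imp_measurable_on) simp
  then obtain N h where N: "negligible N" and h: "\<forall>n. continuous_on UNIV (h n)"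
    and lim: "\<forall>x. x \<notin> N \<longrightarrow> (\<lambda>n. h n x) \<longlonglongrightarrow> (if x \<in> UNIV then g x else 0)"
    unfolding measurable_on_def by (elim exE conjE)
  \<comment> \<open>The radial retraction onto the ball of radius \<open>B\<close>; the
    \<open>max\<close> keeps the denominator positive and the map continuous.\<close>
  define clip where "clip z = (B / max B (norm z)) *\<^sub>R z" for z :: complex
  have clip_le: "norm (clip z) \<le> B" for z
    using assms(5) norm_ge_zero[of z] by (auto simp: clip_def max_def field_simps)
  have clip_eq: "clip z = z" if "norm z \<le> B" for z
    using that assms(5) by (simp add: clip_def max_def)
  have clip_cont: "continuous_on A clip" for A
    unfolding clip_def using assms(5) by (intro continuous_intros) (auto simp: max_def)
  define w where "w x = max 0 (min 1 (R + 1 - norm x))" for x :: "real^'n"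
  have w: "0 \<le> w x" "w x \<le> 1" for x by (auto simp: w_def)
  define f where "f n x = w x *\<^sub>R clip (h n x)" for n x
  have f_cont: "continuous_on UNIV (f n)" for n
    unfolding f_def w_def
    by (intro continuous_intros continuous_on_compose2[OF clip_cont[of UNIV]] h[rule_format]) auto
  have f_supp: "f n x = 0" if "R + 1 \<le> norm x" for n x
    using that by (simp add: f_def w_def)
  have f_le: "norm (f n x) \<le> B" for n x
    using mult_mono[OF w(2)[of x] clip_le[of "h n x"]] w(1)[of x] by (simp add: f_def)
  have "\<exists>\<phi>. \<phi> \<in> test_functions \<and> (\<forall>x. norm (\<phi> x - f n x) < 1 / real (Suc n)) \<and> (\<forall>x. R + 2 \<le> norm x \<longrightarrow> \<phi> x = 0)" for n
  proof -
    have pos: "R + 1 > 0" "1 / real (Suc n) > 0" using assms(4) by auto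
    obtain \<phi> where "\<phi> \<in> test_functions" "\<forall>x. norm (\<phi> x - f n x) < 1 / real (Suc n)" "\<forall>x. R + 1 + 1 \<le> norm x \<longrightarrow> \<phi> x = 0"
      by (rule test_functions_uniformly_dense[OF f_cont[of n] f_supp[where n = n] pos])
    then show ?thesis by (intro exI[of _ \<phi>]) simp
  qed
  then obtain \<phi> where \<phi>: "\<And>n. \<phi> n \<in> test_functions" "\<And>n x. norm (\<phi> n x - f n x) < 1 / real (Suc n)"
    "\<And>n x. R + 2 \<le> norm x \<longrightarrow> \<phi> n x = 0" by metis
  show ?thesis
  proof (rule that[of \<phi>])
    show "\<forall>n. \<phi> n \<in> test_functions" "\<forall>n x. R + 2 \<le> norm x \<longrightarrow> \<phi> n x = 0" using \<phi> by blast+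
    show "\<forall>n x. norm (\<phi> n x) \<le> B + 1"
    proof (intro allI)
      fix n x
      have "norm (\<phi> n x) \<le> norm (f n x) + norm (\<phi> n x - f n x)" by (rule norm_triangle_sub)
      moreover have "1 / real (Suc n) \<le> 1" by simp
      ultimately show "norm (\<phi> n x) \<le> B + 1" using f_le[of n x] \<phi>(2)[of n x] by linarith
    qed
    have "N \<in> null_sets lebesgue" using N by (simp add: negligible_iff_null_sets)
    then have "AE x in lebesgue. x \<notin> N" by (rule AE_not_in)
    then have "AE x in lborel. x \<notin> N" by (simp only: AE_completion_iff)
    then show "AE x in lborel. (\<lambda>n. \<phi> n x) \<longlonglongrightarrow> g x"
    proof eventually_elim
      case (elim x)
      have "(\<lambda>n. h n x) \<longlonglongrightarrow> g x" using lim elim by simp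
      then have "(\<lambda>n. clip (h n x)) \<longlonglongrightarrow> clip (g x)"
        by (rule continuous_on_tendsto_compose[OF clip_cont[of UNIV]]) auto
      then have "(\<lambda>n. f n x) \<longlonglongrightarrow> w x *\<^sub>R clip (g x)"
        unfolding f_def by (intro tendsto_scaleR tendsto_const)
      also have "w x *\<^sub>R clip (g x) = g x"
      proof (cases "R \<le> norm x")
        case True
        then show ?thesis using supp[OF True] by (simp add: clip_def)
      next
        case False
        then show ?thesis using clip_eq[OF bd[of x]] by (simp add: w_def)
      qed
      finally have "(\<lambda>n. f n x) \<longlonglongrightarrow> g x" .
      moreover have "(\<lambda>n. \<phi> n x - f n x) \<longlonglongrightarrow> 0"
      proof (rule Lim_null_comparison)
        show "\<forall>\<^sub>F n in sequentially. norm (\<phi> n x - f n x) \<le> 1 / real (Suc n)"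
          using \<phi>(2) by (intro always_eventually allI less_imp_le)
        show "(\<lambda>n. 1 / real (Suc n)) \<longlonglongrightarrow> 0" by (rule LIMSEQ_Suc[OF lim_1_over_n])
      qed
      ultimately have "(\<lambda>n. (\<phi> n x - f n x) + f n x) \<longlonglongrightarrow> 0 + g x" by (intro tendsto_add)
      then show ?case by simp
    qed
  qed
qed

text \<open>The Borel counterpart of \<open>locally_Lp 1\<close>. Borel measurability survives
  translations, reflections and pairing of variables, which the later uses of Fubini need.\<close>

definition loc_integrable :: "(real^'n::finite \<Rightarrow> complex) \<Rightarrow> bool" where
  "loc_integrable f \<longleftrightarrow> f \<in> borel_measurable borel \<and>
     (\<forall>R. integrable lborel (\<lambda>x. indicator (cball 0 R) x *\<^sub>R norm (f x)))"

lemma loc_integrable_borel: "loc_integrable f \<Longrightarrow> f \<in> borel_measurable borel"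
  by (simp add: loc_integrable_def)

lemma loc_integrable_mult:
  fixes f g :: "real^'n::finite \<Rightarrow> complex"
  assumes f: "loc_integrable f" and [measurable]: "g \<in> borel_measurable borel"
    and g: "\<And>x. norm (g x) \<le> B" "\<And>x. R \<le> norm x \<Longrightarrow> g x = 0"
  shows "norm (f x * g x) \<le> B * (indicator (cball 0 R) x *\<^sub>R norm (f x))"
    and "integrable lborel (\<lambda>x. B * (indicator (cball 0 R) x *\<^sub>R norm (f x)))"
    and "integrable lborel (\<lambda>x. f x * g x)"
proof -
  have [measurable]: "f \<in> borel_measurable borel" using f by (rule loc_integrable_borel)
  show le: "norm (f x * g x) \<le> B * (indicator (cball 0 R) x *\<^sub>R norm (f x))" for x
  proof (cases "norm x \<le> R")
    case True
    have "norm (f x * g x) \<le> B * norm (f x)"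
      unfolding norm_mult mult.commute[of "norm (f x)"] using g(1) by (intro mult_right_mono) auto
    then show ?thesis using True by simp
  next
    case False
    then show ?thesis using g(2)[of x] by simp
  qed
  show int: "integrable lborel (\<lambda>x. B * (indicator (cball 0 R) x *\<^sub>R norm (f x)))"
    using f unfolding loc_integrable_def by (intro integrable_mult_right) blast
  show "integrable lborel (\<lambda>x. f x * g x)"
    by (rule Bochner_Integration.integrable_bound[OF int])
      (measurable, use le in \<open>auto intro!: order_trans[OF _ abs_ge_self]\<close>)
qed

lemma loc_integrable_mult_test:
  assumes f: "loc_integrable f" and \<phi>: "\<phi> \<in> test_functions"
  shows "integrable lborel (\<lambda>x. f x * \<phi> x)"
proof -
  obtain R where R: "R > 0" "\<forall>x. R \<le> norm x \<longrightarrow> \<phi> x = 0" by (rule test_functions_support[OF \<phi>])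
  obtain B where B: "\<And>x. (1 + norm x) ^ 0 * norm (\<phi> x) \<le> B" using test_weighted_bound[OF \<phi>] by metis
  show ?thesis
    by (rule loc_integrable_mult(3)[OF f, of \<phi> B R])
      (use R B smooth_borel[OF test_functions_smooth[OF \<phi>]] in auto)
qed

text \<open>The converse of the Cauchy-Schwarz inequality. The bound is extended from test functions
  to bounded functions of bounded support and then tested with truncations of the conjugate of
  \<open>f\<close>. A truncated square integral \<open>I\<close> satisfies
  \<open>I \<le> M * sqrt I\<close>, and Fatou's lemma removes the truncation.\<close>

lemma L2_duality:
  fixes f :: "real^'n::finite \<Rightarrow> complex"
  assumes f: "loc_integrable f" and M: "M \<ge> 0"
    and le: "\<And>\<phi>. \<phi> \<in> test_functions \<Longrightarrow> norm (LINT x|lborel. f x * \<phi> x) \<le> M * sqrt (LINT x|lborel. (norm (\<phi> x))\<^sup>2)"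
  shows "integrable lborel (\<lambda>x. (norm (f x))\<^sup>2)" and "(LINT x|lborel. (norm (f x))\<^sup>2) \<le> M\<^sup>2"
proof -
  have [measurable]: "f \<in> borel_measurable borel" using f by (rule loc_integrable_borel)
  have ext: "norm (LINT x|lborel. f x * g x) \<le> M * sqrt (LINT x|lborel. (norm (g x))\<^sup>2)"
    if gm[measurable]: "g \<in> borel_measurable borel" and g: "\<And>x. norm (g x) \<le> B" "\<And>x. R \<le> norm x \<Longrightarrow> g x = 0"
      and pos: "R > 0" "B > 0" for g B R
  proof -
    obtain \<phi> where \<phi>: "\<forall>n. \<phi> n \<in> test_functions" "\<forall>n x. norm (\<phi> n x) \<le> B + 1"
      "\<forall>n x. R + 2 \<le> norm x \<longrightarrow> \<phi> n x = 0" "AE x in lborel. (\<lambda>n. \<phi> n x) \<longlonglongrightarrow> g x"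
      by (rule test_functions_ae_dense[OF gm g pos])
    have m[measurable]: "\<phi> n \<in> borel_measurable borel" for n
      using \<phi>(1) by (intro smooth_borel test_functions_smooth) blast
    have bnd: "norm (\<phi> n x) \<le> B + 1" "R + 2 \<le> norm x \<Longrightarrow> \<phi> n x = 0" for n x using \<phi>(2,3) by auto
    have "(\<lambda>n. LINT x|lborel. f x * \<phi> n x) \<longlonglongrightarrow> (LINT x|lborel. f x * g x)"
    proof (rule integral_dominated_convergence)
      show "integrable lborel (\<lambda>x. (B + 1) * (indicator (cball 0 (R + 2)) x *\<^sub>R norm (f x)))"
        by (rule loc_integrable_mult(2)[OF f m bnd])
      show "AE x in lborel. norm (f x * \<phi> n x) \<le> (B + 1) * (indicator (cball 0 (R + 2)) x *\<^sub>R norm (f x))" for n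
        using loc_integrable_mult(1)[OF f m bnd] by (intro AE_I2)
      show "AE x in lborel. (\<lambda>n. f x * \<phi> n x) \<longlonglongrightarrow> f x * g x"
        using \<phi>(4) by eventually_elim (intro tendsto_mult tendsto_const)
    qed measurable
    then have l1: "(\<lambda>n. norm (LINT x|lborel. f x * \<phi> n x)) \<longlonglongrightarrow> norm (LINT x|lborel. f x * g x)"
      by (rule tendsto_norm)
    have "(\<lambda>n. LINT x|lborel. (norm (\<phi> n x))\<^sup>2) \<longlonglongrightarrow> (LINT x|lborel. (norm (g x))\<^sup>2)"
    proof (rule integral_dominated_convergence)
      show "integrable lborel (\<lambda>x::real^'n. (B + 1)\<^sup>2 * indicat_real (cball 0 (R + 2)) x)"
        by (intro integrable_mult_right integrable_real_indicator emeasure_bounded_finite bounded_cball) simp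
      show "AE x in lborel. norm ((norm (\<phi> n x))\<^sup>2) \<le> (B + 1)\<^sup>2 * indicat_real (cball 0 (R + 2)) x" for n
      proof (rule AE_I2)
        fix x :: "real^'n"
        show "norm ((norm (\<phi> n x))\<^sup>2) \<le> (B + 1)\<^sup>2 * indicat_real (cball 0 (R + 2)) x"
        proof (cases "norm x \<le> R + 2")
          case True
          then show ?thesis using power_mono[OF bnd(1), of n x 2] by simp
        next
          case False
          then show ?thesis using bnd(2)[of x n] by simp
        qed
      qed
      show "AE x in lborel. (\<lambda>n. (norm (\<phi> n x))\<^sup>2) \<longlonglongrightarrow> (norm (g x))\<^sup>2"
        using \<phi>(4) by eventually_elim (intro tendsto_power tendsto_norm)
    qed measurable
    then have l2: "(\<lambda>n. M * sqrt (LINT x|lborel. (norm (\<phi> n x))\<^sup>2)) \<longlonglongrightarrow> M * sqrt (LINT x|lborel. (norm (g x))\<^sup>2)"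
      by (intro tendsto_mult tendsto_const tendsto_real_sqrt)
    show ?thesis by (rule LIMSEQ_le[OF l1 l2]) (use le \<phi>(1) in blast)
  qed
  \<comment> \<open>\<open>Suc m\<close> keeps both bounds positive, as the extension step
    \<open>ext\<close> requires.\<close>
  define S where "S m = {x. norm x < real (Suc m) \<and> norm (f x) \<le> real (Suc m)}" for m
  have [measurable]: "S m \<in> sets borel" for m unfolding S_def by measurable
  define u where "u m x = indicat_real (S m) x * (norm (f x))\<^sup>2" for m x
  have trunc: "(\<integral>\<^sup>+x. ennreal (u m x) \<partial>lborel) \<le> ennreal (M\<^sup>2)" for m
  proof -
    define g where "g x = indicat_real (S m) x *\<^sub>R cnj (f x)" for x
    have [measurable]: "g \<in> borel_measurable borel" unfolding g_def by measurable
    have g: "norm (g x) \<le> real (Suc m)" "real (Suc m) \<le> norm x \<Longrightarrow> g x = 0" for x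
      by (auto simp: g_def S_def indicator_def)
    have fg: "f x * g x = of_real (u m x)" for x
      unfolding g_def u_def of_real_mult complex_norm_square by (simp add: scaleR_conv_of_real)
    have gg: "(norm (g x))\<^sup>2 = u m x" for x
      by (simp add: g_def u_def indicator_def)
    have "integrable lborel (\<lambda>x. f x * g x)"
      by (rule loc_integrable_mult(3)[OF f _ g]) simp
    from integrable_Re[OF this] have int: "integrable lborel (u m)" unfolding fg by simp
    define I where "I = (LINT x|lborel. u m x)"
    have I0: "I \<ge> 0" unfolding I_def by (intro Bochner_Integration.integral_nonneg) (simp add: u_def)
    have "norm (LINT x|lborel. f x * g x) \<le> M * sqrt (LINT x|lborel. (norm (g x))\<^sup>2)"
      by (rule ext[OF _ g]) auto
    then have "I \<le> M * sqrt I"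
      unfolding fg gg using I0 by (simp add: I_def)
    then have "sqrt I * sqrt I \<le> M * sqrt I" using I0 by simp
    then have "sqrt I \<le> M"
    proof (cases "I = 0")
      case False
      then have "0 < sqrt I" using I0 by simp
      with \<open>sqrt I * sqrt I \<le> M * sqrt I\<close> show ?thesis by (rule mult_right_le_imp_le)
    qed (use M in simp)
    then have "(sqrt I)\<^sup>2 \<le> M\<^sup>2" by (intro power_mono) (auto simp: I0)
    then have "I \<le> M\<^sup>2" using I0 by simp
    moreover have "(\<integral>\<^sup>+x. ennreal (u m x) \<partial>lborel) = ennreal I"
      unfolding I_def by (rule nn_integral_eq_integral[OF int]) (simp add: u_def)
    ultimately show ?thesis by (simp add: ennreal_leI)
  qed
  have lim: "(\<lambda>m. ennreal (u m x)) \<longlonglongrightarrow> ennreal ((norm (f x))\<^sup>2)" for x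
  proof (rule tendsto_eventually)
    obtain n where n: "norm x + norm (f x) < real n" using reals_Archimedean2 by blast
    show "\<forall>\<^sub>F m in sequentially. ennreal (u m x) = ennreal ((norm (f x))\<^sup>2)"
    proof (rule eventually_sequentiallyI[of n])
      fix m assume "n \<le> m"
      then have "real n \<le> real (Suc m)" by simp
      then have "x \<in> S m"
        using n norm_ge_zero[of x] norm_ge_zero[of "f x"] unfolding S_def by (simp only: mem_Collect_eq) linarith
      then show "ennreal (u m x) = ennreal ((norm (f x))\<^sup>2)" by (simp add: u_def)
    qed
  qed
  have "(\<integral>\<^sup>+x. ennreal ((norm (f x))\<^sup>2) \<partial>lborel) = (\<integral>\<^sup>+x. liminf (\<lambda>m. ennreal (u m x)) \<partial>lborel)"
    by (intro nn_integral_cong) (simp add: lim_imp_Liminf[OF _ lim])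
  also have "\<dots> \<le> liminf (\<lambda>m. \<integral>\<^sup>+x. ennreal (u m x) \<partial>lborel)"
    by (rule nn_integral_liminf) (simp add: u_def)
  also have "\<dots> \<le> ennreal (M\<^sup>2)"
    using trunc by (intro Liminf_le) (auto intro!: always_eventually)
  finally have fin: "(\<integral>\<^sup>+x. ennreal ((norm (f x))\<^sup>2) \<partial>lborel) \<le> ennreal (M\<^sup>2)" .
  show int: "integrable lborel (\<lambda>x. (norm (f x))\<^sup>2)"
    by (rule integrableI_nonneg) (auto intro: le_less_trans[OF fin])
  show "(LINT x|lborel. (norm (f x))\<^sup>2) \<le> M\<^sup>2"
    using fin nn_integral_eq_integral[OF int] by (simp add: ennreal_le_iff)
qed

text \<open>The case \<open>M = 0\<close> of duality. It provides uniqueness of representing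
  functions.\<close>

lemma orthogonal_test_functions_zero:
  fixes f :: "real^'n::finite \<Rightarrow> complex"
  assumes f: "loc_integrable f" and z: "\<And>\<phi>. \<phi> \<in> test_functions \<Longrightarrow> (LINT x|lborel. f x * \<phi> x) = 0"
  shows "AE x in lborel. f x = 0"
proof -
  have *: "norm (LINT x|lborel. f x * \<phi> x) \<le> 0 * sqrt (LINT x|lborel. (norm (\<phi> x))\<^sup>2)" if "\<phi> \<in> test_functions" for \<phi>
    using z[OF that] by simp
  note L = L2_duality[OF f order_refl *]
  have "(LINT x|lborel. (norm (f x))\<^sup>2) = 0"
  proof (rule antisym)
    show "(LINT x|lborel. (norm (f x))\<^sup>2) \<le> 0" using L(2) by simp
    show "0 \<le> (LINT x|lborel. (norm (f x))\<^sup>2)" by (intro Bochner_Integration.integral_nonneg) simp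
  qed
  then show ?thesis
    by (subst (asm) integral_nonneg_eq_0_iff_AE[OF L(1)]) auto
qed

lemma loc_integrable_diff:
  fixes f g :: "real^'n::finite \<Rightarrow> complex"
  assumes f: "loc_integrable f" and g: "loc_integrable g"
  shows "loc_integrable (\<lambda>x. f x - g x)"
  unfolding loc_integrable_def
proof (intro conjI allI)
  have [measurable]: "f \<in> borel_measurable borel" "g \<in> borel_measurable borel"
    using loc_integrable_borel[OF f] loc_integrable_borel[OF g] by auto
  have [measurable]: "cball (0 :: real^'n) R \<in> sets borel" for R by simp
  show "(\<lambda>x. f x - g x) \<in> borel_measurable borel" by measurable
  fix R
  have "integrable lborel (\<lambda>x. indicator (cball 0 R) x *\<^sub>R norm (f x) + indicator (cball 0 R) x *\<^sub>R norm (g x))"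
    using f g unfolding loc_integrable_def by (intro Bochner_Integration.integrable_add) blast+
  then show "integrable lborel (\<lambda>x. indicator (cball 0 R) x *\<^sub>R norm (f x - g x))"
  proof (rule Bochner_Integration.integrable_bound)
    show "AE x in lborel. norm (indicator (cball 0 R) x *\<^sub>R norm (f x - g x))
        \<le> norm (indicator (cball 0 R) x *\<^sub>R norm (f x) + indicator (cball 0 R) x *\<^sub>R norm (g x))"
      by (rule AE_I2) (auto simp: indicator_def norm_triangle_ineq4)
  qed measurable
qed

lemma weight_pos [simp]: "0 < 1 + norm x" "1 + norm x \<noteq> 0" "0 < (1 + norm x) ^ k"
proof -
  show "0 < 1 + norm x" by (simp add: add_pos_nonneg)
  then show "1 + norm x \<noteq> 0" "0 < (1 + norm x) ^ k" by simp_all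
qed

lemma norm_weighted: "norm (norm z / (1 + norm x) ^ k) = norm z / (1 + norm x) ^ k"
  by (simp add: norm_divide norm_power)

subsection \<open>Square-integrable functions\<close>

definition L2 :: "('a::euclidean_space \<Rightarrow> complex) \<Rightarrow> bool" where
  "L2 f \<longleftrightarrow> f \<in> borel_measurable borel \<and> integrable lborel (\<lambda>x. (norm (f x))\<^sup>2)"

definition L2_norm :: "('a::euclidean_space \<Rightarrow> complex) \<Rightarrow> real" where
  "L2_norm f = sqrt (LINT x|lborel. (norm (f x))\<^sup>2)"

lemma L2_borel: "L2 f \<Longrightarrow> f \<in> borel_measurable borel"
  by (simp add: L2_def)

lemma L2_norm_nonneg: "0 \<le> L2_norm f"
  by (simp add: L2_norm_def Bochner_Integration.integral_nonneg)

lemma L2_norm_sq: "(LINT x|lborel. (norm (f x))\<^sup>2) = (L2_norm f)\<^sup>2"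
  by (simp add: L2_norm_def Bochner_Integration.integral_nonneg)

lemma L2_mono:
  assumes "L2 f" and m: "g \<in> borel_measurable borel" and "\<And>x. norm (g x) \<le> norm (f x)"
  shows "L2 g"
proof -
  have [measurable]: "g \<in> borel_measurable borel" by fact
  have "integrable lborel (\<lambda>x. (norm (g x))\<^sup>2)"
  proof (rule Bochner_Integration.integrable_bound)
    show "integrable lborel (\<lambda>x. (norm (f x))\<^sup>2)" using assms(1) by (simp add: L2_def)
    show "AE x in lborel. norm ((norm (g x))\<^sup>2) \<le> norm ((norm (f x))\<^sup>2)"
      using assms(3) by (intro AE_I2) (simp add: power_mono)
  qed measurable
  with m show ?thesis by (simp add: L2_def)
qed

lemma norm_mult_le_squares: "norm (a * b :: complex) \<le> (norm a)\<^sup>2 + (norm b)\<^sup>2"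
proof -
  have "0 \<le> (norm a - norm b)\<^sup>2" by simp
  then have "2 * (norm a * norm b) \<le> (norm a)\<^sup>2 + (norm b)\<^sup>2"
    by (simp add: power2_diff algebra_simps)
  moreover have "0 \<le> norm a * norm b" by simp
  ultimately show ?thesis unfolding norm_mult by linarith
qed

lemma L2_mult_integrable:
  assumes "L2 f" "L2 g"
  shows "integrable lborel (\<lambda>x. f x * g x)"
proof -
  note [measurable] = L2_borel[OF assms(1)] L2_borel[OF assms(2)]
  have "integrable lborel (\<lambda>x. (norm (f x))\<^sup>2 + (norm (g x))\<^sup>2)"
    using assms by (intro Bochner_Integration.integrable_add) (simp_all add: L2_def)
  then show ?thesis
    by (rule Bochner_Integration.integrable_bound)
      (measurable, intro AE_I2 order_trans[OF norm_mult_le_squares], simp)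
qed

lemma L2_cauchy_schwarz:
  assumes "L2 f" "L2 g"
  shows "(LINT x|lborel. norm (f x * g x)) \<le> L2_norm f * L2_norm g"
proof -
  note [measurable] = L2_borel[OF assms(1)] L2_borel[OF assms(2)]
  define I where "I = (LINT x|lborel. norm (f x * g x))"
  have I: "0 \<le> I" unfolding I_def by (intro Bochner_Integration.integral_nonneg) simp
  have "(\<integral>\<^sup>+x. ennreal (norm (f x)) * ennreal (norm (g x)) \<partial>lborel) = (\<integral>\<^sup>+x. ennreal (norm (f x * g x)) \<partial>lborel)"
    by (simp add: norm_mult ennreal_mult)
  also have "\<dots> = ennreal I"
    unfolding I_def by (intro nn_integral_eq_integral integrable_norm L2_mult_integrable assms) simp
  finally have "(\<integral>\<^sup>+x. ennreal (norm (f x)) * ennreal (norm (g x)) \<partial>lborel) = ennreal I" .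
  moreover have "(\<integral>\<^sup>+x. (ennreal (norm (f x)))\<^sup>2 \<partial>lborel) = ennreal ((L2_norm f)\<^sup>2)" if "L2 f" for f :: "'a \<Rightarrow> complex"
    using that unfolding L2_norm_sq[symmetric]
    by (subst nn_integral_eq_integral[symmetric]) (auto simp: L2_def ennreal_power)
  ultimately have "(ennreal I)\<^sup>2 \<le> ennreal ((L2_norm f)\<^sup>2) * ennreal ((L2_norm g)\<^sup>2)"
    using Cauchy_Schwarz_nn_integral[of "\<lambda>x. ennreal (norm (f x))" lborel "\<lambda>x. ennreal (norm (g x))"] assms
    by simp
  then have "ennreal (I\<^sup>2) \<le> ennreal ((L2_norm f * L2_norm g)\<^sup>2)"
    using I by (simp add: ennreal_power ennreal_mult[symmetric] power_mult_distrib)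
  then have "I\<^sup>2 \<le> (L2_norm f * L2_norm g)\<^sup>2"
    by (subst (asm) ennreal_le_iff) auto
  then show ?thesis
    unfolding I_def[symmetric] by (rule power2_le_imp_le) (simp add: L2_norm_nonneg)
qed

lemma L2_add:
  assumes "L2 f" "L2 g"
  shows "L2 (\<lambda>x. f x + g x)"
proof -
  note [measurable] = L2_borel[OF assms(1)] L2_borel[OF assms(2)]
  have int: "integrable lborel (\<lambda>x. 2 * (norm (f x))\<^sup>2 + 2 * (norm (g x))\<^sup>2)"
    using assms by (intro Bochner_Integration.integrable_add integrable_mult_right) (simp_all add: L2_def)
  have le: "(norm (f x + g x))\<^sup>2 \<le> 2 * (norm (f x))\<^sup>2 + 2 * (norm (g x))\<^sup>2" for x
  proof -
    have "(norm (f x + g x))\<^sup>2 \<le> (norm (f x) + norm (g x))\<^sup>2"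
      by (intro power_mono norm_triangle_ineq) simp
    also have "\<dots> \<le> 2 * (norm (f x))\<^sup>2 + 2 * (norm (g x))\<^sup>2"
      using zero_le_power2[of "norm (f x) - norm (g x)"] by (simp add: power2_sum power2_diff)
    finally show ?thesis .
  qed
  have "integrable lborel (\<lambda>x. (norm (f x + g x))\<^sup>2)"
    by (rule Bochner_Integration.integrable_bound[OF int]) (measurable, use le in \<open>auto intro!: order_trans[OF _ abs_ge_self]\<close>)
  then show ?thesis unfolding L2_def by simp
qed

lemma L2_cmult:
  assumes "L2 f"
  shows "L2 (\<lambda>x. c * f x)"
proof -
  note [measurable] = L2_borel[OF assms]
  have "integrable lborel (\<lambda>x. (norm c)\<^sup>2 * (norm (f x))\<^sup>2)"
    using assms by (intro integrable_mult_right) (simp add: L2_def)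
  then show ?thesis unfolding L2_def by (simp add: norm_mult power_mult_distrib)
qed

lemma L2_diff: "L2 f \<Longrightarrow> L2 g \<Longrightarrow> L2 (\<lambda>x. f x - g x)"
  using L2_add[of f "\<lambda>x. (-1) * g x"] L2_cmult[of g "-1"] by simp

lemma schwartz_L2: "\<phi> \<in> schwartz \<Longrightarrow> L2 \<phi>"
  by (simp add: L2_def schwartz_borel schwartz_sq_integrable)

lemma L2_unweighted:
  fixes K :: "'a::euclidean_space \<Rightarrow> complex"
  assumes "K \<in> borel_measurable borel" "L2 (\<lambda>\<xi>. of_real (1 + norm \<xi>) * K \<xi>)"
  shows "L2 K"
proof (rule L2_mono[OF assms(2,1)])
  fix \<xi>
  have "1 * norm (K \<xi>) \<le> (1 + norm \<xi>) * norm (K \<xi>)" by (intro mult_right_mono) auto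
  then show "norm (K \<xi>) \<le> norm (of_real (1 + norm \<xi>) * K \<xi>)" by (simp add: norm_mult del: of_real_add)
qed

lemma L2_loc_integrable:
  fixes f :: "real^'n::finite \<Rightarrow> complex"
  assumes "L2 f"
  shows "loc_integrable f"
  unfolding loc_integrable_def
proof (intro conjI allI)
  show m[measurable]: "f \<in> borel_measurable borel" by (rule L2_borel[OF assms])
  fix R
  have [measurable]: "cball (0::real^'n) R \<in> sets borel" by simp
  have "integrable lborel (\<lambda>x::real^'n. indicat_real (cball 0 R) x)"
    by (intro integrable_real_indicator emeasure_bounded_finite bounded_cball) simp
  moreover have "(norm (complex_of_real (indicat_real (cball 0 R) x)))\<^sup>2 = indicat_real (cball 0 R) x" for x :: "real^'n"
    by (simp add: indicator_def)
  moreover have "(\<lambda>x::real^'n. complex_of_real (indicat_real (cball 0 R) x)) \<in> borel_measurable borel" by measurable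
  ultimately have "L2 (\<lambda>x::real^'n. complex_of_real (indicat_real (cball 0 R) x))"
    unfolding L2_def by (simp only: simp_thms)
  from integrable_norm[OF L2_mult_integrable[OF this assms]]
  show "integrable lborel (\<lambda>x. indicator (cball 0 R) x *\<^sub>R norm (f x))"
    by (simp add: norm_mult)
qed

subsection \<open>Densities on the Fourier side\<close>

lemma inverse_fourier_fourier:
  fixes \<psi> :: "real^'n::finite \<Rightarrow> complex"
  assumes "\<psi> \<in> schwartz"
  shows "inverse_fourier (fourier \<psi>) = \<psi>"
  using inversion_const_pos[where 'n = 'n]
  by (simp add: inverse_fourier_def[abs_def] fourier_inversion[OF assms])

lemma inverse_fourier_partial_deriv:
  assumes "\<phi> \<in> schwartz"
  shows "inverse_fourier (partial_deriv j \<phi>) \<xi> = - \<i> * of_real (\<xi> $ j) * inverse_fourier \<phi> \<xi>"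
  by (simp add: inverse_fourier_def fourier_partial_deriv[OF assms])

lemma L2_norm_inverse_fourier:
  fixes \<phi> :: "real^'n::finite \<Rightarrow> complex"
  assumes S: "\<phi> \<in> schwartz"
  shows "L2_norm (inverse_fourier \<phi>) = sqrt (1 / inversion_const TYPE('n)) * L2_norm \<phi>"
proof -
  let ?c = "inversion_const TYPE('n)"
  have c: "?c > 0" by (rule inversion_const_pos)
  have "?c * (LINT x|lborel. (norm (inverse_fourier \<phi> x))\<^sup>2) = (LINT x|lborel. (norm (\<phi> x))\<^sup>2)"
    using plancherel[OF schwartz_inverse_fourier[OF S]] by (simp only: fourier_inverse_fourier[OF S])
  then have "(LINT x|lborel. (norm (inverse_fourier \<phi> x))\<^sup>2) = (1 / ?c) * (LINT x|lborel. (norm (\<phi> x))\<^sup>2)"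
    using c by (simp add: field_simps)
  then show ?thesis unfolding L2_norm_def by (simp only: real_sqrt_mult)
qed

lemma inverse_fourier_borel: "\<phi> \<in> borel_measurable borel \<Longrightarrow> inverse_fourier \<phi> \<in> borel_measurable borel"
proof -
  assume "\<phi> \<in> borel_measurable borel"
  from fourier_borel[OF this] have [measurable]: "fourier \<phi> \<in> borel_measurable borel" .
  show ?thesis unfolding inverse_fourier_def[abs_def] by measurable
qed

lemma inverse_fourier_swap:
  fixes a b :: "real^'n::finite \<Rightarrow> complex"
  assumes [measurable]: "a \<in> borel_measurable borel" "b \<in> borel_measurable borel"
    and int: "integrable lborel a" "integrable lborel b"
  shows "(LINT \<xi>|lborel. inverse_fourier a \<xi> * b \<xi>) = (LINT x|lborel. a x * inverse_fourier b x)"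
proof -
  let ?c = "complex_of_real (1 / inversion_const TYPE('n))"
  have [measurable]: "fourier a \<in> borel_measurable borel" by (rule fourier_borel) fact
  have m: "(\<lambda>x. fourier a x * b (- x)) \<in> borel_measurable borel" by measurable
  have mb: "(\<lambda>x. b (- x)) \<in> borel_measurable borel" by measurable
  have "(LINT \<xi>|lborel. inverse_fourier a \<xi> * b \<xi>) = ?c * (LINT \<xi>|lborel. fourier a (- \<xi>) * b (- (- \<xi>)))"
    by (simp only: inverse_fourier_def mult.assoc integral_mult_right_zero minus_minus)
  also have "(LINT \<xi>|lborel. fourier a (- \<xi>) * b (- (- \<xi>))) = (LINT \<xi>|lborel. fourier a \<xi> * b (- \<xi>))"
    by (rule lborel_integral_uminus[OF m])
  also have "\<dots> = (LINT x|lborel. a x * fourier (\<lambda>x. b (- x)) x)"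
    by (rule fourier_swap[OF assms(1) mb int(1) lborel_integrable_uminus[OF assms(2) int(2)]])
  also have "?c * \<dots> = (LINT x|lborel. a x * inverse_fourier b x)"
    by (simp only: inverse_fourier_def fourier_uminus[OF assms(2)] mult.left_commute[of _ ?c] integral_mult_right_zero)
  finally show ?thesis .
qed

text \<open>A polynomial weight makes pairings with Schwartz functions absolutely convergent. The
  exponent is existential because square-integrable functions, bounded functions and their
  coordinate multiples come with different ones.\<close>

definition tempered_density :: "(real^'n::finite \<Rightarrow> complex) \<Rightarrow> bool" where
  "tempered_density W \<longleftrightarrow> W \<in> borel_measurable borel \<and>
     (\<exists>m. integrable lborel (\<lambda>\<xi>. norm (W \<xi>) / (1 + norm \<xi>) ^ m))"

lemma tempered_density_borel: "tempered_density W \<Longrightarrow> W \<in> borel_measurable borel"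
  by (simp add: tempered_density_def)

lemma tempered_density_weaken:
  fixes W :: "real^'n::finite \<Rightarrow> complex"
  assumes [measurable]: "W \<in> borel_measurable borel" and int: "integrable lborel (\<lambda>\<xi>. norm (W \<xi>) / (1 + norm \<xi>) ^ m)" and "m \<le> l"
  shows "integrable lborel (\<lambda>\<xi>. norm (W \<xi>) / (1 + norm \<xi>) ^ l)"
proof (rule Bochner_Integration.integrable_bound[OF int])
  show "AE \<xi> in lborel. norm (norm (W \<xi>) / (1 + norm \<xi>) ^ l) \<le> norm (norm (W \<xi>) / (1 + norm \<xi>) ^ m)"
  proof (rule AE_I2)
    fix \<xi> :: "real^'n"
    have "(1 + norm \<xi>) ^ m \<le> (1 + norm \<xi>) ^ l" using assms(3) by (intro power_increasing) auto
    then have "norm (W \<xi>) / (1 + norm \<xi>) ^ l \<le> norm (W \<xi>) / (1 + norm \<xi>) ^ m"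
      by (intro divide_left_mono mult_pos_pos zero_less_power) (auto simp: add_pos_nonneg)
    then show "norm (norm (W \<xi>) / (1 + norm \<xi>) ^ l) \<le> norm (norm (W \<xi>) / (1 + norm \<xi>) ^ m)"
      by (simp add: norm_divide norm_power)
  qed
qed measurable

lemma tempered_density_add:
  fixes V W :: "real^'n::finite \<Rightarrow> complex"
  assumes "tempered_density V" "tempered_density W"
  shows "tempered_density (\<lambda>\<xi>. V \<xi> + W \<xi>)"
proof -
  have m[measurable]: "V \<in> borel_measurable borel" "W \<in> borel_measurable borel" using assms by (auto simp: tempered_density_def)
  obtain k l where "integrable lborel (\<lambda>\<xi>. norm (V \<xi>) / (1 + norm \<xi>) ^ k)" "integrable lborel (\<lambda>\<xi>. norm (W \<xi>) / (1 + norm \<xi>) ^ l)"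
    using assms unfolding tempered_density_def by (elim conjE exE)
  from tempered_density_weaken[OF m(1) this(1), of "k + l"] tempered_density_weaken[OF m(2) this(2), of "k + l"]
  have "integrable lborel (\<lambda>\<xi>. norm (V \<xi>) / (1 + norm \<xi>) ^ (k + l) + norm (W \<xi>) / (1 + norm \<xi>) ^ (k + l))"
    by (intro Bochner_Integration.integrable_add) simp_all
  then have "integrable lborel (\<lambda>\<xi>. norm (V \<xi> + W \<xi>) / (1 + norm \<xi>) ^ (k + l))"
  proof (rule Bochner_Integration.integrable_bound)
    show "AE \<xi> in lborel. norm (norm (V \<xi> + W \<xi>) / (1 + norm \<xi>) ^ (k + l)) \<le> norm (norm (V \<xi>) / (1 + norm \<xi>) ^ (k + l) + norm (W \<xi>) / (1 + norm \<xi>) ^ (k + l))"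
      by (rule AE_I2) (simp add: norm_divide norm_power add_divide_distrib[symmetric] divide_right_mono norm_triangle_ineq)
  qed measurable
  then show ?thesis unfolding tempered_density_def by (intro conjI exI[of _ "k + l"]) simp_all
qed

lemma tempered_density_cmult:
  assumes "tempered_density W"
  shows "tempered_density (\<lambda>\<xi>. c * W \<xi>)"
proof -
  have m[measurable]: "W \<in> borel_measurable borel" using assms by (auto simp: tempered_density_def)
  obtain k where "integrable lborel (\<lambda>\<xi>. norm (W \<xi>) / (1 + norm \<xi>) ^ k)"
    using assms unfolding tempered_density_def by (elim conjE exE)
  then have "integrable lborel (\<lambda>\<xi>. norm c * (norm (W \<xi>) / (1 + norm \<xi>) ^ k))" by (rule integrable_mult_right)
  then show ?thesis unfolding tempered_density_def by (intro conjI exI[of _ k]) (simp_all add: norm_mult)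
qed

lemma tempered_density_0: "tempered_density (\<lambda>\<xi>. 0)"
  by (auto simp: tempered_density_def)

lemma tempered_density_sum:
  "finite I \<Longrightarrow> (\<And>i. i \<in> I \<Longrightarrow> tempered_density (W i)) \<Longrightarrow> tempered_density (\<lambda>\<xi>. \<Sum>i\<in>I. W i \<xi>)"
  by (induction I rule: finite_induct) (auto intro: tempered_density_0 tempered_density_add)

lemma tempered_density_coord_mult:
  fixes W :: "real^'n::finite \<Rightarrow> complex"
  assumes "tempered_density W"
  shows "tempered_density (\<lambda>\<xi>. of_real (\<xi> $ j) * W \<xi>)"
proof -
  have m[measurable]: "W \<in> borel_measurable borel" using assms by (auto simp: tempered_density_def)
  obtain k where k: "integrable lborel (\<lambda>\<xi>. norm (W \<xi>) / (1 + norm \<xi>) ^ k)"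
    using assms unfolding tempered_density_def by (elim conjE exE)
  have "integrable lborel (\<lambda>\<xi>. norm (of_real (\<xi> $ j) * W \<xi>) / (1 + norm \<xi>) ^ Suc k)"
  proof (rule Bochner_Integration.integrable_bound[OF k])
    show "AE \<xi> in lborel. norm (norm (of_real (\<xi> $ j) * W \<xi>) / (1 + norm \<xi>) ^ Suc k) \<le> norm (norm (W \<xi>) / (1 + norm \<xi>) ^ k)"
    proof (rule AE_I2)
      fix \<xi> :: "real^'n"
      have "norm (of_real (\<xi> $ j) * W \<xi>) \<le> (1 + norm \<xi>) * norm (W \<xi>)"
        unfolding norm_mult using component_le_norm_cart[of \<xi> j] by (intro mult_right_mono) auto
      then have "norm (of_real (\<xi> $ j) * W \<xi>) / (1 + norm \<xi>) ^ Suc k \<le> (1 + norm \<xi>) * norm (W \<xi>) / (1 + norm \<xi>) ^ Suc k"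
        by (intro divide_right_mono) auto
      also have "\<dots> = norm (W \<xi>) / (1 + norm \<xi>) ^ k"
        using norm_ge_zero[of \<xi>] by (simp add: add_nonneg_eq_0_iff)
      finally show "norm (norm (of_real (\<xi> $ j) * W \<xi>) / (1 + norm \<xi>) ^ Suc k) \<le> norm (norm (W \<xi>) / (1 + norm \<xi>) ^ k)"
        by (simp only: norm_weighted)
    qed
  qed measurable
  then show ?thesis unfolding tempered_density_def by (intro conjI exI[of _ "Suc k"]) simp_all
qed

lemma tempered_density_bounded:
  fixes W :: "real^'n::finite \<Rightarrow> complex"
  assumes [measurable]: "W \<in> borel_measurable borel" and "\<And>\<xi>. norm (W \<xi>) \<le> B"
  shows "tempered_density W"
proof -
  have "integrable lborel (\<lambda>\<xi>. norm (W \<xi>) / (1 + norm \<xi>) ^ (CARD('n) + 1))"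
  proof (rule decay_integrable)
    show "(1 + norm x) ^ (CARD('n) + 1) * norm (norm (W x) / (1 + norm x) ^ (CARD('n) + 1)) \<le> B" for x
    proof -
      show ?thesis unfolding norm_weighted using assms(2)[of x] by simp
    qed
  qed measurable
  then show ?thesis unfolding tempered_density_def using assms(1) by blast
qed

lemma L2_tempered_density:
  fixes W :: "real^'n::finite \<Rightarrow> complex"
  assumes "L2 W"
  shows "tempered_density W"
proof -
  have m[measurable]: "W \<in> borel_measurable borel" using assms by (rule L2_borel)
  let ?d = "CARD('n) + 1"
  have "integrable lborel (\<lambda>\<xi>::real^'n. 1 / (1 + norm \<xi>) ^ (DIM(real^'n) + 1))"
    by (rule integrable_inverse_power_norm)
  then have i: "integrable lborel (\<lambda>\<xi>. (norm (W \<xi>))\<^sup>2 + 1 / (1 + norm \<xi>) ^ ?d)"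
    using assms by (intro Bochner_Integration.integrable_add) (simp_all add: L2_def)
  have "integrable lborel (\<lambda>\<xi>. norm (W \<xi>) / (1 + norm \<xi>) ^ ?d)"
  proof (rule Bochner_Integration.integrable_bound[OF i])
    show "AE \<xi> in lborel. norm (norm (W \<xi>) / (1 + norm \<xi>) ^ ?d) \<le> norm ((norm (W \<xi>))\<^sup>2 + 1 / (1 + norm \<xi>) ^ ?d)"
    proof (rule AE_I2)
      fix \<xi> :: "real^'n"
      define v where "v = 1 / (1 + norm \<xi>) ^ ?d"
      have "1 \<le> (1 + norm \<xi>) ^ ?d" by (intro one_le_power) simp
      then have v: "v \<le> 1" unfolding v_def by (subst pos_divide_le_eq[OF weight_pos(3)]) simp
      have v0: "0 \<le> v" unfolding v_def by (intro divide_nonneg_pos weight_pos) simp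
      note v = v0 v
      have "norm (of_real (norm (W \<xi>)) * of_real v :: complex) \<le> (norm (of_real (norm (W \<xi>)) :: complex))\<^sup>2 + (norm (of_real v :: complex))\<^sup>2"
        by (rule norm_mult_le_squares)
      then have "norm (W \<xi>) * v \<le> (norm (W \<xi>))\<^sup>2 + v\<^sup>2" using v by (simp add: norm_mult)
      moreover have "v\<^sup>2 \<le> v" using v by (simp add: power2_eq_square mult_left_le)
      ultimately have le: "norm (W \<xi>) * v \<le> (norm (W \<xi>))\<^sup>2 + v" by linarith
      have "norm (W \<xi>) / (1 + norm \<xi>) ^ ?d = norm (W \<xi>) * v" by (simp add: v_def)
      then show "norm (norm (W \<xi>) / (1 + norm \<xi>) ^ ?d) \<le> norm ((norm (W \<xi>))\<^sup>2 + 1 / (1 + norm \<xi>) ^ ?d)"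
        using le v unfolding norm_weighted v_def[symmetric] by simp
    qed
  qed measurable
  then show ?thesis unfolding tempered_density_def using m by blast
qed

lemma tempered_density_mult_schwartz:
  fixes W :: "real^'n::finite \<Rightarrow> complex"
  assumes "tempered_density W" and S: "\<psi> \<in> schwartz"
  shows "integrable lborel (\<lambda>\<xi>. W \<xi> * \<psi> \<xi>)"
proof -
  have m[measurable]: "W \<in> borel_measurable borel" "\<psi> \<in> borel_measurable borel"
    using assms by (auto simp: tempered_density_def intro: schwartz_borel)
  obtain k where k: "integrable lborel (\<lambda>\<xi>. norm (W \<xi>) / (1 + norm \<xi>) ^ k)"
    using assms unfolding tempered_density_def by (elim conjE exE)
  obtain B where B: "\<And>x. (1 + norm x) ^ k * norm (\<psi> x) \<le> B" using schwartz_bound[OF S] by metis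
  from k have "integrable lborel (\<lambda>\<xi>. B * (norm (W \<xi>) / (1 + norm \<xi>) ^ k))" by (rule integrable_mult_right)
  then show ?thesis
  proof (rule Bochner_Integration.integrable_bound)
    show "AE \<xi> in lborel. norm (W \<xi> * \<psi> \<xi>) \<le> norm (B * (norm (W \<xi>) / (1 + norm \<xi>) ^ k))"
    proof (rule AE_I2)
      fix \<xi> :: "real^'n"
      have "(1 + norm \<xi>) ^ k > 0" by (intro zero_less_power) (simp add: add_pos_nonneg)
      then have "norm (W \<xi> * \<psi> \<xi>) = ((1 + norm \<xi>) ^ k * norm (\<psi> \<xi>)) * (norm (W \<xi>) / (1 + norm \<xi>) ^ k)"
        by (simp add: norm_mult)
      also have "\<dots> \<le> B * (norm (W \<xi>) / (1 + norm \<xi>) ^ k)"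
        using B by (intro mult_right_mono) auto
      also have "\<dots> \<le> norm \<dots>" by (simp only: real_norm_def abs_ge_self)
      finally show "norm (W \<xi> * \<psi> \<xi>) \<le> norm (B * (norm (W \<xi>) / (1 + norm \<xi>) ^ k))" .
    qed
  qed measurable
qed

lemma tempered_density_null:
  fixes W :: "real^'n::finite \<Rightarrow> complex"
  assumes "tempered_density W" and n: "schwartz_null \<Phi>"
  shows "(\<lambda>n. LINT \<xi>|lborel. W \<xi> * \<Phi> n \<xi>) \<longlonglongrightarrow> 0"
proof -
  obtain k where k: "integrable lborel (\<lambda>\<xi>. norm (W \<xi>) / (1 + norm \<xi>) ^ k)"
    using assms unfolding tempered_density_def by (elim conjE exE)
  define I where "I = (LINT \<xi>|lborel. norm (W \<xi>) / (1 + norm \<xi>) ^ k)"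
  have I: "0 \<le> I" unfolding I_def by (intro Bochner_Integration.integral_nonneg) auto
  have S: "\<Phi> n \<in> schwartz" for n using n by (simp add: schwartz_null_def)
  show ?thesis
  proof (rule tendstoI)
    fix e :: real assume e: "e > 0"
    \<comment> \<open>The factor 2 makes the final inequality strict, and \<open>I + 1\<close>
      avoids a division by zero.\<close>
    define d where "d = e / (2 * (I + 1))"
    have d: "d > 0" unfolding d_def using e I by (intro divide_pos_pos) auto
    have dI: "d * I < e"
    proof -
      have "d * I \<le> d * (I + 1)" using d by simp
      also have "\<dots> = e / 2" unfolding d_def using I by (simp add: field_simps)
      also have "\<dots> < e" using e by simp
      finally show ?thesis .
    qed
    from schwartz_null_bound[OF n d, of k]
    show "\<forall>\<^sub>F n in sequentially. dist (LINT \<xi>|lborel. W \<xi> * \<Phi> n \<xi>) 0 < e"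
    proof eventually_elim
      case (elim n)
      have "norm (LINT \<xi>|lborel. W \<xi> * \<Phi> n \<xi>) \<le> (LINT \<xi>|lborel. norm (W \<xi> * \<Phi> n \<xi>))"
        by (rule integral_norm_bound)
      also have "\<dots> \<le> (LINT \<xi>|lborel. d * (norm (W \<xi>) / (1 + norm \<xi>) ^ k))"
      proof (intro integral_mono integrable_norm tempered_density_mult_schwartz assms S integrable_mult_right k)
        fix \<xi> :: "real^'n"
        have "(1 + norm \<xi>) ^ k > 0" by (intro zero_less_power) (simp add: add_pos_nonneg)
        then have "norm (W \<xi> * \<Phi> n \<xi>) = ((1 + norm \<xi>) ^ k * norm (\<Phi> n \<xi>)) * (norm (W \<xi>) / (1 + norm \<xi>) ^ k)"
          by (simp add: norm_mult)
        also have "\<dots> \<le> d * (norm (W \<xi>) / (1 + norm \<xi>) ^ k)"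
          using elim by (intro mult_right_mono) auto
        finally show "norm (W \<xi> * \<Phi> n \<xi>) \<le> d * (norm (W \<xi>) / (1 + norm \<xi>) ^ k)" .
      qed
      also have "\<dots> = d * I" unfolding I_def by (rule integral_mult_right_zero)
      finally show ?case using dI unfolding dist_norm diff_zero by linarith
    qed
  qed
qed

lemma tempered_density_loc_integrable:
  fixes W :: "real^'n::finite \<Rightarrow> complex"
  assumes "tempered_density W"
  shows "loc_integrable W"
  unfolding loc_integrable_def
proof (intro conjI allI)
  show m[measurable]: "W \<in> borel_measurable borel" using assms by (rule tempered_density_borel)
  fix R
  have [measurable]: "cball (0::real^'n) R \<in> sets borel" by simp
  obtain k where k: "integrable lborel (\<lambda>\<xi>. norm (W \<xi>) / (1 + norm \<xi>) ^ k)"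
    using assms unfolding tempered_density_def by (elim conjE exE)
  from k have "integrable lborel (\<lambda>\<xi>. (1 + R) ^ k * (norm (W \<xi>) / (1 + norm \<xi>) ^ k))" by (rule integrable_mult_right)
  then show "integrable lborel (\<lambda>\<xi>. indicator (cball 0 R) \<xi> *\<^sub>R norm (W \<xi>))"
  proof (rule Bochner_Integration.integrable_bound)
    show "AE \<xi> in lborel. norm (indicator (cball 0 R) \<xi> *\<^sub>R norm (W \<xi>)) \<le> norm ((1 + R) ^ k * (norm (W \<xi>) / (1 + norm \<xi>) ^ k))"
    proof (rule AE_I2)
      fix \<xi> :: "real^'n"
      show "norm (indicator (cball 0 R) \<xi> *\<^sub>R norm (W \<xi>)) \<le> norm ((1 + R) ^ k * (norm (W \<xi>) / (1 + norm \<xi>) ^ k))"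
      proof (cases "norm \<xi> \<le> R")
        case True
        have p: "(1 + norm \<xi>) ^ k > 0" by (intro zero_less_power) (simp add: add_pos_nonneg)
        have "(1 + norm \<xi>) ^ k \<le> (1 + R) ^ k" using True by (intro power_mono) auto
        then have "(1 + norm \<xi>) ^ k * (norm (W \<xi>) / (1 + norm \<xi>) ^ k) \<le> (1 + R) ^ k * (norm (W \<xi>) / (1 + norm \<xi>) ^ k)"
          using p by (intro mult_right_mono) auto
        moreover have "(1 + norm \<xi>) ^ k * (norm (W \<xi>) / (1 + norm \<xi>) ^ k) = norm (W \<xi>)" by simp
        ultimately have "norm (W \<xi>) \<le> (1 + R) ^ k * (norm (W \<xi>) / (1 + norm \<xi>) ^ k)" by (simp only:)
        also have "\<dots> \<le> norm \<dots>" by (simp only: real_norm_def abs_ge_self)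
        finally show ?thesis using True by simp
      qed simp
    qed
  qed measurable
qed

text \<open>The inverse Fourier transforms of test functions are dense in the Schwartz space.\<close>

lemma tempered_density_zero:
  fixes W :: "real^'n::finite \<Rightarrow> complex"
  assumes W: "tempered_density W"
    and z: "\<And>\<phi>. \<phi> \<in> test_functions \<Longrightarrow> (LINT \<xi>|lborel. W \<xi> * inverse_fourier \<phi> \<xi>) = 0"
  shows "AE \<xi> in lborel. W \<xi> = 0"
proof (rule orthogonal_test_functions_zero[OF tempered_density_loc_integrable[OF W]])
  fix \<psi> :: "real^'n \<Rightarrow> complex" assume "\<psi> \<in> test_functions"
  then have S: "\<psi> \<in> schwartz" by (rule test_schwartz)
  \<comment> \<open>\<open>\<psi>\<close> is the inverse transform of this \<open>\<phi>\<close>,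
    which need not have compact support. Its cut-offs \<open>\<theta> n\<close> do, so the
    hypothesis applies to them.\<close>
  define \<phi> where "\<phi> = fourier \<psi>"
  have F: "\<phi> \<in> schwartz" unfolding \<phi>_def by (rule schwartz_fourier[OF S])
  define \<theta> where "\<theta> n x = bump (dilation n *\<^sub>R x) * \<phi> x" for n x
  have \<theta>: "\<theta> n \<in> test_functions" for n unfolding \<theta>_def by (rule bump_cutoff_test[OF F])
  have "schwartz_null (\<lambda>n x. \<theta> n x - \<phi> x)"
    using bump_cutoff_null[OF F] by (simp add: \<theta>_def left_diff_distrib)
  from schwartz_null_fourier[OF this]
  have nf: "schwartz_null (\<lambda>n. fourier (\<lambda>x. \<theta> n x - \<phi> x))" .
  define \<Phi> where "\<Phi> n = inverse_fourier (\<lambda>x. \<theta> n x - \<phi> x)" for n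
  have "\<Phi> n = (\<lambda>\<xi>. inverse_fourier (\<theta> n) \<xi> - \<psi> \<xi>)" for n
  proof -
    have "\<Phi> n \<xi> = inverse_fourier (\<theta> n) \<xi> - inverse_fourier \<phi> \<xi>" for \<xi>
      unfolding \<Phi>_def inverse_fourier_def fourier_diff[OF test_schwartz[OF \<theta>] F] by (simp add: right_diff_distrib)
    then show ?thesis unfolding \<phi>_def inverse_fourier_fourier[OF S] by blast
  qed
  \<comment> \<open>The reflection inside \<open>inverse_fourier\<close> is moved onto
    \<open>W\<close>, since convergence is known for \<open>fourier\<close>.\<close>
  moreover have "(\<lambda>n. LINT \<xi>|lborel. W (- \<xi>) * (of_real (1 / inversion_const TYPE('n)) * fourier (\<lambda>x. \<theta> n x - \<phi> x) \<xi>)) \<longlonglongrightarrow> 0"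
  proof (rule tempered_density_null)
    have m: "(\<lambda>\<xi>. norm (W \<xi>) / (1 + norm \<xi>) ^ k) \<in> borel_measurable borel" for k
    proof -
      have [measurable]: "W \<in> borel_measurable borel" using W by (rule tempered_density_borel)
      show ?thesis by measurable
    qed
    obtain k where "integrable lborel (\<lambda>\<xi>. norm (W \<xi>) / (1 + norm \<xi>) ^ k)"
      using W unfolding tempered_density_def by (elim conjE exE)
    from lborel_integrable_uminus[OF m this] tempered_density_borel[OF W]
    show "tempered_density (\<lambda>\<xi>. W (- \<xi>))"
      unfolding tempered_density_def by (intro conjI exI[of _ k]) simp_all
    show "schwartz_null (\<lambda>n \<xi>. of_real (1 / inversion_const TYPE('n)) * fourier (\<lambda>x. \<theta> n x - \<phi> x) \<xi>)"
      by (rule schwartz_null_cmult[OF nf])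
  qed
  moreover have "(LINT \<xi>|lborel. W (- \<xi>) * (of_real (1 / inversion_const TYPE('n)) * fourier (\<lambda>x. \<theta> n x - \<phi> x) \<xi>)) = (LINT \<xi>|lborel. W \<xi> * \<Phi> n \<xi>)" for n
  proof -
    have [measurable]: "W \<in> borel_measurable borel" using W by (rule tempered_density_borel)
    have [measurable]: "\<Phi> n \<in> borel_measurable borel"
      unfolding \<Phi>_def by (intro schwartz_borel schwartz_inverse_fourier schwartz_diff test_schwartz \<theta> F)
    have "(\<lambda>\<xi>. W \<xi> * \<Phi> n \<xi>) \<in> borel_measurable borel" by measurable
    from lborel_integral_uminus[OF this] show ?thesis by (simp add: \<Phi>_def inverse_fourier_def)
  qed
  ultimately have "(\<lambda>n. LINT \<xi>|lborel. W \<xi> * (inverse_fourier (\<theta> n) \<xi> - \<psi> \<xi>)) \<longlonglongrightarrow> 0"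
    by simp
  moreover have "(LINT \<xi>|lborel. W \<xi> * (inverse_fourier (\<theta> n) \<xi> - \<psi> \<xi>)) = - (LINT \<xi>|lborel. W \<xi> * \<psi> \<xi>)" for n
    using tempered_density_mult_schwartz[OF W S] tempered_density_mult_schwartz[OF W schwartz_inverse_fourier[OF test_schwartz[OF \<theta>[of n]]]]
      z[OF \<theta>[of n]]
    by (simp add: right_diff_distrib)
  ultimately show "(LINT \<xi>|lborel. W \<xi> * \<psi> \<xi>) = 0"
    by (simp add: LIMSEQ_const_iff)
qed

subsection \<open>Borel representatives\<close>

lemma lebesgue_measurable_borel_version:
  fixes f :: "'a::euclidean_space \<Rightarrow> complex"
  assumes "f \<in> borel_measurable lebesgue"
  obtains g where "g \<in> borel_measurable borel" "AE x in lebesgue. f x = g x"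
proof -
  have "(\<lambda>x. Re (f x)) \<in> borel_measurable lebesgue" "(\<lambda>x. Im (f x)) \<in> borel_measurable lebesgue"
    using assms by measurable
  from this[THEN completion_ex_borel_measurable_real]
  obtain u v where [measurable]: "u \<in> borel_measurable lborel" "v \<in> borel_measurable lborel"
    and uv: "AE x in lborel. Re (f x) = u x" "AE x in lborel. Im (f x) = v x" by blast
  show ?thesis
  proof (rule that[of "\<lambda>x. of_real (u x) + \<i> * of_real (v x)"])
    show "(\<lambda>x. of_real (u x) + \<i> * of_real (v x)) \<in> borel_measurable borel"
      using \<open>u \<in> _\<close> \<open>v \<in> _\<close> by simp
    have "AE x in lborel. f x = of_real (u x) + \<i> * of_real (v x)"
      using uv by eventually_elim (simp add: complex_eq_iff)
    then show "AE x in lebesgue. f x = of_real (u x) + \<i> * of_real (v x)"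
      by (rule AE_completion)
  qed
qed

lemma AE_lebesgue_integrable_iff:
  fixes f g :: "'a::euclidean_space \<Rightarrow> real"
  assumes "f \<in> borel_measurable lebesgue" and g: "g \<in> borel_measurable borel" and "AE x in lebesgue. f x = g x"
  shows "integrable lebesgue f \<longleftrightarrow> integrable lborel g"
proof -
  have m: "g \<in> borel_measurable lebesgue" using g by (intro measurable_completion) simp
  have "integrable lebesgue f \<longleftrightarrow> integrable lebesgue g"
    by (rule integrable_cong_AE) (use assms m in auto)
  also have "\<dots> \<longleftrightarrow> integrable lborel g" by (rule integrable_completion) (use g in simp)
  finally show ?thesis .
qed

text \<open>The definitions use Lebesgue measurable representatives, whereas reflections,
  convolutions and product integrals take place in \<open>lborel\<close>. The passage is made here,
  at the price of equality almost everywhere.\<close>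

lemma represented_by_borel_version:
  fixes T :: "'n::finite functional"
  assumes "represented_by T f"
  obtains g where "loc_integrable g" "AE x in lebesgue. f x = g x"
    "\<forall>\<phi>\<in>test_functions. T \<phi> = (LINT x|lborel. g x * \<phi> x)"
proof -
  have m: "f \<in> borel_measurable lebesgue"
    and int: "\<And>K. compact K \<Longrightarrow> set_integrable lebesgue K (\<lambda>x. norm (f x) powr 1)"
    and T: "\<And>\<phi>. \<phi> \<in> test_functions \<Longrightarrow> T \<phi> = (LINT x|lebesgue. f x * \<phi> x)"
    using assms unfolding represented_by_def locally_Lp_def by auto
  obtain g where g[measurable]: "g \<in> borel_measurable borel" and ae: "AE x in lebesgue. f x = g x"
    by (rule lebesgue_measurable_borel_version[OF m])
  note [measurable] = m
  show ?thesis
  proof (rule that[OF _ ae])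
    show "loc_integrable g"
      unfolding loc_integrable_def
    proof (intro conjI allI g)
      fix R
      have [measurable]: "cball (0::real^'n) R \<in> sets borel" "cball (0::real^'n) R \<in> sets lebesgue" by simp_all
      have "integrable lebesgue (\<lambda>x. indicat_real (cball 0 R) x *\<^sub>R (norm (f x) powr 1))"
        using int[OF compact_cball] by (simp add: set_integrable_def)
      then show "integrable lborel (\<lambda>x. indicator (cball 0 R) x *\<^sub>R norm (g x))"
      proof (rule AE_lebesgue_integrable_iff[THEN iffD1, rotated 3])
        show "AE x in lebesgue. indicat_real (cball 0 R) x *\<^sub>R (norm (f x) powr 1) = indicat_real (cball 0 R) x *\<^sub>R norm (g x)"
          using ae by eventually_elim simp
      qed measurable
    qed
    show "\<forall>\<phi>\<in>test_functions. T \<phi> = (LINT x|lborel. g x * \<phi> x)"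
    proof
      fix \<phi> :: "real^'n \<Rightarrow> complex" assume \<phi>: "\<phi> \<in> test_functions"
      have b[measurable]: "\<phi> \<in> borel_measurable borel" by (intro smooth_borel test_functions_smooth \<phi>)
      have [measurable]: "\<phi> \<in> borel_measurable lebesgue" "g \<in> borel_measurable lebesgue"
        by (intro measurable_completion; simp)+
      have "T \<phi> = (LINT x|lebesgue. g x * \<phi> x)"
        unfolding T[OF \<phi>]
      proof (rule integral_cong_AE)
        show "AE x in lebesgue. f x * \<phi> x = g x * \<phi> x" using ae by eventually_elim simp
      qed measurable
      also have "\<dots> = (LINT x|lborel. g x * \<phi> x)" by (rule integral_completion) measurable
      finally show "T \<phi> = (LINT x|lborel. g x * \<phi> x)" .
    qed
  qed
qed

subsection \<open>Distributions given by a density on the Fourier side\<close>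

text \<open>\<open>W\<close> is the Fourier transform of \<open>T\<close>, tested through
  \<open>inverse_fourier\<close>. The condition is confined to test functions because products and
  the equation are known only there, so the notion also applies to functionals not known to be
  tempered.\<close>

definition has_spectrum :: "'n::finite functional \<Rightarrow> (real^'n \<Rightarrow> complex) \<Rightarrow> bool" where
  "has_spectrum T W \<longleftrightarrow> tempered_density W \<and>
     (\<forall>\<phi>\<in>test_functions. T \<phi> = (LINT \<xi>|lborel. W \<xi> * inverse_fourier \<phi> \<xi>))"

lemma has_spectrum_integrable:
  "has_spectrum T W \<Longrightarrow> \<phi> \<in> test_functions \<Longrightarrow> integrable lborel (\<lambda>\<xi>. W \<xi> * inverse_fourier \<phi> \<xi>)"
  unfolding has_spectrum_def
  by (intro tempered_density_mult_schwartz schwartz_inverse_fourier test_schwartz) auto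

lemma has_spectrum_distr_deriv:
  assumes "has_spectrum T W"
  shows "has_spectrum (distr_deriv j T) (\<lambda>\<xi>. \<i> * (of_real (\<xi> $ j) * W \<xi>))"
  unfolding has_spectrum_def
proof (intro conjI ballI)
  have W: "tempered_density W" and T: "\<And>\<phi>. \<phi> \<in> test_functions \<Longrightarrow> T \<phi> = (LINT \<xi>|lborel. W \<xi> * inverse_fourier \<phi> \<xi>)"
    using assms by (auto simp: has_spectrum_def)
  show "tempered_density (\<lambda>\<xi>. \<i> * (of_real (\<xi> $ j) * W \<xi>))"
    by (intro tempered_density_cmult tempered_density_coord_mult W)
  fix \<phi> :: "real^'a \<Rightarrow> complex" assume \<phi>: "\<phi> \<in> test_functions"
  have "distr_deriv j T \<phi> = (LINT \<xi>|lborel. (- 1) * (W \<xi> * inverse_fourier (partial_deriv j \<phi>) \<xi>))"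
    unfolding distr_deriv_def T[OF test_partial_deriv[OF \<phi>]] integral_mult_right_zero by simp
  also have "\<dots> = (LINT \<xi>|lborel. \<i> * (of_real (\<xi> $ j) * W \<xi>) * inverse_fourier \<phi> \<xi>)"
    unfolding inverse_fourier_partial_deriv[OF test_schwartz[OF \<phi>]] by (simp add: algebra_simps)
  finally show "distr_deriv j T \<phi> = (LINT \<xi>|lborel. \<i> * (of_real (\<xi> $ j) * W \<xi>) * inverse_fourier \<phi> \<xi>)" .
qed

lemma has_spectrum_sum:
  fixes T :: "'i \<Rightarrow> 'n::finite functional"
  assumes "finite I" "\<And>i. i \<in> I \<Longrightarrow> has_spectrum (T i) (W i)"
  shows "has_spectrum (\<lambda>\<phi>. \<Sum>i\<in>I. T i \<phi>) (\<lambda>\<xi>. \<Sum>i\<in>I. W i \<xi>)"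
  unfolding has_spectrum_def
proof (intro conjI ballI)
  show "tempered_density (\<lambda>\<xi>. \<Sum>i\<in>I. W i \<xi>)"
    using assms by (intro tempered_density_sum) (auto simp: has_spectrum_def)
  fix \<phi> :: "real^'n \<Rightarrow> complex" assume \<phi>: "\<phi> \<in> test_functions"
  have "(\<Sum>i\<in>I. T i \<phi>) = (\<Sum>i\<in>I. (LINT \<xi>|lborel. W i \<xi> * inverse_fourier \<phi> \<xi>))"
    using assms \<phi> by (intro sum.cong) (auto simp: has_spectrum_def)
  also have "\<dots> = (LINT \<xi>|lborel. (\<Sum>i\<in>I. W i \<xi> * inverse_fourier \<phi> \<xi>))"
    by (rule Bochner_Integration.integral_sum[symmetric]) (intro has_spectrum_integrable[OF assms(2)] \<phi>)
  finally show "(\<Sum>i\<in>I. T i \<phi>) = (LINT \<xi>|lborel. (\<Sum>i\<in>I. W i \<xi>) * inverse_fourier \<phi> \<xi>)"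
    by (simp only: sum_distrib_right)
qed

lemma has_spectrum_add:
  assumes "has_spectrum S V" "has_spectrum T W"
  shows "has_spectrum (\<lambda>\<phi>. S \<phi> + T \<phi>) (\<lambda>\<xi>. V \<xi> + W \<xi>)"
  using assms has_spectrum_integrable[OF assms(1)] has_spectrum_integrable[OF assms(2)]
  unfolding has_spectrum_def by (simp add: tempered_density_add distrib_right)

lemma has_spectrum_uminus:
  assumes "has_spectrum T W"
  shows "has_spectrum (\<lambda>\<phi>. - T \<phi>) (\<lambda>\<xi>. - W \<xi>)"
  using assms tempered_density_cmult[of W "-1"] unfolding has_spectrum_def by simp

lemma has_spectrum_zero:
  assumes "has_spectrum T W" "\<And>\<phi>. \<phi> \<in> test_functions \<Longrightarrow> T \<phi> = 0"
  shows "AE \<xi> in lborel. W \<xi> = 0"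
  using assms unfolding has_spectrum_def by (intro tempered_density_zero) auto

subsection \<open>Approximation by truncating the density\<close>

text \<open>Removing high frequencies makes a square-integrable density integrable, so that its
  inverse transform is an absolutely convergent integral and the multiplication formula
  applies.\<close>

definition trunc :: "nat \<Rightarrow> (real^'n::finite \<Rightarrow> complex) \<Rightarrow> real^'n \<Rightarrow> complex" where
  "trunc n K \<xi> = of_real (indicat_real (cball 0 (real n)) \<xi>) * K \<xi>"

lemma norm_trunc_le: "norm (trunc n K \<xi>) \<le> norm (K \<xi>)"
  by (simp add: trunc_def indicator_def norm_mult)

lemma trunc_borel:
  fixes K :: "real^'n::finite \<Rightarrow> complex"
  assumes [measurable]: "K \<in> borel_measurable borel"
  shows "trunc n K \<in> borel_measurable borel"
proof -
  have [measurable]: "cball (0::real^'n) R \<in> sets borel" for R by simp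
  show ?thesis unfolding trunc_def[abs_def] by measurable
qed

lemma trunc_tendsto: "(\<lambda>n. trunc n K \<xi>) \<longlonglongrightarrow> K \<xi>"
proof (rule tendsto_eventually)
  obtain m where m: "norm \<xi> \<le> real m" using real_arch_simple by blast
  show "\<forall>\<^sub>F n in sequentially. trunc n K \<xi> = K \<xi>"
  proof (rule eventually_sequentiallyI[of m])
    fix n assume "m \<le> n"
    then have "norm \<xi> \<le> real n" using m by linarith
    then show "trunc n K \<xi> = K \<xi>" by (simp add: trunc_def)
  qed
qed

lemma trunc_integrable:
  fixes K :: "real^'n::finite \<Rightarrow> complex"
  assumes "L2 K"
  shows "integrable lborel (trunc n K)"
proof -
  have "integrable lborel (\<lambda>\<xi>. indicator (cball 0 (real n)) \<xi> *\<^sub>R norm (K \<xi>))"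
    using L2_loc_integrable[OF assms] unfolding loc_integrable_def by blast
  then show ?thesis
    by (rule Bochner_Integration.integrable_bound)
      (use trunc_borel[OF L2_borel[OF assms]] in \<open>auto simp: trunc_def norm_mult\<close>)
qed

lemma trunc_L2_tendsto:
  fixes K :: "real^'n::finite \<Rightarrow> complex"
  assumes "L2 K"
  shows "(\<lambda>n. L2_norm (\<lambda>\<xi>. K \<xi> - trunc n K \<xi>)) \<longlonglongrightarrow> 0"
proof -
  note [measurable] = L2_borel[OF assms] trunc_borel[OF L2_borel[OF assms]]
  have "(\<lambda>n. LINT \<xi>|lborel. (norm (K \<xi> - trunc n K \<xi>))\<^sup>2) \<longlonglongrightarrow> (LINT \<xi>|(lborel :: (real^'n) measure). (0::real))"
  proof (rule integral_dominated_convergence)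
    show "integrable lborel (\<lambda>\<xi>. (norm (K \<xi>))\<^sup>2)" using assms by (simp add: L2_def)
    show "AE \<xi> in lborel. norm ((norm (K \<xi> - trunc n K \<xi>))\<^sup>2) \<le> (norm (K \<xi>))\<^sup>2" for n
      by (rule AE_I2) (simp add: trunc_def indicator_def)
    show "AE \<xi> in lborel. (\<lambda>n. (norm (K \<xi> - trunc n K \<xi>))\<^sup>2) \<longlonglongrightarrow> 0"
    proof (rule AE_I2)
      fix \<xi>
      have "(\<lambda>n. (norm (K \<xi> - trunc n K \<xi>))\<^sup>2) \<longlonglongrightarrow> (norm (K \<xi> - K \<xi>))\<^sup>2"
        by (intro tendsto_intros trunc_tendsto)
      then show "(\<lambda>n. (norm (K \<xi> - trunc n K \<xi>))\<^sup>2) \<longlonglongrightarrow> 0" by simp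
    qed
  qed measurable
  from tendsto_real_sqrt[OF this] show ?thesis by (simp add: L2_norm_def)
qed

lemma inverse_fourier_bounded:
  fixes a :: "real^'n::finite \<Rightarrow> complex"
  assumes "a \<in> borel_measurable borel"
  shows "norm (inverse_fourier a \<xi>) \<le> 1 / inversion_const TYPE('n) * (LINT x|lborel. norm (a x))"
  unfolding inverse_fourier_def norm_mult norm_of_real
  using inversion_const_pos[where 'n = 'n] norm_fourier_le[OF assms, of "- \<xi>"]
  by (intro mult_mono) auto

text \<open>Plancherel is used for test functions only: it bounds their pairing with a density
  \<open>J\<close> by a multiple of \<open>L2_norm J\<close>, and duality turns this into an
  \<open>L2\<close> bound. For \<open>K\<close> this yields square integrability of
  \<open>f\<close>, for the difference of \<open>K\<close> and \<open>trunc n K\<close> it yields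
  convergence.\<close>

lemma L2_spectral_approx:
  fixes f K :: "real^'n::finite \<Rightarrow> complex"
  assumes f: "loc_integrable f" and K: "L2 K"
    and eq: "\<And>\<phi>. \<phi> \<in> test_functions \<Longrightarrow> (LINT x|lborel. f x * \<phi> x) = (LINT \<xi>|lborel. K \<xi> * inverse_fourier \<phi> \<xi>)"
  shows "L2 f" and "L2 (\<lambda>x. f x - inverse_fourier (trunc n K) x)"
    and "(\<lambda>n. L2_norm (\<lambda>x. f x - inverse_fourier (trunc n K) x)) \<longlonglongrightarrow> 0"
proof -
  define s where "s = sqrt (1 / inversion_const TYPE('n))"
  have s: "0 \<le> s" using inversion_const_pos[where 'n = 'n] by (simp add: s_def)
  note [measurable] = L2_borel[OF K] trunc_borel[OF L2_borel[OF K]] loc_integrable_borel[OF f]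
  have pair_le: "norm (LINT \<xi>|lborel. J \<xi> * inverse_fourier \<phi> \<xi>) \<le> (s * L2_norm J) * sqrt (LINT x|lborel. (norm (\<phi> x))\<^sup>2)"
    if "L2 J" "\<phi> \<in> test_functions" for J \<phi> :: "real^'n \<Rightarrow> complex"
  proof -
    have S: "\<phi> \<in> schwartz" using that(2) by (rule test_schwartz)
    have "norm (LINT \<xi>|lborel. J \<xi> * inverse_fourier \<phi> \<xi>) \<le> (LINT \<xi>|lborel. norm (J \<xi> * inverse_fourier \<phi> \<xi>))"
      by (rule integral_norm_bound)
    also have "\<dots> \<le> L2_norm J * L2_norm (inverse_fourier \<phi>)"
      by (intro L2_cauchy_schwarz that(1) schwartz_L2 schwartz_inverse_fourier S)
    finally show ?thesis
      unfolding L2_norm_inverse_fourier[OF S] s_def[symmetric] L2_norm_def[of \<phi>] by (simp only: ac_simps)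
  qed
  have Tr: "L2 (trunc n K)" for n
    by (rule L2_mono[OF K trunc_borel[OF L2_borel[OF K]] norm_trunc_le])
  have D: "L2 (\<lambda>\<xi>. K \<xi> - trunc n K \<xi>)" for n by (rule L2_diff[OF K Tr])
  have G: "loc_integrable (inverse_fourier (trunc n K))" for n
    by (intro tempered_density_loc_integrable tempered_density_bounded[OF _ inverse_fourier_bounded] inverse_fourier_borel) measurable
  have fG: "loc_integrable (\<lambda>x. f x - inverse_fourier (trunc n K) x)" for n
    by (rule loc_integrable_diff[OF f G])
  have M: "0 \<le> s * L2_norm J" for J :: "real^'n \<Rightarrow> complex" using s L2_norm_nonneg[of J] by simp
  have "norm (LINT x|lborel. f x * \<phi> x) \<le> (s * L2_norm K) * sqrt (LINT x|lborel. (norm (\<phi> x))\<^sup>2)" if "\<phi> \<in> test_functions" for \<phi>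
    unfolding eq[OF that] by (rule pair_le[OF K that])
  from L2_duality(1)[OF f M this] show "L2 f" by (simp add: L2_def loc_integrable_borel[OF f])
  have diff: "norm (LINT x|lborel. (f x - inverse_fourier (trunc n K) x) * \<phi> x)
      \<le> (s * L2_norm (\<lambda>\<xi>. K \<xi> - trunc n K \<xi>)) * sqrt (LINT x|lborel. (norm (\<phi> x))\<^sup>2)" if \<phi>: "\<phi> \<in> test_functions" for \<phi> n
  proof -
    have S: "\<phi> \<in> schwartz" using \<phi> by (rule test_schwartz)
    have "(LINT x|lborel. (f x - inverse_fourier (trunc n K) x) * \<phi> x)
        = (LINT x|lborel. f x * \<phi> x) - (LINT x|lborel. inverse_fourier (trunc n K) x * \<phi> x)"
      unfolding left_diff_distrib
      by (intro Bochner_Integration.integral_diff loc_integrable_mult_test f G \<phi>)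
    also have "(LINT x|lborel. inverse_fourier (trunc n K) x * \<phi> x) = (LINT \<xi>|lborel. trunc n K \<xi> * inverse_fourier \<phi> \<xi>)"
      by (rule inverse_fourier_swap) (auto intro: trunc_integrable K schwartz_integrable S trunc_borel L2_borel schwartz_borel)
    also have "(LINT x|lborel. f x * \<phi> x) - \<dots> = (LINT \<xi>|lborel. (K \<xi> - trunc n K \<xi>) * inverse_fourier \<phi> \<xi>)"
      unfolding eq[OF \<phi>] left_diff_distrib
      by (intro Bochner_Integration.integral_diff[symmetric] L2_mult_integrable K Tr schwartz_L2 schwartz_inverse_fourier S)
    finally show ?thesis using pair_le[OF D \<phi>] by simp
  qed
  show L: "L2 (\<lambda>x. f x - inverse_fourier (trunc n K) x)" for n
    using L2_duality(1)[OF fG[of n] M diff[where n = n]] by (simp add: L2_def loc_integrable_borel[OF fG])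
  have le: "L2_norm (\<lambda>x. f x - inverse_fourier (trunc n K) x) \<le> s * L2_norm (\<lambda>\<xi>. K \<xi> - trunc n K \<xi>)" for n
    using L2_duality(2)[OF fG[of n] M diff[where n = n]] unfolding L2_norm_sq by (rule power2_le_imp_le[OF _ M])
  show "(\<lambda>n. L2_norm (\<lambda>x. f x - inverse_fourier (trunc n K) x)) \<longlonglongrightarrow> 0"
  proof (rule Lim_null_comparison)
    show "\<forall>\<^sub>F n in sequentially. norm (L2_norm (\<lambda>x. f x - inverse_fourier (trunc n K) x)) \<le> s * L2_norm (\<lambda>\<xi>. K \<xi> - trunc n K \<xi>)"
      using le by (intro always_eventually allI) (simp add: L2_norm_nonneg)
    show "(\<lambda>n. s * L2_norm (\<lambda>\<xi>. K \<xi> - trunc n K \<xi>)) \<longlonglongrightarrow> 0"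
      by (rule tendsto_mult_right_zero[OF trunc_L2_tendsto[OF K]])
  qed
qed

lemma L2_product_limit:
  fixes f g \<phi> :: "real^'n::finite \<Rightarrow> complex"
  assumes fg: "L2 f" "L2 g" and p: "\<And>n. L2 (\<lambda>x. f x - F n x)" "(\<lambda>n. L2_norm (\<lambda>x. f x - F n x)) \<longlonglongrightarrow> 0"
    and q: "\<And>n. L2 (\<lambda>x. g x - G n x)" "(\<lambda>n. L2_norm (\<lambda>x. g x - G n x)) \<longlonglongrightarrow> 0"
    and \<phi>: "\<phi> \<in> borel_measurable borel" "\<And>x. norm (\<phi> x) \<le> B"
  shows "(\<lambda>n. LINT x|lborel. F n x * G n x * \<phi> x) \<longlonglongrightarrow> (LINT x|lborel. f x * g x * \<phi> x)"
proof -
  note [measurable] = \<phi>(1)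
  define P where "P n x = f x - F n x" for n x
  define Q where "Q n x = g x - G n x" for n x
  have PQ: "L2 (P n)" "L2 (Q n)" for n using p(1) q(1) by (simp_all add: P_def[abs_def] Q_def[abs_def])
  have B: "0 \<le> B" using \<phi>(2)[of 0] norm_ge_zero order_trans by blast
  have ip: "integrable lborel (\<lambda>x. u x * v x * \<phi> x)" if "L2 u" "L2 v" for u v :: "real^'n \<Rightarrow> complex"
  proof -
    note [measurable] = L2_borel[OF that(1)] L2_borel[OF that(2)]
    have "integrable lborel (\<lambda>x. B * norm (u x * v x))" by (intro integrable_mult_right integrable_norm L2_mult_integrable that)
    moreover have "(\<lambda>x. u x * v x * \<phi> x) \<in> borel_measurable lborel" by measurable
    moreover have "AE x in lborel. norm (u x * v x * \<phi> x) \<le> norm (B * norm (u x * v x))"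
      using \<phi>(2) B by (intro AE_I2) (auto simp: norm_mult mult.commute[of B] intro!: mult_left_mono)
    ultimately show ?thesis by (rule Bochner_Integration.integrable_bound)
  qed
  have le: "norm (LINT x|lborel. u x * v x * \<phi> x) \<le> B * (L2_norm u * L2_norm v)" if "L2 u" "L2 v" for u v :: "real^'n \<Rightarrow> complex"
  proof -
    have "norm (LINT x|lborel. u x * v x * \<phi> x) \<le> (LINT x|lborel. norm (u x * v x * \<phi> x))"
      by (rule integral_norm_bound)
    also have "\<dots> \<le> (LINT x|lborel. B * norm (u x * v x))"
    proof (intro integral_mono integrable_norm ip that integrable_mult_right L2_mult_integrable)
      show "norm (u x * v x * \<phi> x) \<le> B * norm (u x * v x)" for x
        using \<phi>(2)[of x] unfolding norm_mult mult.commute[of B] by (intro mult_left_mono) auto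
    qed
    also have "\<dots> = B * (LINT x|lborel. norm (u x * v x))" by (rule integral_mult_right_zero)
    also have "\<dots> \<le> B * (L2_norm u * L2_norm v)" by (intro mult_left_mono L2_cauchy_schwarz that B)
    finally show ?thesis .
  qed
  \<comment> \<open>Expanded in the errors \<open>P\<close>, \<open>Q\<close> and the limits
    \<open>f\<close>, \<open>g\<close>, so that every term contains an error and no bound on
    \<open>F n\<close> or \<open>G n\<close> is called for.\<close>
  have eq: "(LINT x|lborel. F n x * G n x * \<phi> x) - (LINT x|lborel. f x * g x * \<phi> x)
      = (LINT x|lborel. P n x * Q n x * \<phi> x) - (LINT x|lborel. P n x * g x * \<phi> x) - (LINT x|lborel. f x * Q n x * \<phi> x)" for n
  proof -
    have "(\<lambda>x. F n x * G n x * \<phi> x) = (\<lambda>x. f x * g x * \<phi> x + (P n x * Q n x * \<phi> x - P n x * g x * \<phi> x - f x * Q n x * \<phi> x))"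
      by (simp add: P_def Q_def algebra_simps)
    then show ?thesis using ip[OF fg] ip[OF PQ] ip[OF PQ(1) fg(2)] ip[OF fg(1) PQ(2)] by simp
  qed
  have l: "(\<lambda>n. L2_norm (P n)) \<longlonglongrightarrow> 0" "(\<lambda>n. L2_norm (Q n)) \<longlonglongrightarrow> 0"
    using p(2) q(2) by (simp_all add: P_def[abs_def] Q_def[abs_def])
  show ?thesis
  proof (rule LIM_zero_cancel, rule Lim_null_comparison)
    show "\<forall>\<^sub>F n in sequentially. norm ((LINT x|lborel. F n x * G n x * \<phi> x) - (LINT x|lborel. f x * g x * \<phi> x))
      \<le> B * (L2_norm (P n) * L2_norm (Q n)) + B * (L2_norm (P n) * L2_norm g) + B * (L2_norm f * L2_norm (Q n))"
    proof (rule always_eventually, rule allI)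
      fix n
      show "norm ((LINT x|lborel. F n x * G n x * \<phi> x) - (LINT x|lborel. f x * g x * \<phi> x))
        \<le> B * (L2_norm (P n) * L2_norm (Q n)) + B * (L2_norm (P n) * L2_norm g) + B * (L2_norm f * L2_norm (Q n))"
        unfolding eq using le[OF PQ, of n n] le[OF PQ(1) fg(2), of n] le[OF fg(1) PQ(2), of n]
        by (intro order_trans[OF norm_triangle_ineq4] add_mono) auto
    qed
    have "(\<lambda>n. B * (L2_norm (P n) * L2_norm (Q n)) + B * (L2_norm (P n) * L2_norm g) + B * (L2_norm f * L2_norm (Q n)))
        \<longlonglongrightarrow> B * (0 * 0) + B * (0 * L2_norm g) + B * (L2_norm f * 0)"
      by (intro tendsto_intros l)
    then show "(\<lambda>n. B * (L2_norm (P n) * L2_norm (Q n)) + B * (L2_norm (P n) * L2_norm g) + B * (L2_norm f * L2_norm (Q n))) \<longlonglongrightarrow> 0"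
      by simp
  qed
qed

subsection \<open>The spectrum of a product\<close>

lemma L2_reflect:
  fixes H :: "'a::euclidean_space \<Rightarrow> complex"
  assumes "L2 H"
  shows "L2 (\<lambda>b. H (\<xi> - b))" and "L2_norm (\<lambda>b. H (\<xi> - b)) = L2_norm H"
proof -
  note [measurable] = L2_borel[OF assms]
  have m: "(\<lambda>x. (norm (H x))\<^sup>2) \<in> borel_measurable borel" by measurable
  have "integrable lborel (\<lambda>b. (norm (H (\<xi> + (- 1) *\<^sub>R b)))\<^sup>2)"
    using lborel_integrable_affine_iff[OF m, of "-1" \<xi>] assms by (simp add: L2_def)
  then show "L2 (\<lambda>b. H (\<xi> - b))" by (simp add: L2_def)
  show "L2_norm (\<lambda>b. H (\<xi> - b)) = L2_norm H"
    using lborel_integral_affine[OF m, of "-1" \<xi>] by (simp add: L2_norm_def)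
qed

definition convolution :: "('a::euclidean_space \<Rightarrow> complex) \<Rightarrow> ('a \<Rightarrow> complex) \<Rightarrow> 'a \<Rightarrow> complex" where
  "convolution H K \<xi> = (LINT b|lborel. H (\<xi> - b) * K b)"

lemma convolution_borel:
  fixes H K :: "'a::euclidean_space \<Rightarrow> complex"
  assumes [measurable]: "H \<in> borel_measurable borel" "K \<in> borel_measurable borel"
  shows "convolution H K \<in> borel_measurable borel"
proof -
  have "(\<lambda>(\<xi>, b). H (\<xi> - b) * K b) \<in> borel_measurable (borel \<Otimes>\<^sub>M lborel)" by measurable
  from lborel.borel_measurable_lebesgue_integral[OF this]
  show ?thesis by (simp add: convolution_def[abs_def])
qed

lemma norm_convolution_le:
  assumes "L2 H" "L2 K"
  shows "norm (convolution H K \<xi>) \<le> L2_norm H * L2_norm K"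
proof -
  have "norm (convolution H K \<xi>) \<le> (LINT b|lborel. norm (H (\<xi> - b) * K b))"
    unfolding convolution_def by (rule integral_norm_bound)
  also have "\<dots> \<le> L2_norm (\<lambda>b. H (\<xi> - b)) * L2_norm K"
    by (intro L2_cauchy_schwarz L2_reflect assms)
  finally show ?thesis by (simp only: L2_reflect(2)[OF assms(1)])
qed

lemma tempered_density_convolution:
  assumes "L2 H" "L2 K"
  shows "tempered_density (convolution H K)"
  by (rule tempered_density_bounded[OF convolution_borel norm_convolution_le]) (intro L2_borel assms)+

text \<open>Integrating in \<open>b\<close> first gives a multiple of the integral of
  \<open>\<bar>q\<bar>\<close> that does not depend on \<open>a\<close>. The scale \<open>c\<close>
  covers both sums and differences of the variables.\<close>

lemma integrable_pair_shift:
  fixes p q :: "'a::euclidean_space \<Rightarrow> real"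
  assumes [measurable]: "p \<in> borel_measurable borel" "q \<in> borel_measurable borel"
    and p: "integrable lborel p" and q: "integrable lborel q" and c: "c \<noteq> 0"
  shows "integrable (lborel \<Otimes>\<^sub>M lborel) (\<lambda>(a, b). p a * q (a + c *\<^sub>R b))"
proof (rule lborel_pair.Fubini_integrable)
  show "(\<lambda>(a, b). p a * q (a + c *\<^sub>R b)) \<in> borel_measurable (lborel \<Otimes>\<^sub>M lborel)" by measurable
  have m: "(\<lambda>x. \<bar>q x\<bar>) \<in> borel_measurable borel" by measurable
  have i: "integrable lborel (\<lambda>b. q (a + c *\<^sub>R b))" for a
    using lborel_integrable_affine_iff[OF assms(2) c, of a] q by simp
  have "(LINT b|lborel. \<bar>q (a + c *\<^sub>R b)\<bar>) = (LINT x|lborel. \<bar>q x\<bar>) / \<bar>c\<bar> ^ DIM('a)" for a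
    using lborel_integral_affine[OF m c, of a] c by simp
  then have "(\<lambda>a. LINT b|lborel. norm (case (a, b) of (a, b) \<Rightarrow> p a * q (a + c *\<^sub>R b))) = (\<lambda>a. \<bar>p a\<bar> * ((LINT x|lborel. \<bar>q x\<bar>) / \<bar>c\<bar> ^ DIM('a)))"
    by (simp add: abs_mult)
  moreover have "integrable lborel (\<lambda>a. \<bar>p a\<bar> * ((LINT x|lborel. \<bar>q x\<bar>) / \<bar>c\<bar> ^ DIM('a)))"
    by (intro integrable_mult_left integrable_abs p)
  ultimately show "integrable lborel (\<lambda>a. LINT b|lborel. norm (case (a, b) of (a, b) \<Rightarrow> p a * q (a + c *\<^sub>R b)))"
    by (simp only:)
  show "AE a in lborel. integrable lborel (\<lambda>b. case (a, b) of (a, b) \<Rightarrow> p a * q (a + c *\<^sub>R b))"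
    using i by (simp add: integrable_mult_right)
qed

lemma integrable_pair_swap:
  fixes f :: "'a::euclidean_space \<Rightarrow> 'a \<Rightarrow> 'b::{banach, second_countable_topology}"
  assumes "integrable (lborel \<Otimes>\<^sub>M lborel) (\<lambda>(a, b). f a b)"
  shows "integrable (lborel \<Otimes>\<^sub>M lborel) (\<lambda>(b, a). f a b)"
  using lborel_pair.integrable_product_swap[OF assms] by (simp add: case_prod_beta')

text \<open>Once \<open>H * K\<close> is bounded by the sum of the squares, each term is an
  integrable function of one variable times an integrable function of an independent or shifted one.
  The second form is the same integrand after the substitution \<open>\<xi> = a + b\<close>.\<close>

lemma integrable_density_triple:
  fixes H K \<Phi> :: "'a::euclidean_space \<Rightarrow> complex"
  assumes H: "L2 H" and K: "L2 K" and \<Phi>: "\<Phi> \<in> borel_measurable borel" "integrable lborel \<Phi>"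
  shows "integrable (lborel \<Otimes>\<^sub>M lborel) (\<lambda>(a, b). H a * K b * \<Phi> (a + b))"
    and "integrable (lborel \<Otimes>\<^sub>M lborel) (\<lambda>(\<xi>, b). H (\<xi> - b) * K b * \<Phi> \<xi>)"
proof -
  note [measurable] = L2_borel[OF H] L2_borel[OF K] \<Phi>(1)
  define h where "h x = (norm (H x))\<^sup>2" for x
  define k where "k x = (norm (K x))\<^sup>2" for x
  define p where "p x = norm (\<Phi> x)" for x
  have m[measurable]: "h \<in> borel_measurable borel" "k \<in> borel_measurable borel" "p \<in> borel_measurable borel"
    unfolding h_def[abs_def] k_def[abs_def] p_def[abs_def] by measurable
  have i: "integrable lborel h" "integrable lborel k" "integrable lborel p"
    using H K \<Phi> by (simp_all add: L2_def h_def[abs_def] k_def[abs_def] p_def[abs_def] integrable_norm)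
  have "integrable (lborel \<Otimes>\<^sub>M lborel) (\<lambda>(a, b). h a * p (a + b))"
    using integrable_pair_shift[OF m(1,3) i(1,3), of 1] by simp
  moreover have "integrable (lborel \<Otimes>\<^sub>M lborel) (\<lambda>(a, b). k b * p (a + b))"
    using integrable_pair_swap[of "\<lambda>b a. k b * p (b + a)"] integrable_pair_shift[OF m(2,3) i(2,3), of 1]
    by (simp add: add.commute)
  ultimately have "integrable (lborel \<Otimes>\<^sub>M lborel) (\<lambda>z. (case z of (a, b) \<Rightarrow> h a * p (a + b)) + (case z of (a, b) \<Rightarrow> k b * p (a + b)))"
    by (rule Bochner_Integration.integrable_add)
  then show "integrable (lborel \<Otimes>\<^sub>M lborel) (\<lambda>(a, b). H a * K b * \<Phi> (a + b))"
  proof (rule Bochner_Integration.integrable_bound)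
    show "AE z in lborel \<Otimes>\<^sub>M lborel. norm (case z of (a, b) \<Rightarrow> H a * K b * \<Phi> (a + b))
        \<le> norm ((case z of (a, b) \<Rightarrow> h a * p (a + b)) + (case z of (a, b) \<Rightarrow> k b * p (a + b)))"
    proof (rule AE_I2)
      fix z :: "'a \<times> 'a"
      obtain a b where z: "z = (a, b)" by (cases z)
      have "norm (H a * K b * \<Phi> (a + b)) \<le> (h a + k b) * p (a + b)"
        unfolding h_def k_def p_def norm_mult[of "H a * K b"] by (intro mult_right_mono norm_mult_le_squares) simp
      also have "\<dots> = h a * p (a + b) + k b * p (a + b)" by (rule distrib_right)
      also have "\<dots> \<le> norm \<dots>" by (simp only: real_norm_def abs_ge_self)
      finally show "norm (case z of (a, b) \<Rightarrow> H a * K b * \<Phi> (a + b))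
        \<le> norm ((case z of (a, b) \<Rightarrow> h a * p (a + b)) + (case z of (a, b) \<Rightarrow> k b * p (a + b)))"
        by (simp only: z prod.case)
    qed
  qed measurable
  have "integrable (lborel \<Otimes>\<^sub>M lborel) (\<lambda>(\<xi>, b). p \<xi> * h (\<xi> + (- 1) *\<^sub>R b))"
    by (rule integrable_pair_shift[OF m(3,1) i(3,1)]) simp
  moreover have "integrable (lborel \<Otimes>\<^sub>M lborel) (\<lambda>(\<xi>, b). p \<xi> * k b)"
    by (rule lborel_pair.integrable_pair_mult[OF i(3,2)])
  ultimately have "integrable (lborel \<Otimes>\<^sub>M lborel) (\<lambda>z. (case z of (\<xi>, b) \<Rightarrow> p \<xi> * h (\<xi> + (- 1) *\<^sub>R b)) + (case z of (\<xi>, b) \<Rightarrow> p \<xi> * k b))"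
    by (rule Bochner_Integration.integrable_add)
  then show "integrable (lborel \<Otimes>\<^sub>M lborel) (\<lambda>(\<xi>, b). H (\<xi> - b) * K b * \<Phi> \<xi>)"
  proof (rule Bochner_Integration.integrable_bound)
    show "AE z in lborel \<Otimes>\<^sub>M lborel. norm (case z of (\<xi>, b) \<Rightarrow> H (\<xi> - b) * K b * \<Phi> \<xi>)
        \<le> norm ((case z of (\<xi>, b) \<Rightarrow> p \<xi> * h (\<xi> + (- 1) *\<^sub>R b)) + (case z of (\<xi>, b) \<Rightarrow> p \<xi> * k b))"
    proof (rule AE_I2)
      fix z :: "'a \<times> 'a"
      obtain \<xi> b where z: "z = (\<xi>, b)" by (cases z)
      have "norm (H (\<xi> - b) * K b * \<Phi> \<xi>) \<le> (h (\<xi> - b) + k b) * p \<xi>"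
        unfolding h_def k_def p_def norm_mult[of "H (\<xi> - b) * K b"] by (intro mult_right_mono norm_mult_le_squares) simp
      also have "\<dots> = p \<xi> * h (\<xi> + (- 1) *\<^sub>R b) + p \<xi> * k b" by (simp add: algebra_simps)
      also have "\<dots> \<le> norm \<dots>" by (simp only: real_norm_def abs_ge_self)
      finally show "norm (case z of (\<xi>, b) \<Rightarrow> H (\<xi> - b) * K b * \<Phi> \<xi>)
        \<le> norm ((case z of (\<xi>, b) \<Rightarrow> p \<xi> * h (\<xi> + (- 1) *\<^sub>R b)) + (case z of (\<xi>, b) \<Rightarrow> p \<xi> * k b))"
        by (simp only: z prod.case)
    qed
  qed measurable
qed

lemma inverse_fourier_modulation:
  fixes \<phi> :: "real^'n::finite \<Rightarrow> complex"
  assumes [measurable]: "\<phi> \<in> borel_measurable borel"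
  shows "inverse_fourier (\<lambda>x. cis (- (x \<bullet> - a)) * \<phi> x) b = inverse_fourier \<phi> (a + b)"
proof -
  have m: "(\<lambda>x. cis (- (x \<bullet> - a)) * \<phi> x) \<in> borel_measurable borel" by measurable
  have "cis (- (x \<bullet> - b)) * (cis (- (x \<bullet> - a)) * \<phi> x) = cis (- (x \<bullet> - (a + b))) * \<phi> x" for x
  proof -
    have "cis (- (x \<bullet> - b)) * cis (- (x \<bullet> - a)) = cis (- (x \<bullet> - (a + b)))"
      by (simp add: cis_mult inner_add_right inner_diff_right)
    then show ?thesis by (simp only: mult.assoc[symmetric])
  qed
  then show ?thesis
    unfolding inverse_fourier_def fourier_lborel[OF m] fourier_lborel[OF assms] by (simp only:)
qed

text \<open>The convolution theorem for square-integrable densities. With truncated densities all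
  integrals converge absolutely, and two applications of the multiplication formula give a double
  integral. The truncation is then removed on the left by \<open>L2\<close> convergence of the
  factors and on the right by dominated convergence.\<close>

theorem spectrum_of_product:
  fixes f g H K :: "real^'n::finite \<Rightarrow> complex"
  assumes f: "loc_integrable f" and g: "loc_integrable g" and H: "L2 H" and K: "L2 K"
    and eqf: "\<And>\<phi>. \<phi> \<in> test_functions \<Longrightarrow> (LINT x|lborel. f x * \<phi> x) = (LINT \<xi>|lborel. H \<xi> * inverse_fourier \<phi> \<xi>)"
    and eqg: "\<And>\<phi>. \<phi> \<in> test_functions \<Longrightarrow> (LINT x|lborel. g x * \<phi> x) = (LINT \<xi>|lborel. K \<xi> * inverse_fourier \<phi> \<xi>)"
    and \<phi>: "\<phi> \<in> test_functions"
  shows "(LINT x|lborel. f x * g x * \<phi> x)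
    = (LINT \<xi>|lborel. of_real (1 / inversion_const TYPE('n)) * convolution H K \<xi> * inverse_fourier \<phi> \<xi>)"
proof -
  define c where "c = complex_of_real (1 / inversion_const TYPE('n))"
  define \<Phi> where "\<Phi> = inverse_fourier \<phi>"
  have S: "\<phi> \<in> schwartz" using \<phi> by (rule test_schwartz)
  have S\<Phi>: "\<Phi> \<in> schwartz" unfolding \<Phi>_def by (rule schwartz_inverse_fourier[OF S])
  have \<phi>i: "integrable lborel \<phi>" by (rule schwartz_integrable[OF S])
  have \<Phi>i: "integrable lborel \<Phi>" by (rule schwartz_integrable[OF S\<Phi>])
  have m[measurable]: "H \<in> borel_measurable borel" "K \<in> borel_measurable borel" "\<phi> \<in> borel_measurable borel" "\<Phi> \<in> borel_measurable borel"
    by (intro L2_borel H K schwartz_borel S S\<Phi>)+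
  have tm[measurable]: "trunc n H \<in> borel_measurable borel" "trunc n K \<in> borel_measurable borel" for n
    by (intro trunc_borel m)+
  have gm[measurable]: "inverse_fourier (trunc n K) \<in> borel_measurable borel" for n by (intro inverse_fourier_borel tm)
  have ti: "integrable lborel (trunc n H)" "integrable lborel (trunc n K)" for n
    by (intro trunc_integrable H K)+
  obtain B where B: "\<And>x. (1 + norm x) ^ 0 * norm (\<phi> x) \<le> B" using schwartz_bound[OF S] by metis
  have lim1: "(\<lambda>n. LINT x|lborel. inverse_fourier (trunc n H) x * inverse_fourier (trunc n K) x * \<phi> x)
      \<longlonglongrightarrow> (LINT x|lborel. f x * g x * \<phi> x)"
    by (rule L2_product_limit[OF L2_spectral_approx(1)[OF f H eqf] L2_spectral_approx(1)[OF g K eqg]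
          L2_spectral_approx(2,3)[OF f H eqf] L2_spectral_approx(2,3)[OF g K eqg] m(3), of B])
      (use B in auto)
  have step: "(LINT x|lborel. inverse_fourier (trunc n H) x * inverse_fourier (trunc n K) x * \<phi> x)
      = c * (LINT a|lborel. (LINT b|lborel. trunc n H a * trunc n K b * \<Phi> (a + b)))" for n
  proof -
    let ?G = "inverse_fourier (trunc n K)"
    have Gb: "norm (?G x) \<le> 1 / inversion_const TYPE('n) * (LINT x|lborel. norm (trunc n K x))" (is "_ \<le> ?M") for x
      by (rule inverse_fourier_bounded[OF tm(2)])
    have Gi: "integrable lborel (\<lambda>x. ?G x * \<phi> x)"
    proof (rule Bochner_Integration.integrable_bound)
      show "integrable lborel (\<lambda>x. ?M * norm (\<phi> x))" by (intro integrable_mult_right integrable_norm \<phi>i)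
      show "AE x in lborel. norm (?G x * \<phi> x) \<le> norm (?M * norm (\<phi> x))"
      proof (rule AE_I2)
        fix x
        have "norm (?G x * \<phi> x) \<le> ?M * norm (\<phi> x)" unfolding norm_mult by (intro mult_right_mono Gb) simp
        also have "\<dots> \<le> norm \<dots>" by (simp only: real_norm_def abs_ge_self)
        finally show "norm (?G x * \<phi> x) \<le> norm (?M * norm (\<phi> x))" .
      qed
    qed measurable
    have Gm: "(\<lambda>x. ?G x * \<phi> x) \<in> borel_measurable borel" by measurable
    \<comment> \<open>Multiplication by a character shifts the transform of \<open>\<phi>\<close> by
      \<open>a\<close>; this is the origin of the argument \<open>a + b\<close>.\<close>
    have inner: "inverse_fourier (\<lambda>x. ?G x * \<phi> x) a = c * (LINT b|lborel. trunc n K b * \<Phi> (a + b))" for a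
    proof -
      have mm: "(\<lambda>x. cis (- (x \<bullet> - a)) * \<phi> x) \<in> borel_measurable borel" by measurable
      have "inverse_fourier (\<lambda>x. ?G x * \<phi> x) a = c * (LINT x|lborel. ?G x * (cis (- (x \<bullet> - a)) * \<phi> x))"
        unfolding inverse_fourier_def[of "\<lambda>x. ?G x * \<phi> x"] fourier_lborel[OF Gm] c_def by (simp only: mult.left_commute)
      also have "(LINT x|lborel. ?G x * (cis (- (x \<bullet> - a)) * \<phi> x)) = (LINT b|lborel. trunc n K b * inverse_fourier (\<lambda>x. cis (- (x \<bullet> - a)) * \<phi> x) b)"
        by (rule inverse_fourier_swap[OF tm(2) mm ti(2) integrable_cis_mult[OF m(3) \<phi>i]])
      finally show ?thesis by (simp only: inverse_fourier_modulation[OF m(3)] \<Phi>_def)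
    qed
    have "(LINT x|lborel. inverse_fourier (trunc n H) x * ?G x * \<phi> x) = (LINT x|lborel. inverse_fourier (trunc n H) x * (?G x * \<phi> x))"
      by (simp only: mult.assoc)
    also have "\<dots> = (LINT a|lborel. trunc n H a * inverse_fourier (\<lambda>x. ?G x * \<phi> x) a)"
      by (rule inverse_fourier_swap[OF tm(1) Gm ti(1) Gi])
    also have "\<dots> = (LINT a|lborel. c * (trunc n H a * (LINT b|lborel. trunc n K b * \<Phi> (a + b))))"
      by (simp only: inner mult.left_commute)
    also have "\<dots> = c * (LINT a|lborel. (LINT b|lborel. trunc n H a * trunc n K b * \<Phi> (a + b)))"
      by (simp only: integral_mult_right_zero mult.assoc)
    finally show ?thesis .
  qed
  have L: "L2 (trunc n H)" "L2 (trunc n K)" for n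
    by (rule L2_mono[OF H tm(1) norm_trunc_le], rule L2_mono[OF K tm(2) norm_trunc_le])
  have int: "integrable (lborel \<Otimes>\<^sub>M lborel) (\<lambda>(a, b). H a * K b * \<Phi> (a + b))"
    by (rule integrable_density_triple(1)[OF H K m(4) \<Phi>i])
  have intn: "integrable (lborel \<Otimes>\<^sub>M lborel) (\<lambda>(a, b). trunc n H a * trunc n K b * \<Phi> (a + b))" for n
    by (rule integrable_density_triple(1)[OF L m(4) \<Phi>i])
  have "(\<lambda>n. integral\<^sup>L (lborel \<Otimes>\<^sub>M lborel) (\<lambda>(a, b). trunc n H a * trunc n K b * \<Phi> (a + b)))
      \<longlonglongrightarrow> integral\<^sup>L (lborel \<Otimes>\<^sub>M lborel) (\<lambda>(a, b). H a * K b * \<Phi> (a + b))"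
  proof (rule integral_dominated_convergence)
    show "integrable (lborel \<Otimes>\<^sub>M lborel) (\<lambda>z. norm (case z of (a, b) \<Rightarrow> H a * K b * \<Phi> (a + b)))"
      using int by (rule integrable_norm)
    show "AE z in lborel \<Otimes>\<^sub>M lborel. norm (case z of (a, b) \<Rightarrow> trunc n H a * trunc n K b * \<Phi> (a + b))
        \<le> norm (case z of (a, b) \<Rightarrow> H a * K b * \<Phi> (a + b))" for n
      by (rule AE_I2) (auto simp: norm_mult intro!: mult_right_mono mult_mono norm_trunc_le)
    show "AE z in lborel \<Otimes>\<^sub>M lborel. (\<lambda>n. case z of (a, b) \<Rightarrow> trunc n H a * trunc n K b * \<Phi> (a + b))
        \<longlonglongrightarrow> (case z of (a, b) \<Rightarrow> H a * K b * \<Phi> (a + b))"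
    proof (rule AE_I2)
      fix z :: "(real^'n) \<times> (real^'n)"
      obtain a b where z: "z = (a, b)" by (cases z)
      have "(\<lambda>n. trunc n H a * trunc n K b * \<Phi> (a + b)) \<longlonglongrightarrow> H a * K b * \<Phi> (a + b)"
        by (intro tendsto_mult tendsto_const trunc_tendsto)
      then show "(\<lambda>n. case z of (a, b) \<Rightarrow> trunc n H a * trunc n K b * \<Phi> (a + b))
        \<longlonglongrightarrow> (case z of (a, b) \<Rightarrow> H a * K b * \<Phi> (a + b))" by (simp only: z prod.case)
    qed
  qed measurable
  then have "(\<lambda>n. c * integral\<^sup>L (lborel \<Otimes>\<^sub>M lborel) (\<lambda>(a, b). trunc n H a * trunc n K b * \<Phi> (a + b)))
      \<longlonglongrightarrow> c * integral\<^sup>L (lborel \<Otimes>\<^sub>M lborel) (\<lambda>(a, b). H a * K b * \<Phi> (a + b))"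
    by (intro tendsto_mult tendsto_const)
  then have "(\<lambda>n. LINT x|lborel. inverse_fourier (trunc n H) x * inverse_fourier (trunc n K) x * \<phi> x)
      \<longlonglongrightarrow> c * integral\<^sup>L (lborel \<Otimes>\<^sub>M lborel) (\<lambda>(a, b). H a * K b * \<Phi> (a + b))"
    unfolding step lborel_pair.integral_fst[OF intn] .
  from LIMSEQ_unique[OF lim1 this]
  have "(LINT x|lborel. f x * g x * \<phi> x) = c * integral\<^sup>L (lborel \<Otimes>\<^sub>M lborel) (\<lambda>(a, b). H a * K b * \<Phi> (a + b))" .
  also have "integral\<^sup>L (lborel \<Otimes>\<^sub>M lborel) (\<lambda>(a, b). H a * K b * \<Phi> (a + b)) = (LINT b|lborel. (LINT a|lborel. H a * K b * \<Phi> (a + b)))"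
    by (rule lborel_pair.integral_snd[OF int, symmetric])
  \<comment> \<open>For fixed \<open>b\<close> the substitution \<open>\<xi> = a + b\<close> is a
    translation; exchanging the order afterwards makes the inner integral a convolution.\<close>
  also have "\<dots> = (LINT b|lborel. (LINT \<xi>|lborel. H (\<xi> - b) * K b * \<Phi> \<xi>))"
  proof (rule Bochner_Integration.integral_cong[OF refl])
    fix b :: "real^'n"
    have "(\<lambda>a. H a * K b * \<Phi> (a + b)) \<in> borel_measurable borel" by measurable
    from lborel_integral_translate[OF this, of "- b"]
    show "(LINT a|lborel. H a * K b * \<Phi> (a + b)) = (LINT \<xi>|lborel. H (\<xi> - b) * K b * \<Phi> \<xi>)" by simp
  qed
  also have "\<dots> = (LINT \<xi>|lborel. (LINT b|lborel. H (\<xi> - b) * K b * \<Phi> \<xi>))"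
    by (rule lborel_pair.Fubini_integral[OF integrable_density_triple(2)[OF H K m(4) \<Phi>i]])
  also have "\<dots> = (LINT \<xi>|lborel. convolution H K \<xi> * \<Phi> \<xi>)"
    by (simp only: convolution_def integral_mult_left_zero)
  also have "c * \<dots> = (LINT \<xi>|lborel. c * convolution H K \<xi> * \<Phi> \<xi>)"
    by (simp only: integral_mult_right_zero mult.assoc)
  finally show ?thesis unfolding c_def \<Phi>_def .
qed

lemma has_spectrum_product:
  fixes S T R :: "'n::finite functional"
  assumes prod: "is_distr_product S T R" and S: "has_spectrum S H" "L2 H" and T: "has_spectrum T K" "L2 K"
  shows "has_spectrum R (\<lambda>\<xi>. of_real (1 / inversion_const TYPE('n)) * convolution H K \<xi>)"
  unfolding has_spectrum_def
proof (intro conjI ballI)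
  show "tempered_density (\<lambda>\<xi>. of_real (1 / inversion_const TYPE('n)) * convolution H K \<xi>)"
    by (intro tempered_density_cmult tempered_density_convolution S T)
  fix \<phi> :: "real^'n \<Rightarrow> complex" assume \<phi>: "\<phi> \<in> test_functions"
  obtain f g where fg: "represented_by S f" "represented_by T g" "represented_by R (\<lambda>x. f x * g x)"
    using prod unfolding is_distr_product_def by (elim exE conjE)
  obtain u where u: "loc_integrable u" "AE x in lebesgue. f x = u x" "\<forall>\<phi>\<in>test_functions. S \<phi> = (LINT x|lborel. u x * \<phi> x)"
    by (rule represented_by_borel_version[OF fg(1)])
  obtain v where v: "loc_integrable v" "AE x in lebesgue. g x = v x" "\<forall>\<phi>\<in>test_functions. T \<phi> = (LINT x|lborel. v x * \<phi> x)"
    by (rule represented_by_borel_version[OF fg(2)])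
  obtain w where w: "loc_integrable w" "AE x in lebesgue. f x * g x = w x" "\<forall>\<phi>\<in>test_functions. R \<phi> = (LINT x|lborel. w x * \<phi> x)"
    by (rule represented_by_borel_version[OF fg(3)])
  note [measurable] = loc_integrable_borel[OF u(1)] loc_integrable_borel[OF v(1)] loc_integrable_borel[OF w(1)]
    smooth_borel[OF test_functions_smooth[OF \<phi>]]
  \<comment> \<open>All three Borel versions come from the same pair \<open>f\<close>,
    \<open>g\<close>, so they inherit the pointwise product almost everywhere.\<close>
  have "AE x in lebesgue. w x = u x * v x"
    using u(2) v(2) w(2) by eventually_elim simp
  then have ae: "AE x in lborel. w x = u x * v x" by (simp only: AE_completion_iff)
  have "R \<phi> = (LINT x|lborel. w x * \<phi> x)" using w(3) \<phi> by blast
  also have "\<dots> = (LINT x|lborel. u x * v x * \<phi> x)"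
  proof (rule integral_cong_AE)
    show "AE x in lborel. w x * \<phi> x = u x * v x * \<phi> x" using ae by eventually_elim simp
  qed measurable
  also have "\<dots> = (LINT \<xi>|lborel. of_real (1 / inversion_const TYPE('n)) * convolution H K \<xi> * inverse_fourier \<phi> \<xi>)"
  proof (rule spectrum_of_product[OF u(1) v(1) S(2) T(2) _ _ \<phi>])
    fix \<psi> :: "real^'n \<Rightarrow> complex" assume \<psi>: "\<psi> \<in> test_functions"
    show "(LINT x|lborel. u x * \<psi> x) = (LINT \<xi>|lborel. H \<xi> * inverse_fourier \<psi> \<xi>)"
      using u(3)[rule_format, OF \<psi>] S(1) \<psi> by (simp add: has_spectrum_def)
    show "(LINT x|lborel. v x * \<psi> x) = (LINT \<xi>|lborel. K \<xi> * inverse_fourier \<psi> \<xi>)"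
      using v(3)[rule_format, OF \<psi>] T(1) \<psi> by (simp add: has_spectrum_def)
  qed
  finally show "R \<phi> = (LINT \<xi>|lborel. of_real (1 / inversion_const TYPE('n)) * convolution H K \<xi> * inverse_fourier \<phi> \<xi>)" .
qed

subsection \<open>The spectrum of a field in the homogeneous Sobolev space\<close>

text \<open>The two conditions cover complementary frequencies. In the unit ball the square of the
  modulus \<open>s\<close> of the density is at most \<open>1 + s powr r\<close>; outside it
  \<open>1 + norm \<xi> \<le> 2 * norm \<xi>\<close>, and the homogeneous norm applies. Square
  integrability then lets the representation pass from test functions to all Schwartz
  functions.\<close>

lemma Hdot1_spectrum:
  fixes T :: "'n::finite functional"
  assumes T: "T \<in> Hdot1" and Lr: "in_Lp_loc r (distr_fourier T)" and r: "2 \<le> r"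
  obtains H where "H \<in> borel_measurable borel" "L2 (\<lambda>\<xi>. of_real (1 + norm \<xi>) * H \<xi>)"
    "\<forall>\<psi>\<in>schwartz. T (fourier \<psi>) = (LINT \<xi>|lborel. H \<xi> * \<psi> \<xi>)"
proof -
  from T obtain h where temp: "tempered_distribution T" and h: "represented_by (distr_fourier T) h"
    and hi: "integrable lebesgue (\<lambda>\<xi>. (norm \<xi>)\<^sup>2 * (norm (h \<xi>))\<^sup>2)"
    unfolding Hdot1_def by blast
  from Lr obtain f where f: "represented_by (distr_fourier T) f" and fp: "locally_Lp r f"
    unfolding in_Lp_loc_def by blast
  obtain H where H: "loc_integrable H" "AE x in lebesgue. h x = H x"
    "\<forall>\<phi>\<in>test_functions. distr_fourier T \<phi> = (LINT x|lborel. H x * \<phi> x)"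
    by (rule represented_by_borel_version[OF h])
  obtain F where F: "loc_integrable F" "AE x in lebesgue. f x = F x"
    "\<forall>\<phi>\<in>test_functions. distr_fourier T \<phi> = (LINT x|lborel. F x * \<phi> x)"
    by (rule represented_by_borel_version[OF f])
  note m[measurable] = loc_integrable_borel[OF H(1)] loc_integrable_borel[OF F(1)]
  have [measurable]: "h \<in> borel_measurable lebesgue" "f \<in> borel_measurable lebesgue"
    using h f by (auto simp: represented_by_def locally_Lp_def)
  have [measurable]: "cball (0::real^'n) 1 \<in> sets borel" "cball (0::real^'n) 1 \<in> sets lebesgue" by simp_all
  \<comment> \<open>Each of the two conditions comes with a representing function of its own;
    uniqueness identifies them.\<close>
  have "AE x in lborel. H x - F x = 0"
  proof (rule orthogonal_test_functions_zero[OF loc_integrable_diff[OF H(1) F(1)]])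
    fix \<phi> :: "real^'n \<Rightarrow> complex" assume \<phi>: "\<phi> \<in> test_functions"
    have "(LINT x|lborel. (H x - F x) * \<phi> x) = (LINT x|lborel. H x * \<phi> x) - (LINT x|lborel. F x * \<phi> x)"
      unfolding left_diff_distrib by (intro Bochner_Integration.integral_diff loc_integrable_mult_test H F \<phi>)
    then show "(LINT x|lborel. (H x - F x) * \<phi> x) = 0" using H(3)[rule_format, OF \<phi>] F(3)[rule_format, OF \<phi>] by simp
  qed
  then have HF: "AE x in lborel. H x = F x" by eventually_elim simp
  have i1: "integrable lborel (\<lambda>\<xi>. (norm \<xi>)\<^sup>2 * (norm (H \<xi>))\<^sup>2)"
  proof (rule AE_lebesgue_integrable_iff[THEN iffD1, OF _ _ _ hi])
    show "AE \<xi> in lebesgue. (norm \<xi>)\<^sup>2 * (norm (h \<xi>))\<^sup>2 = (norm \<xi>)\<^sup>2 * (norm (H \<xi>))\<^sup>2"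
      using H(2) by eventually_elim simp
    show "(\<lambda>\<xi>. (norm \<xi>)\<^sup>2 * (norm (h \<xi>))\<^sup>2) \<in> borel_measurable lebesgue" using hi by simp
  qed measurable
  have i2': "integrable lebesgue (\<lambda>\<xi>. indicat_real (cball 0 1) \<xi> *\<^sub>R (norm (f \<xi>) powr r))"
    using fp compact_cball[of "0::real^'n" 1] unfolding locally_Lp_def set_integrable_def by blast
  have i2: "integrable lborel (\<lambda>\<xi>. indicat_real (cball 0 1) \<xi> *\<^sub>R (norm (F \<xi>) powr r))"
  proof (rule AE_lebesgue_integrable_iff[THEN iffD1, OF _ _ _ i2'])
    show "AE \<xi> in lebesgue. indicat_real (cball 0 1) \<xi> *\<^sub>R (norm (f \<xi>) powr r) = indicat_real (cball 0 1) \<xi> *\<^sub>R (norm (F \<xi>) powr r)"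
      using F(2) by eventually_elim simp
    show "(\<lambda>\<xi>. indicat_real (cball 0 1) \<xi> *\<^sub>R (norm (f \<xi>) powr r)) \<in> borel_measurable lebesgue" using i2' by (rule borel_measurable_integrable)
  qed measurable
  have i3: "integrable lborel (\<lambda>\<xi>::real^'n. indicat_real (cball 0 1) \<xi>)"
    by (intro integrable_real_indicator emeasure_bounded_finite bounded_cball) simp
  \<comment> \<open>The factor 4 is \<open>2\<^sup>2\<close>: in the unit ball it bounds the squared
    weight, outside it compares that weight with \<open>(norm \<xi>)\<^sup>2\<close>.\<close>
  define b where "b \<xi> = 4 * (indicat_real (cball 0 1) \<xi> + indicat_real (cball 0 1) \<xi> *\<^sub>R (norm (F \<xi>) powr r)
      + (norm \<xi>)\<^sup>2 * (norm (H \<xi>))\<^sup>2)" for \<xi>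
  have bi: "integrable lborel b"
    unfolding b_def by (intro integrable_mult_right Bochner_Integration.integrable_add i1 i2 i3)
  have "integrable lborel (\<lambda>\<xi>. (norm (of_real (1 + norm \<xi>) * H \<xi>))\<^sup>2)"
  proof (rule Bochner_Integration.integrable_bound[OF bi])
    show "AE \<xi> in lborel. norm ((norm (of_real (1 + norm \<xi>) * H \<xi>))\<^sup>2) \<le> norm (b \<xi>)"
      using HF
    proof eventually_elim
      case (elim \<xi>)
      have sq: "norm ((norm (of_real (1 + norm \<xi>) * H \<xi>))\<^sup>2) = (1 + norm \<xi>)\<^sup>2 * (norm (H \<xi>))\<^sup>2"
        by (simp only: norm_mult norm_of_real power_mult_distrib power2_abs real_norm_def abs_mult abs_power2)
      have "(1 + norm \<xi>)\<^sup>2 * (norm (H \<xi>))\<^sup>2 \<le> b \<xi>"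
      proof (cases "norm \<xi> \<le> 1")
        case True
        have "(norm (H \<xi>))\<^sup>2 \<le> 1 + norm (F \<xi>) powr r"
        proof (cases "norm (F \<xi>) \<le> 1")
          case True
          then have "(norm (H \<xi>))\<^sup>2 \<le> 1" using elim by (simp add: power_le_one)
          moreover have "0 \<le> norm (F \<xi>) powr r" by simp
          ultimately show ?thesis by linarith
        next
          case False
          then have "norm (F \<xi>) powr 2 \<le> norm (F \<xi>) powr r" using r by (intro powr_mono) auto
          moreover have "norm (F \<xi>) powr 2 = (norm (H \<xi>))\<^sup>2" using False elim by (simp add: powr_numeral)
          ultimately show ?thesis by linarith
        qed
        moreover have "(1 + norm \<xi>)\<^sup>2 \<le> 2\<^sup>2" using True by (intro power_mono) auto
        ultimately have "(1 + norm \<xi>)\<^sup>2 * (norm (H \<xi>))\<^sup>2 \<le> 4 * (1 + norm (F \<xi>) powr r)"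
          by (intro mult_mono) auto
        also have "\<dots> \<le> b \<xi>" using True by (simp add: b_def)
        finally show ?thesis .
      next
        case False
        then have "(1 + norm \<xi>)\<^sup>2 \<le> (2 * norm \<xi>)\<^sup>2" by (intro power_mono) auto
        then have "(1 + norm \<xi>)\<^sup>2 * (norm (H \<xi>))\<^sup>2 \<le> (2 * norm \<xi>)\<^sup>2 * (norm (H \<xi>))\<^sup>2"
          by (intro mult_right_mono) auto
        also have "\<dots> = b \<xi>" using False by (simp add: b_def power_mult_distrib)
        finally show ?thesis .
      qed
      also have "\<dots> \<le> norm (b \<xi>)" by (simp only: real_norm_def abs_ge_self)
      finally show ?case unfolding sq .
    qed
  qed measurable
  then have wL2: "L2 (\<lambda>\<xi>. of_real (1 + norm \<xi>) * H \<xi>)" unfolding L2_def by simp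
  have HL2: "L2 H" by (rule L2_unweighted[OF m(1) wL2])
  have "T (fourier \<psi>) = (LINT \<xi>|lborel. H \<xi> * \<psi> \<xi>)" if S: "\<psi> \<in> schwartz" for \<psi>
  proof -
    \<comment> \<open>The density of \<open>distr_fourier T\<close> is known on test functions only.
      The error of the cut-off tends to zero both under \<open>T\<close> and under the integral,
      which carries the identity over to \<open>\<psi>\<close>.\<close>
    define \<theta> where "\<theta> n x = bump (dilation n *\<^sub>R x) * \<psi> x" for n x
    have \<theta>: "\<theta> n \<in> test_functions" for n unfolding \<theta>_def by (rule bump_cutoff_test[OF S])
    have S\<theta>: "\<theta> n \<in> schwartz" for n by (rule test_schwartz[OF \<theta>])
    have null: "schwartz_null (\<lambda>n x. \<theta> n x - \<psi> x)"
      using bump_cutoff_null[OF S] by (simp add: \<theta>_def left_diff_distrib)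
    have lin: "linear_functional_on schwartz T" using temp by (simp add: tempered_distribution_def)
    have "T (fourier (\<lambda>x. \<theta> n x - \<psi> x)) = (LINT \<xi>|lborel. H \<xi> * (\<theta> n \<xi> - \<psi> \<xi>)) + ((LINT \<xi>|lborel. H \<xi> * \<psi> \<xi>) - T (fourier \<psi>))" for n
    proof -
      have "fourier (\<lambda>x. \<theta> n x - \<psi> x) = (\<lambda>x. 1 * fourier (\<theta> n) x + (- 1) * fourier \<psi> x)"
        by (simp add: fourier_diff[OF S\<theta> S] fun_eq_iff)
      then have "T (fourier (\<lambda>x. \<theta> n x - \<psi> x)) = 1 * T (fourier (\<theta> n)) + (- 1) * T (fourier \<psi>)"
        by (simp only: lin[unfolded linear_functional_on_def, rule_format, OF schwartz_fourier[OF S\<theta>] schwartz_fourier[OF S]])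
      moreover have "T (fourier (\<theta> n)) = (LINT \<xi>|lborel. H \<xi> * \<theta> n \<xi>)"
        using H(3)[rule_format, OF \<theta>] by (simp add: distr_fourier_def)
      moreover have "(LINT \<xi>|lborel. H \<xi> * (\<theta> n \<xi> - \<psi> \<xi>)) = (LINT \<xi>|lborel. H \<xi> * \<theta> n \<xi>) - (LINT \<xi>|lborel. H \<xi> * \<psi> \<xi>)"
        unfolding right_diff_distrib
        by (intro Bochner_Integration.integral_diff L2_mult_integrable HL2 schwartz_L2 S S\<theta>)
      ultimately show ?thesis by simp
    qed
    moreover have "(\<lambda>n. T (fourier (\<lambda>x. \<theta> n x - \<psi> x))) \<longlonglongrightarrow> 0"
      by (rule tempered_distribution_null[OF temp schwartz_null_fourier[OF null]])
    ultimately have "(\<lambda>n. (LINT \<xi>|lborel. H \<xi> * (\<theta> n \<xi> - \<psi> \<xi>)) + ((LINT \<xi>|lborel. H \<xi> * \<psi> \<xi>) - T (fourier \<psi>))) \<longlonglongrightarrow> 0"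
      by simp
    moreover have "(\<lambda>n. (LINT \<xi>|lborel. H \<xi> * (\<theta> n \<xi> - \<psi> \<xi>)) + ((LINT \<xi>|lborel. H \<xi> * \<psi> \<xi>) - T (fourier \<psi>)))
        \<longlonglongrightarrow> 0 + ((LINT \<xi>|lborel. H \<xi> * \<psi> \<xi>) - T (fourier \<psi>))"
      by (intro tendsto_add tendsto_const tempered_density_null[OF L2_tempered_density[OF HL2] null])
    ultimately have "0 = 0 + ((LINT \<xi>|lborel. H \<xi> * \<psi> \<xi>) - T (fourier \<psi>))" by (rule LIMSEQ_unique)
    then show ?thesis by simp
  qed
  then show ?thesis by (intro that[OF m(1) wL2]) blast
qed

section \<open>Reality as Hermitian symmetry of the spectrum\<close>

lemma real_valued_cnj:
  fixes T :: "'n::finite functional"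
  assumes lin: "linear_functional_on schwartz T" and real: "real_valued T" and S: "\<phi> \<in> schwartz"
  shows "T (\<lambda>x. cnj (\<phi> x)) = cnj (T \<phi>)"
proof -
  define a where "a x = complex_of_real (Re (\<phi> x))" for x
  define b where "b x = complex_of_real (Im (\<phi> x))" for x
  have "(\<lambda>x. (1 / 2) * \<phi> x + (1 / 2) * cnj (\<phi> x)) \<in> schwartz" "(\<lambda>x. (- \<i> / 2) * \<phi> x + (\<i> / 2) * cnj (\<phi> x)) \<in> schwartz"
    by (intro schwartz_lincomb S schwartz_cnj)+
  moreover have "(\<lambda>x. (1 / 2) * \<phi> x + (1 / 2) * cnj (\<phi> x)) = a" "(\<lambda>x. (- \<i> / 2) * \<phi> x + (\<i> / 2) * cnj (\<phi> x)) = b"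
    by (auto simp: a_def b_def fun_eq_iff complex_eq_iff)
  ultimately have ab: "a \<in> schwartz" "b \<in> schwartz" by simp_all
  have "T a \<in> \<real>" "T b \<in> \<real>" using real ab unfolding real_valued_def a_def[abs_def] b_def[abs_def] by auto
  moreover have "\<phi> = (\<lambda>x. 1 * a x + \<i> * b x)" "(\<lambda>x. cnj (\<phi> x)) = (\<lambda>x. 1 * a x + (- \<i>) * b x)"
    by (auto simp: a_def b_def fun_eq_iff complex_eq_iff)
  then have "T \<phi> = 1 * T a + \<i> * T b" "T (\<lambda>x. cnj (\<phi> x)) = 1 * T a + (- \<i>) * T b"
    using lin ab unfolding linear_functional_on_def by metis+
  ultimately show ?thesis by (auto simp: Reals_cnj_iff)
qed

text \<open>\<open>fourier\<close> maps the conjugate reflection of \<open>\<psi>\<close> to the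
  conjugate of \<open>fourier \<psi>\<close>, where a real functional takes the conjugate value.
  Comparing the densities on both sides gives the symmetry.\<close>

lemma spectrum_hermitian:
  fixes T :: "'n::finite functional"
  assumes lin: "linear_functional_on schwartz T" and real: "real_valued T" and H: "L2 H"
    and T: "\<forall>\<psi>\<in>schwartz. T (fourier \<psi>) = (LINT \<xi>|lborel. H \<xi> * \<psi> \<xi>)"
  shows "AE \<xi> in lborel. H (- \<xi>) = cnj (H \<xi>)"
proof -
  note [measurable] = L2_borel[OF H]
  have R: "L2 (\<lambda>\<xi>. cnj (H (- \<xi>)))"
    using L2_reflect(1)[OF H, of 0] unfolding L2_def by (auto) measurable
  have "AE \<xi> in lborel. cnj (H (- \<xi>)) - H \<xi> = 0"
  proof (rule orthogonal_test_functions_zero[OF L2_loc_integrable[OF L2_diff[OF R H]]])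
    fix \<psi> :: "real^'n \<Rightarrow> complex" assume "\<psi> \<in> test_functions"
    then have S: "\<psi> \<in> schwartz" by (rule test_schwartz)
    note [measurable] = schwartz_borel[OF S]
    have S': "(\<lambda>\<xi>. cnj (\<psi> (- \<xi>))) \<in> schwartz" by (intro schwartz_cnj schwartz_uminus S)
    have "fourier (\<lambda>\<xi>. cnj (\<psi> (- \<xi>))) = (\<lambda>x. cnj (fourier \<psi> x))"
      using fourier_cnj[of "\<lambda>\<xi>. \<psi> (- \<xi>)"] fourier_uminus[of \<psi>] schwartz_borel[OF S] schwartz_borel[OF schwartz_uminus[OF S]]
      by (simp add: fun_eq_iff)
    then have "cnj (T (fourier \<psi>)) = (LINT \<xi>|lborel. H \<xi> * cnj (\<psi> (- \<xi>)))"
      using T[rule_format, OF S'] real_valued_cnj[OF lin real schwartz_fourier[OF S]] by simp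
    also have "\<dots> = (LINT \<xi>|lborel. H (- \<xi>) * cnj (\<psi> \<xi>))"
    proof -
      have "(\<lambda>\<xi>. H \<xi> * cnj (\<psi> (- \<xi>))) \<in> borel_measurable borel" by measurable
      from lborel_integral_uminus[OF this] show ?thesis by simp
    qed
    finally have "T (fourier \<psi>) = cnj (LINT \<xi>|lborel. H (- \<xi>) * cnj (\<psi> \<xi>))" by (metis complex_cnj_cnj)
    also have "\<dots> = (LINT \<xi>|lborel. cnj (H (- \<xi>)) * \<psi> \<xi>)"
      by (simp only: Bochner_Integration.integral_cnj[symmetric] complex_cnj_mult complex_cnj_cnj)
    finally have "(LINT \<xi>|lborel. cnj (H (- \<xi>)) * \<psi> \<xi>) = (LINT \<xi>|lborel. H \<xi> * \<psi> \<xi>)"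
      using T[rule_format, OF S] by simp
    moreover have "(LINT \<xi>|lborel. (cnj (H (- \<xi>)) - H \<xi>) * \<psi> \<xi>) = (LINT \<xi>|lborel. cnj (H (- \<xi>)) * \<psi> \<xi>) - (LINT \<xi>|lborel. H \<xi> * \<psi> \<xi>)"
      unfolding left_diff_distrib by (intro Bochner_Integration.integral_diff L2_mult_integrable R H schwartz_L2 S)
    ultimately show "(LINT \<xi>|lborel. (cnj (H (- \<xi>)) - H \<xi>) * \<psi> \<xi>) = 0" by simp
  qed
  then show ?thesis
  proof eventually_elim
    case (elim \<xi>)
    then have "cnj (cnj (H (- \<xi>))) = cnj (H \<xi>)" by simp
    then show ?case by simp
  qed
qed

lemma AE_lborel_uminus:
  fixes P :: "'a::euclidean_space \<Rightarrow> bool"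
  assumes [measurable]: "Measurable.pred borel P" and "AE x in lborel. P x"
  shows "AE x in lborel. P (- x)"
proof -
  have eq: "distr lborel borel uminus = (lborel :: 'a measure)"
    using lborel_affine[of "-1" "0 :: 'a"] by (simp add: density_1)
  have "AE x in distr lborel borel uminus. P x" unfolding eq by (rule assms(2))
  then show ?thesis by (subst (asm) AE_distr_iff) (auto simp: pred_def)
qed

text \<open>The relations hold almost everywhere; they are made exact by setting the densities to zero on
  a symmetric null set, so that they can later be used at \<open>\<xi> - \<eta>\<close> without further null sets.\<close>

lemma exact_densities:
  fixes H :: "'n::finite \<Rightarrow> real^'n \<Rightarrow> complex"
  assumes m: "\<And>i. H i \<in> borel_measurable borel"
    and herm: "\<And>i. AE \<xi> in lborel. H i (- \<xi>) = cnj (H i \<xi>)"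
    and div: "AE \<xi> in lborel. (\<Sum>i\<in>UNIV. of_real (\<xi> $ i) * H i \<xi>) = 0"
  shows "\<exists>K. (\<forall>i. K i \<in> borel_measurable borel) \<and> (\<forall>i \<xi>. norm (K i \<xi>) \<le> norm (H i \<xi>)) \<and>
    (\<forall>i. AE \<xi> in lborel. H i \<xi> = K i \<xi>) \<and> (\<forall>i \<xi>. K i (- \<xi>) = cnj (K i \<xi>)) \<and>
    (\<forall>\<xi>. (\<Sum>i\<in>UNIV. of_real (\<xi> $ i) * K i \<xi>) = 0)"
proof -
  note [measurable] = m
  define P where "P \<xi> \<longleftrightarrow> (\<forall>i\<in>UNIV. H i (- \<xi>) = cnj (H i \<xi>)) \<and> (\<Sum>i\<in>UNIV. of_real (\<xi> $ i) * H i \<xi>) = 0" for \<xi>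
  have P[measurable]: "Measurable.pred borel P" unfolding P_def[abs_def] by measurable
  have "AE \<xi> in lborel. \<forall>i. H i (- \<xi>) = cnj (H i \<xi>)" by (intro eventually_all_finite herm)
  with div have aeP: "AE \<xi> in lborel. P \<xi>" by eventually_elim (simp add: P_def)
  have aeP': "AE \<xi> in lborel. P (- \<xi>)" by (rule AE_lborel_uminus[OF P aeP])
  \<comment> \<open>Requiring \<open>P\<close> at \<open>- \<xi>\<close> as well makes the
    exceptional set symmetric, so that zeroing the densities there preserves the Hermitian
    relation.\<close>
  define K where "K i \<xi> = (if P \<xi> \<and> P (- \<xi>) then H i \<xi> else 0)" for i \<xi>
  show ?thesis
  proof (intro exI[of _ K] conjI allI)
    show "K i \<in> borel_measurable borel" for i unfolding K_def[abs_def] by measurable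
    show "norm (K i \<xi>) \<le> norm (H i \<xi>)" for i \<xi> by (simp add: K_def)
    show "AE \<xi> in lborel. H i \<xi> = K i \<xi>" for i
      using aeP aeP' by eventually_elim (simp add: K_def)
    show "K i (- \<xi>) = cnj (K i \<xi>)" for i \<xi>
    proof (cases "P \<xi> \<and> P (- \<xi>)")
      case True
      then have "K i \<xi> = H i \<xi>" "K i (- \<xi>) = H i (- \<xi>)" by (simp_all add: K_def)
      moreover have "H i (- \<xi>) = cnj (H i \<xi>)" using True unfolding P_def by blast
      ultimately show ?thesis by simp
    next
      case False
      then have "K i \<xi> = 0" "K i (- \<xi>) = 0" by (auto simp: K_def)
      then show ?thesis by simp
    qed
    show "(\<Sum>i\<in>UNIV. of_real (\<xi> $ i) * K i \<xi>) = 0" for \<xi>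
    proof (cases "P \<xi> \<and> P (- \<xi>)")
      case True
      then have "(\<Sum>i\<in>UNIV. of_real (\<xi> $ i) * H i \<xi>) = 0" unfolding P_def by blast
      with True show ?thesis by (simp add: K_def)
    next
      case False
      then have "K i \<xi> = 0" for i by (auto simp: K_def)
      then show ?thesis by simp
    qed
  qed
qed

subsection \<open>The trilinear form and the conclusion\<close>

text \<open>In dimension three \<open>1 / (1 + norm x) ^ 4\<close> is integrable; this replaces the Sobolev embedding
  that makes the trilinear form of the energy identity converge.\<close>

lemma integrable_trilinear:
  fixes f g k :: "real^3 \<Rightarrow> complex"
  assumes [measurable]: "f \<in> borel_measurable borel" "g \<in> borel_measurable borel"
    and f: "L2 (\<lambda>\<xi>. of_real (1 + norm \<xi>) * f \<xi>)" and g: "L2 (\<lambda>\<xi>. of_real (1 + norm \<xi>) * g \<xi>)" and k: "L2 k"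
  shows "integrable (lborel \<Otimes>\<^sub>M lborel) (\<lambda>(\<xi>, b). f \<xi> * g (\<xi> - b) * k b)"
proof -
  note [measurable] = L2_borel[OF k]
  define F where "F \<xi> = (norm (of_real (1 + norm \<xi>) * f \<xi>))\<^sup>2" for \<xi>
  define G where "G \<xi> = (norm (of_real (1 + norm \<xi>) * g \<xi>))\<^sup>2" for \<xi>
  define Q where "Q \<xi> = (norm (k \<xi>))\<^sup>2" for \<xi>
  define w where "w \<xi> = 1 / (1 + norm \<xi>) ^ 4" for \<xi> :: "real^3"
  have m[measurable]: "F \<in> borel_measurable borel" "G \<in> borel_measurable borel" "Q \<in> borel_measurable borel" "w \<in> borel_measurable borel"
    unfolding F_def[abs_def] G_def[abs_def] Q_def[abs_def] w_def[abs_def] by measurable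
  have i: "integrable lborel F" "integrable lborel G" "integrable lborel Q"
    using f g k by (simp_all add: L2_def F_def[abs_def] G_def[abs_def] Q_def[abs_def])
  have iw: "integrable lborel w"
    unfolding w_def using integrable_inverse_power_norm[where 'a = "real^3"] by (simp add: numeral_eq_Suc)
  have i1: "integrable (lborel \<Otimes>\<^sub>M lborel) (\<lambda>(\<xi>, b). F \<xi> * G (\<xi> + (- 1) *\<^sub>R b))"
    by (rule integrable_pair_shift[OF m(1,2) i(1,2)]) simp
  have i2: "integrable (lborel \<Otimes>\<^sub>M lborel) (\<lambda>(\<xi>, b). w \<xi> * Q b)"
    by (rule lborel_pair.integrable_pair_mult[OF iw i(3)])
  have i3: "integrable (lborel \<Otimes>\<^sub>M lborel) (\<lambda>(\<xi>, b). Q b * w (b + (- 1) *\<^sub>R \<xi>))"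
    by (rule integrable_pair_swap[of "\<lambda>b \<xi>. Q b * w (b + (- 1) *\<^sub>R \<xi>)"], rule integrable_pair_shift[OF m(3,4) i(3) iw]) simp
  have le: "norm (f \<xi> * g (\<xi> - b) * k b) \<le> F \<xi> * G (\<xi> + (- 1) *\<^sub>R b) + (w \<xi> * Q b + Q b * w (b + (- 1) *\<^sub>R \<xi>))" for \<xi> b
  proof -
    define p q where "p = 1 + norm \<xi>" and "q = 1 + norm (\<xi> - b)"
    have pq: "p > 0" "q > 0" by (simp_all add: p_def q_def)
    have sq: "x * y \<le> x\<^sup>2 + y\<^sup>2" if "0 \<le> x" "0 \<le> y" for x y :: real
    proof -
      have "norm (complex_of_real x * complex_of_real y) \<le> (norm (complex_of_real x))\<^sup>2 + (norm (complex_of_real y))\<^sup>2"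
        by (rule norm_mult_le_squares)
      then show ?thesis using that by (simp add: norm_mult)
    qed
    \<comment> \<open>The weights of \<open>f\<close> and \<open>g\<close> are collected in
      \<open>A\<close>, and their inverses are left with \<open>k\<close>. The bound
      \<open>x * y \<le> x\<^sup>2 + y\<^sup>2\<close> is applied to \<open>A * E\<close> and again
      to \<open>(1 / p)\<^sup>2 * (1 / q)\<^sup>2\<close>, so that each term keeps the fourth power
      of a single weight.\<close>
    define A where "A = (p * norm (f \<xi>)) * (q * norm (g (\<xi> - b)))"
    define E where "E = norm (k b) * (1 / p * (1 / q))"
    have "norm (f \<xi> * g (\<xi> - b) * k b) = A * E"
      using pq by (simp add: A_def E_def norm_mult)
    also have "\<dots> \<le> A\<^sup>2 + E\<^sup>2" using pq by (intro sq) (simp_all add: A_def E_def)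
    also have "A\<^sup>2 = F \<xi> * G (\<xi> + (- 1) *\<^sub>R b)"
      by (simp add: A_def F_def G_def p_def q_def norm_mult power_mult_distrib del: of_real_add)
    also have "E\<^sup>2 = Q b * ((1 / p)\<^sup>2 * (1 / q)\<^sup>2)" by (simp only: E_def Q_def power_mult_distrib)
    also have "\<dots> \<le> Q b * (((1 / p)\<^sup>2)\<^sup>2 + ((1 / q)\<^sup>2)\<^sup>2)"
      by (intro mult_left_mono sq) (simp_all add: Q_def)
    also have "\<dots> = w \<xi> * Q b + Q b * w (b + (- 1) *\<^sub>R \<xi>)"
      by (simp add: w_def p_def q_def power_divide norm_minus_commute distrib_left flip: power_mult)
    finally show ?thesis by simp
  qed
  have "integrable (lborel \<Otimes>\<^sub>M lborel) (\<lambda>z. (case z of (\<xi>, b) \<Rightarrow> F \<xi> * G (\<xi> + (- 1) *\<^sub>R b))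
      + ((case z of (\<xi>, b) \<Rightarrow> w \<xi> * Q b) + (case z of (\<xi>, b) \<Rightarrow> Q b * w (b + (- 1) *\<^sub>R \<xi>))))"
    by (intro Bochner_Integration.integrable_add i1 i2 i3)
  then show ?thesis
  proof (rule Bochner_Integration.integrable_bound)
    show "AE z in lborel \<Otimes>\<^sub>M lborel. norm (case z of (\<xi>, b) \<Rightarrow> f \<xi> * g (\<xi> - b) * k b)
      \<le> norm ((case z of (\<xi>, b) \<Rightarrow> F \<xi> * G (\<xi> + (- 1) *\<^sub>R b))
      + ((case z of (\<xi>, b) \<Rightarrow> w \<xi> * Q b) + (case z of (\<xi>, b) \<Rightarrow> Q b * w (b + (- 1) *\<^sub>R \<xi>))))"
    proof (rule AE_I2)
      fix z :: "(real^3) \<times> (real^3)"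
      obtain \<xi> b where z: "z = (\<xi>, b)" by (cases z)
      show "norm (case z of (\<xi>, b) \<Rightarrow> f \<xi> * g (\<xi> - b) * k b)
        \<le> norm ((case z of (\<xi>, b) \<Rightarrow> F \<xi> * G (\<xi> + (- 1) *\<^sub>R b))
        + ((case z of (\<xi>, b) \<Rightarrow> w \<xi> * Q b) + (case z of (\<xi>, b) \<Rightarrow> Q b * w (b + (- 1) *\<^sub>R \<xi>))))"
        unfolding z prod.case real_norm_def by (rule order_trans[OF le abs_ge_self])
    qed
  qed measurable
qed

text \<open>By inversion \<open>\<phi>\<close> is itself a Fourier transform, and on that side
  partial derivatives are multiplications by coordinates, which commute.\<close>

lemma partial_deriv_commute:
  fixes \<phi> :: "real^'n::finite \<Rightarrow> complex"
  assumes S: "\<phi> \<in> schwartz"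
  shows "partial_deriv i (partial_deriv k \<phi>) = partial_deriv k (partial_deriv i \<phi>)"
proof -
  define \<psi> where "\<psi> = inverse_fourier \<phi>"
  have S\<psi>: "\<psi> \<in> schwartz" unfolding \<psi>_def by (rule schwartz_inverse_fourier[OF S])
  have *: "partial_deriv i (partial_deriv k (fourier \<psi>))
      = fourier (\<lambda>x. - \<i> * (of_real (x $ i) * (- \<i> * (of_real (x $ k) * \<psi> x))))" for i k
    using schwartz_cmult[OF schwartz_coord_mult[OF S\<psi>, of k], of "- \<i>"]
    by (simp only: partial_deriv_fourier[OF S\<psi>] partial_deriv_fourier)
  have "partial_deriv i (partial_deriv k (fourier \<psi>)) = partial_deriv k (partial_deriv i (fourier \<psi>))"
    unfolding * by (simp only: ac_simps)
  then show ?thesis by (simp only: \<psi>_def fourier_inverse_fourier[OF S])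
qed

text \<open>Divergence-freeness moves the derivative from \<open>K i b\<close> to \<open>K i \<xi>\<close>.\<close>

lemma trilinear_antisym:
  fixes K :: "'n::finite \<Rightarrow> real^'n \<Rightarrow> complex"
  assumes herm: "\<And>i \<xi>. K i (- \<xi>) = cnj (K i \<xi>)" and div: "\<And>\<xi>. (\<Sum>i\<in>UNIV. of_real (\<xi> $ i) * K i \<xi>) = 0"
    and t: "\<And>\<xi> b. t \<xi> b = (\<Sum>i\<in>UNIV. \<Sum>j\<in>UNIV. cnj (K i \<xi>) * K j (\<xi> - b) * (\<i> * (of_real (b $ j) * K i b)))"
  shows "t b \<xi> = - cnj (t \<xi> b)"
proof -
  \<comment> \<open>This sum contains all of the dependence on the direction of differentiation;
    divergence-freeness at \<open>\<xi> - b\<close> says that it takes the same value at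
    \<open>\<xi>\<close> and at \<open>b\<close>.\<close>
  define S where "S a = (\<Sum>j\<in>UNIV. of_real (a $ j) * cnj (K j (\<xi> - b)))" for a :: "real^'n"
  have "(\<Sum>j\<in>UNIV. of_real ((\<xi> - b) $ j) * cnj (K j (\<xi> - b))) = cnj (\<Sum>j\<in>UNIV. of_real ((\<xi> - b) $ j) * K j (\<xi> - b))"
    by simp
  then have "S \<xi> - S b = 0"
    unfolding div S_def by (simp add: sum_subtractf[symmetric] left_diff_distrib)
  then have SS: "S \<xi> = S b" by simp
  have h: "K j (b - \<xi>) = cnj (K j (\<xi> - b))" for j
    using herm[of j "\<xi> - b"] by simp
  have "t b \<xi> = (\<Sum>i\<in>UNIV. cnj (K i b) * K i \<xi> * \<i> * S \<xi>)"
    unfolding t h S_def sum_distrib_left by (intro sum.cong refl) (simp only: ac_simps)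
  also have "\<dots> = (\<Sum>i\<in>UNIV. cnj (K i b) * K i \<xi> * \<i> * S b)" by (simp only: SS)
  also have "\<dots> = - cnj (t \<xi> b)"
    unfolding t S_def sum_distrib_left cnj_sum sum_negf[symmetric]
    by (intro sum.cong refl) (simp add: ac_simps)
  finally show ?thesis .
qed

text \<open>Exchanging the two variables by Fubini shows that the integral equals minus its own
  conjugate.\<close>

lemma integral_antisym_Re:
  fixes t :: "'a::euclidean_space \<Rightarrow> 'a \<Rightarrow> complex"
  assumes int: "integrable (lborel \<Otimes>\<^sub>M lborel) (\<lambda>(\<xi>, b). t \<xi> b)" and anti: "\<And>\<xi> b. t b \<xi> = - cnj (t \<xi> b)"
  shows "Re (LINT \<xi>|lborel. (LINT b|lborel. t \<xi> b)) = 0"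
proof -
  define I where "I = (LINT \<xi>|lborel. (LINT b|lborel. t \<xi> b))"
  have "I = (LINT b|lborel. (LINT \<xi>|lborel. t \<xi> b))"
    unfolding I_def by (rule lborel_pair.Fubini_integral[OF int, symmetric])
  also have "\<dots> = (LINT b|lborel. (LINT \<xi>|lborel. - cnj (t b \<xi>)))"
    by (intro Bochner_Integration.integral_cong refl) (rule anti)
  also have "\<dots> = - cnj I"
    by (simp only: I_def Bochner_Integration.integral_minus Bochner_Integration.integral_cnj)
  finally have "Re I = Re (- cnj I)" by (rule arg_cong)
  then show ?thesis unfolding I_def[symmetric] by simp
qed

text \<open>After multiplication by \<open>\<xi> \<bullet> \<xi>\<close>, one of the two factors
  \<open>\<xi> $ k\<close> trades its index with \<open>A\<close>, and the divergence of
  \<open>K\<close> splits off. Cancelling \<open>\<xi> \<bullet> \<xi>\<close> needs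
  \<open>\<xi> \<noteq> 0\<close>.\<close>

lemma parallel_orthogonal:
  fixes \<xi> :: "real^'n::finite"
  assumes "\<xi> \<noteq> 0" and par: "\<And>i k. of_real (\<xi> $ k) * A i = of_real (\<xi> $ i) * (A k :: complex)"
    and div: "(\<Sum>i\<in>UNIV. of_real (\<xi> $ i) * K i) = (0 :: complex)"
  shows "(\<Sum>i\<in>UNIV. cnj (K i) * A i) = 0"
proof -
  have "of_real (\<xi> \<bullet> \<xi>) * (\<Sum>i\<in>UNIV. cnj (K i) * A i) = (\<Sum>i\<in>UNIV. \<Sum>k\<in>UNIV. cnj (K i) * (of_real (\<xi> $ k) * (of_real (\<xi> $ k) * A i)))"
    unfolding inner_vec_def of_real_sum sum_product
    by (subst sum.swap) (intro sum.cong refl, simp add: ac_simps)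
  also have "\<dots> = (\<Sum>i\<in>UNIV. \<Sum>k\<in>UNIV. (of_real (\<xi> $ i) * cnj (K i)) * (of_real (\<xi> $ k) * A k))"
    unfolding par[of _ _] by (intro sum.cong refl) (simp only: par ac_simps)
  also have "\<dots> = (\<Sum>i\<in>UNIV. of_real (\<xi> $ i) * cnj (K i)) * (\<Sum>k\<in>UNIV. of_real (\<xi> $ k) * A k)"
    by (simp only: sum_product)
  also have "(\<Sum>i\<in>UNIV. of_real (\<xi> $ i) * cnj (K i)) = cnj (\<Sum>i\<in>UNIV. of_real (\<xi> $ i) * K i)" by simp
  finally show ?thesis using assms(1) by (simp add: div)
qed

lemma L2_coord_mult:
  fixes K :: "real^'n::finite \<Rightarrow> complex"
  assumes [measurable]: "K \<in> borel_measurable borel" and K: "L2 (\<lambda>\<xi>. of_real (1 + norm \<xi>) * K \<xi>)"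
  shows "L2 (\<lambda>\<xi>. \<i> * (of_real (\<xi> $ j) * K \<xi>))"
proof (rule L2_mono[OF K])
  show "(\<lambda>\<xi>. \<i> * (of_real (\<xi> $ j) * K \<xi>)) \<in> borel_measurable borel" by measurable
  show "norm (\<i> * (of_real (\<xi> $ j) * K \<xi>)) \<le> norm (of_real (1 + norm \<xi>) * K \<xi>)" for \<xi>
    unfolding norm_mult norm_of_real using component_le_norm_cart[of \<xi> j]
    by (simp add: mult_right_mono)
qed

section \<open>The energy identity on the Fourier side\<close>

theorem corollary1:
  fixes U :: "3 \<Rightarrow> 3 functional" and r :: real
  assumes "\<forall>i. U i \<in> Hdot1"
    and "\<forall>i. real_valued (U i)"
    and "weak_steady_NS U"
    and "r > 6"
    and "\<forall>i. in_Lp_loc r (distr_fourier (U i))"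
  shows "\<forall>i. \<forall>\<phi>\<in>schwartz. U i \<phi> = 0"
proof -
  define c where "c = 1 / inversion_const TYPE(3)"
  obtain P N where PN: "\<forall>i j. is_distr_product (U j) (distr_deriv j (U i)) (N i j)"
      "\<forall>i. \<forall>\<phi>\<in>test_functions. - distr_laplacian (U i) \<phi> + (\<Sum>j\<in>UNIV. N i j \<phi>) + distr_deriv i P \<phi> = 0"
    and div: "\<forall>\<phi>\<in>test_functions. (\<Sum>i\<in>UNIV. distr_deriv i (U i) \<phi>) = 0"
    using assms(3) unfolding weak_steady_NS_def by (elim conjE exE)
  have "\<forall>i. \<exists>H. H \<in> borel_measurable borel \<and> L2 (\<lambda>\<xi>. of_real (1 + norm \<xi>) * H \<xi>) \<and>
    (\<forall>\<psi>\<in>schwartz. U i (fourier \<psi>) = (LINT \<xi>|lborel. H \<xi> * \<psi> \<xi>))"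
  proof
    fix i
    have 1: "U i \<in> Hdot1" "in_Lp_loc r (distr_fourier (U i))" "2 \<le> r" using assms by auto
    obtain H where "H \<in> borel_measurable borel" "L2 (\<lambda>\<xi>. of_real (1 + norm \<xi>) * H \<xi>)"
      "\<forall>\<psi>\<in>schwartz. U i (fourier \<psi>) = (LINT \<xi>|lborel. H \<xi> * \<psi> \<xi>)"
      by (rule Hdot1_spectrum[OF 1])
    then show "\<exists>H. H \<in> borel_measurable borel \<and> L2 (\<lambda>\<xi>. of_real (1 + norm \<xi>) * H \<xi>) \<and>
      (\<forall>\<psi>\<in>schwartz. U i (fourier \<psi>) = (LINT \<xi>|lborel. H \<xi> * \<psi> \<xi>))"
      by (intro exI[of _ H] conjI)
  qed
  from choice[OF this]
  obtain H where HH: "\<forall>i. H i \<in> borel_measurable borel \<and> L2 (\<lambda>\<xi>. of_real (1 + norm \<xi>) * H i \<xi>) \<and>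
    (\<forall>\<psi>\<in>schwartz. U i (fourier \<psi>) = (LINT \<xi>|lborel. H i \<xi> * \<psi> \<xi>))" by (elim exE)
  note H = HH[THEN spec, THEN conjunct1] HH[THEN spec, THEN conjunct2, THEN conjunct1]
    HH[THEN spec, THEN conjunct2, THEN conjunct2]
  have HL2: "L2 (H i)" for i by (rule L2_unweighted[OF H(1,2)])
  have spec_H: "has_spectrum (U i) (H i)" for i
    unfolding has_spectrum_def
  proof (intro conjI ballI L2_tempered_density HL2)
    fix \<phi> :: "real^3 \<Rightarrow> complex" assume "\<phi> \<in> test_functions"
    then have S: "\<phi> \<in> schwartz" by (rule test_schwartz)
    show "U i \<phi> = (LINT \<xi>|lborel. H i \<xi> * inverse_fourier \<phi> \<xi>)"
      using H(3)[of i, rule_format, OF schwartz_inverse_fourier[OF S]] by (simp only: fourier_inverse_fourier[OF S])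
  qed
  have herm: "AE \<xi> in lborel. H i (- \<xi>) = cnj (H i \<xi>)" for i
  proof (rule spectrum_hermitian[OF _ _ HL2 H(3)])
    show "linear_functional_on schwartz (U i)"
      using assms(1) unfolding Hdot1_def tempered_distribution_def by blast
    show "real_valued (U i)" using assms(2) by blast
  qed
  have "AE \<xi> in lborel. (\<Sum>i\<in>UNIV. \<i> * (of_real (\<xi> $ i) * H i \<xi>)) = 0"
    by (rule has_spectrum_zero[OF has_spectrum_sum[OF finite has_spectrum_distr_deriv[OF spec_H]]]) (rule div[rule_format])
  then have "AE \<xi> in lborel. (\<Sum>i\<in>UNIV. of_real (\<xi> $ i) * H i \<xi>) = 0"
    by eventually_elim (simp add: sum_distrib_left[symmetric])
  from exact_densities[OF H(1) herm this] obtain K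
    where KK: "\<forall>i. K i \<in> borel_measurable borel" "\<forall>i \<xi>. norm (K i \<xi>) \<le> norm (H i \<xi>)"
      "\<forall>i. AE \<xi> in lborel. H i \<xi> = K i \<xi>" "\<forall>i \<xi>. K i (- \<xi>) = cnj (K i \<xi>)"
      "\<forall>\<xi>. (\<Sum>i\<in>UNIV. of_real (\<xi> $ i) * K i \<xi>) = 0"
    by (elim exE conjE)
  note Kb[measurable] = KK(1)[THEN spec] and Kle = KK(2)[THEN spec, THEN spec] and HK = KK(3)[THEN spec]
    and Kherm = KK(4)[THEN spec, THEN spec] and Kdiv = KK(5)[THEN spec]
  have KwL2: "L2 (\<lambda>\<xi>. of_real (1 + norm \<xi>) * K i \<xi>)" for i
  proof (rule L2_mono[OF H(2)[of i]])
    show "(\<lambda>\<xi>. of_real (1 + norm \<xi>) * K i \<xi>) \<in> borel_measurable borel" by measurable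
    show "norm (of_real (1 + norm \<xi>) * K i \<xi>) \<le> norm (of_real (1 + norm \<xi>) * H i \<xi>)" for \<xi>
      unfolding norm_mult by (intro mult_left_mono Kle) simp
  qed
  have KL2: "L2 (K i)" for i by (rule L2_unweighted[OF Kb KwL2])
  have HK_int: "(LINT \<xi>|lborel. H i \<xi> * \<psi> \<xi>) = (LINT \<xi>|lborel. K i \<xi> * \<psi> \<xi>)" if "\<psi> \<in> schwartz" for i \<psi>
  proof (rule integral_cong_AE)
    show "AE \<xi> in lborel. H i \<xi> * \<psi> \<xi> = K i \<xi> * \<psi> \<xi>" using HK[of i] by eventually_elim simp
  qed (use H(1)[of i] Kb[of i] schwartz_borel[OF that] in simp_all)
  have spec_K: "has_spectrum (U i) (K i)" for i
    using spec_H[of i] HK_int[OF schwartz_inverse_fourier[OF test_schwartz]] L2_tempered_density[OF KL2]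
    unfolding has_spectrum_def by simp
  define E where "E i j \<xi> = \<i> * (of_real (\<xi> $ j) * K i \<xi>)" for i j and \<xi> :: "real^3"
  have EL2: "L2 (E i j)" for i j
    unfolding E_def[abs_def] by (rule L2_coord_mult[OF Kb KwL2])
  have spec_E: "has_spectrum (distr_deriv j (U i)) (E i j)" for i j
    unfolding E_def[abs_def] by (rule has_spectrum_distr_deriv[OF spec_K])
  \<comment> \<open>Both factors have square-integrable spectra, because the weight
    \<open>1 + norm \<xi>\<close> controls the field and its derivatives at once.\<close>
  have spec_N: "has_spectrum (N i j) (\<lambda>\<xi>. of_real c * convolution (K j) (E i j) \<xi>)" for i j
    unfolding c_def by (rule has_spectrum_product[OF PN(1)[THEN spec, THEN spec] spec_K KL2 spec_E EL2])
  define M where "M i \<xi> = (\<Sum>j\<in>UNIV. of_real c * convolution (K j) (E i j) \<xi>)" for i \<xi>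
  define Lap where "Lap i \<xi> = (\<Sum>l\<in>UNIV. \<i> * (of_real (\<xi> $ l) * E i l \<xi>))" for i \<xi>
  have "has_spectrum (distr_laplacian (U i)) (Lap i)" for i
    unfolding distr_laplacian_def[abs_def] Lap_def[abs_def]
    by (intro has_spectrum_sum finite has_spectrum_distr_deriv[OF spec_E])
  moreover have "has_spectrum (\<lambda>\<phi>. \<Sum>j\<in>UNIV. N i j \<phi>) (M i)" for i
    unfolding M_def[abs_def] by (intro has_spectrum_sum finite spec_N)
  ultimately have spec_Q: "has_spectrum (\<lambda>\<phi>. - distr_laplacian (U i) \<phi> + (\<Sum>j\<in>UNIV. N i j \<phi>)) (\<lambda>\<xi>. - Lap i \<xi> + M i \<xi>)" for i
    by (intro has_spectrum_add has_spectrum_uminus)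
  define Q where "Q i \<phi> = - distr_laplacian (U i) \<phi> + (\<Sum>j\<in>UNIV. N i j \<phi>)" for i \<phi>
  define A where "A i \<xi> = - Lap i \<xi> + M i \<xi>" for i \<xi>
  have spec_A: "has_spectrum (Q i) (A i)" for i
    using spec_Q[of i] by (simp add: Q_def[abs_def] A_def[abs_def])
  \<comment> \<open>The minus sign in \<open>distr_deriv\<close> cancels against moving the pressure
    gradient to the other side.\<close>
  have Q: "Q i \<phi> = P (partial_deriv i \<phi>)" if "\<phi> \<in> test_functions" for i \<phi>
    using PN(2)[rule_format, OF that, of i] by (simp add: Q_def distr_deriv_def)
  \<comment> \<open>The curl of \<open>Q\<close>: each term evaluates \<open>P\<close> at a mixed
    second derivative of \<open>\<phi>\<close>, and the two arguments agree. The spectra involved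
    are those of \<open>Q\<close>; none is ever assigned to \<open>P\<close>.\<close>
  have "AE \<xi> in lborel. \<i> * (of_real (\<xi> $ k) * A i \<xi>) + - (\<i> * (of_real (\<xi> $ i) * A k \<xi>)) = 0" for i k
  proof (rule has_spectrum_zero)
    show "has_spectrum (\<lambda>\<phi>. distr_deriv k (Q i) \<phi> + - distr_deriv i (Q k) \<phi>)
      (\<lambda>\<xi>. \<i> * (of_real (\<xi> $ k) * A i \<xi>) + - (\<i> * (of_real (\<xi> $ i) * A k \<xi>)))"
      by (intro has_spectrum_add has_spectrum_uminus has_spectrum_distr_deriv spec_A)
    fix \<phi> :: "real^3 \<Rightarrow> complex" assume \<phi>: "\<phi> \<in> test_functions"
    show "distr_deriv k (Q i) \<phi> + - distr_deriv i (Q k) \<phi> = 0"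
      unfolding distr_deriv_def Q[OF test_partial_deriv[OF \<phi>]] partial_deriv_commute[OF test_schwartz[OF \<phi>], of i k] by simp
  qed
  then have par': "AE \<xi> in lborel. of_real (\<xi> $ k) * A i \<xi> = of_real (\<xi> $ i) * A k \<xi>" for i k
    by (rule AE_mp) (auto simp: right_diff_distrib[symmetric])
  have par: "AE \<xi> in lborel. \<forall>i k. of_real (\<xi> $ k) * A i \<xi> = of_real (\<xi> $ i) * A k \<xi>"
    by (intro eventually_all_finite par')
  have nonzero: "AE \<xi> in lborel. \<xi> \<noteq> (0 :: real^3)"
    by (rule AE_lborel_singleton)
  \<comment> \<open>The integrand of the trilinear form, with \<open>E i j b\<close> written out in
    the shape that \<open>trilinear_antisym\<close> expects.\<close>
  define t where "t \<xi> b = (\<Sum>i\<in>UNIV. \<Sum>j\<in>UNIV. cnj (K i \<xi>) * K j (\<xi> - b) * (\<i> * (of_real (b $ j) * K i b)))" for \<xi> b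
  have cK: "L2 (\<lambda>\<xi>. of_real (1 + norm \<xi>) * cnj (K i \<xi>))" for i
  proof (rule L2_mono[OF KwL2[of i]])
    show "(\<lambda>\<xi>. of_real (1 + norm \<xi>) * cnj (K i \<xi>)) \<in> borel_measurable borel" by measurable
    show "norm (of_real (1 + norm \<xi>) * cnj (K i \<xi>)) \<le> norm (of_real (1 + norm \<xi>) * K i \<xi>)" for \<xi>
      by (simp only: norm_mult complex_mod_cnj)
  qed
  have tri: "integrable (lborel \<Otimes>\<^sub>M lborel) (\<lambda>(\<xi>, b). cnj (K i \<xi>) * K j (\<xi> - b) * E i j b)" for i j
    by (rule integrable_trilinear[OF _ Kb cK KwL2 EL2]) measurable
  have t_int: "integrable (lborel \<Otimes>\<^sub>M lborel) (\<lambda>(\<xi>, b). t \<xi> b)"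
  proof -
    have "integrable (lborel \<Otimes>\<^sub>M lborel) (\<lambda>z. \<Sum>i\<in>UNIV. \<Sum>j\<in>UNIV. (case z of (\<xi>, b) \<Rightarrow> cnj (K i \<xi>) * K j (\<xi> - b) * E i j b))"
      by (intro Bochner_Integration.integrable_sum tri)
    then show ?thesis by (simp add: t_def E_def case_prod_beta')
  qed
  have t_M: "of_real c * (LINT b|lborel. t \<xi> b) = (\<Sum>i\<in>UNIV. cnj (K i \<xi>) * M i \<xi>)" for \<xi>
  proof -
    have i: "integrable lborel (\<lambda>b. K j (\<xi> - b) * E i j b)" for i j
      by (intro L2_mult_integrable L2_reflect KL2 EL2)
    have "(LINT b|lborel. t \<xi> b) = (LINT b|lborel. (\<Sum>i\<in>UNIV. \<Sum>j\<in>UNIV. cnj (K i \<xi>) * (K j (\<xi> - b) * E i j b)))"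
      by (simp only: t_def E_def mult.assoc)
    also have "\<dots> = (\<Sum>i\<in>UNIV. (LINT b|lborel. (\<Sum>j\<in>UNIV. cnj (K i \<xi>) * (K j (\<xi> - b) * E i j b))))"
      by (rule Bochner_Integration.integral_sum) (intro Bochner_Integration.integrable_sum integrable_mult_right i)
    also have "\<dots> = (\<Sum>i\<in>UNIV. \<Sum>j\<in>UNIV. (LINT b|lborel. cnj (K i \<xi>) * (K j (\<xi> - b) * E i j b)))"
      by (intro sum.cong refl Bochner_Integration.integral_sum integrable_mult_right i)
    also have "\<dots> = (\<Sum>i\<in>UNIV. \<Sum>j\<in>UNIV. cnj (K i \<xi>) * convolution (K j) (E i j) \<xi>)"
      by (simp only: integral_mult_right_zero convolution_def)
    finally show ?thesis
      by (simp only: M_def sum_distrib_left mult.left_commute[of _ "of_real c"])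
  qed
  define S where "S \<xi> = (\<Sum>i\<in>UNIV. (norm \<xi> * norm (K i \<xi>))\<^sup>2)" for \<xi>
  \<comment> \<open>The orthogonality of \<open>K\<close> and \<open>A\<close> at
    \<open>\<xi>\<close>, solved for the dissipation density; \<open>- Lap\<close> contributes the
    factor \<open>\<xi> \<bullet> \<xi>\<close> because \<open>\<i> * \<i> = - 1\<close>.\<close>
  have S: "AE \<xi> in lborel. complex_of_real (S \<xi>) = - (of_real c * (LINT b|lborel. t \<xi> b))"
    using par nonzero
  proof eventually_elim
    case (elim \<xi>)
    have "(\<Sum>i\<in>UNIV. cnj (K i \<xi>) * A i \<xi>) = 0"
      by (rule parallel_orthogonal[OF elim(2) _ Kdiv]) (use elim(1) in blast)
    moreover have "A i \<xi> = of_real (\<xi> \<bullet> \<xi>) * K i \<xi> + M i \<xi>" for i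
    proof -
      have "\<i> * (x * (\<i> * (x * k))) = - (x * (x * k))" for x k :: complex
      proof -
        have "\<i> * (x * (\<i> * (x * k))) = (\<i> * \<i>) * (x * (x * k))" by (simp only: ac_simps)
        then show ?thesis by simp
      qed
      then have "- Lap i \<xi> = (\<Sum>l\<in>UNIV. of_real (\<xi> $ l) * (of_real (\<xi> $ l) * K i \<xi>))"
        by (simp only: Lap_def E_def sum_negf minus_minus)
      also have "\<dots> = of_real (\<xi> \<bullet> \<xi>) * K i \<xi>"
        by (simp only: inner_vec_def inner_real_def of_real_sum of_real_mult sum_distrib_right mult.assoc)
      finally show ?thesis by (simp only: A_def)
    qed
    ultimately have "(\<Sum>i\<in>UNIV. cnj (K i \<xi>) * (of_real (\<xi> \<bullet> \<xi>) * K i \<xi>)) + (\<Sum>i\<in>UNIV. cnj (K i \<xi>) * M i \<xi>) = 0"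
      by (simp add: distrib_left sum.distrib)
    moreover have "(\<Sum>i\<in>UNIV. cnj (K i \<xi>) * (of_real (\<xi> \<bullet> \<xi>) * K i \<xi>)) = complex_of_real (S \<xi>)"
    proof -
      have "cnj k * (of_real (\<xi> \<bullet> \<xi>) * k) = complex_of_real ((norm \<xi> * norm k)\<^sup>2)" for k
        by (simp only: power_mult_distrib of_real_mult complex_norm_square[of k] dot_square_norm ac_simps)
      then show ?thesis by (simp only: S_def of_real_sum)
    qed
    ultimately show ?case unfolding t_M by (simp add: eq_neg_iff_add_eq_0)
  qed
  have Sm[measurable]: "S \<in> borel_measurable borel" unfolding S_def[abs_def] by measurable
  have T_int: "integrable lborel (\<lambda>\<xi>. LINT b|lborel. t \<xi> b)" by (rule lborel_pair.integrable_fst[OF t_int])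
  \<comment> \<open>Integrability of \<open>S\<close> is read off from the identity, whose
    right-hand side is integrable by Fubini.\<close>
  have "integrable lborel (\<lambda>\<xi>. - (of_real c * (LINT b|lborel. t \<xi> b)))"
    by (intro Bochner_Integration.integrable_minus integrable_mult_right T_int)
  then have "integrable lborel (\<lambda>\<xi>. complex_of_real (S \<xi>))"
    by (subst integrable_cong_AE[OF _ _ S]) (auto simp: borel_measurable_integrable)
  from integrable_Re[OF this] have S_int: "integrable lborel S" by simp
  have "complex_of_real (LINT \<xi>|lborel. S \<xi>) = (LINT \<xi>|lborel. complex_of_real (S \<xi>))"
    by (rule integral_complex_of_real[symmetric])
  also have "\<dots> = (LINT \<xi>|lborel. - (of_real c * (LINT b|lborel. t \<xi> b)))"
  proof (rule integral_cong_AE[OF _ _ S])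
    show "(\<lambda>\<xi>. - (of_real c * (LINT b|lborel. t \<xi> b))) \<in> borel_measurable lborel"
      using T_int by (intro borel_measurable_integrable Bochner_Integration.integrable_minus integrable_mult_right)
  qed measurable
  also have "\<dots> = - (of_real c * (LINT \<xi>|lborel. (LINT b|lborel. t \<xi> b)))"
    by (simp only: Bochner_Integration.integral_minus integral_mult_right_zero)
  finally have "Re (complex_of_real (LINT \<xi>|lborel. S \<xi>)) = Re (- (of_real c * (LINT \<xi>|lborel. (LINT b|lborel. t \<xi> b))))"
    by (rule arg_cong)
  \<comment> \<open>Since \<open>c\<close> is real, a vanishing real part survives multiplication by
    it; the left-hand side is real, so the whole integral of \<open>S\<close> vanishes.\<close>
  moreover have "Re (LINT \<xi>|lborel. (LINT b|lborel. t \<xi> b)) = 0"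
    by (rule integral_antisym_Re[OF t_int trilinear_antisym[OF Kherm Kdiv t_def]])
  ultimately have "(LINT \<xi>|lborel. S \<xi>) = 0" by simp
  then have "AE \<xi> in lborel. S \<xi> = 0"
    by (subst (asm) integral_nonneg_eq_0_iff_AE[OF S_int]) (auto simp: S_def intro!: sum_nonneg)
  with nonzero have K0: "AE \<xi> in lborel. K i \<xi> = 0" for i
  proof eventually_elim
    case (elim \<xi>)
    then have "\<forall>i\<in>UNIV. (norm \<xi> * norm (K i \<xi>))\<^sup>2 = 0"
      unfolding S_def by (subst (asm) sum_nonneg_eq_0_iff) auto
    with elim show ?case by simp
  qed
  show ?thesis
  proof (intro allI ballI)
    fix i and \<phi> :: "real^3 \<Rightarrow> complex" assume S: "\<phi> \<in> schwartz"
    have S': "inverse_fourier \<phi> \<in> schwartz" by (rule schwartz_inverse_fourier[OF S])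
    \<comment> \<open>The representation by \<open>H\<close> holds on the whole Schwartz space, so
      the conclusion is not confined to test functions.\<close>
    have "U i \<phi> = (LINT \<xi>|lborel. K i \<xi> * inverse_fourier \<phi> \<xi>)"
      using H(3)[of i, rule_format, OF S'] by (simp only: fourier_inverse_fourier[OF S] HK_int[OF S'])
    also have "\<dots> = 0"
      using K0[of i] by (intro integral_eq_zero_AE) (auto elim: AE_mp)
    finally show "U i \<phi> = 0" .
  qed
qed

end
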